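(* Let $\pi$ be the Koopman representation of the infinite dihedral group $D_\infty=\langle a,t \mid a^2=t^2=1\rangle$ on $L^2(\partial T,\mu)$, where $T$ is the $2$-regular rooted tree, and consider the pencil $$A_\pi(z)=z_0 I+z_1\pi(a)+z_2\pi(t)+z_3\pi(at),\qquad z=(z_0,z_1,z_2,z_3).$$ The polynomial map on $\mathbb{P}^3$ induced by the operator recursion of this pencil is $$F(z)=[\,z_0^2-z_1^2 : z_0z_2-z_1z_3 : z_0z_2-z_1z_3 : z_2^2-z_3^2\,],$$ and its Julia set satisfies $$\mathcal{J}(F)=\bigcup_{x\in[-1,1]}\{z\in\mathbb{P}^3 : z_0^2+z_3^2-z_1^2-z_2^2+2x(z_0z_3-z_1z_2)=0\}=p(A_\pi).$$
   Context: $\mathbb{P}^3$ is complex projective space and $\phi$ is the canonical projection from $\mathbb{C}^4$ (minus the origin $O$) onto $\mathbb{P}^3$. Projective spectrum: $P(A_\pi)=\{z\in\mathbb{C}^4 : A_\pi(z) \text{ is not invertible}\}$ and $p(A_\pi)=\phi(P(A_\pi))=\{z\in\mathbb{P}^3 : A_\pi(z)\text{ is not invertible}\}$. Koopman representation: The vertices of $T$ are the finite words over $\{0,1\}$; its boundary $\partial T$ is the set of infinite words, with the uniform Bernoulli measure $\mu$ (each cylinder of a word of length $p$ has measure $2^{-p}$). $D_\infty$ acts on $T$ and $\partial T$ by the recursive rules $a=\sigma$, $t=(a,t)$, i.e. $a(0w)=1w$, $a(1w)=0w$, $t(0w)=0\,a(w)$, $t(1w)=1\,t(w)$. Then $(\pi(g)f)(x)=f(g^{-1}x)$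 for $f\in L^2(\partial T,\mu)$. Under $L^2(\partial T,\mu)\simeq L^2(\partial T,\mu)\oplus L^2(\partial T,\mu)$ (restriction to the two first-level subtrees), $\pi(a)=\begin{pmatrix} 0 & I \\ I & 0 \end{pmatrix}$ and $\pi(t)=\begin{pmatrix} \pi(a) & 0 \\ 0 & \pi(t) \end{pmatrix}$. Induced map: let $\mathcal{H}_n$ be the ($2^n$-dimensional, invariant) span of the characteristic functions of the cylinders of words of length $n$, let $\pi_n=\pi|_{\mathcal{H}_n}$, and let $A_{\pi_n}(z)=z_0+z_1\pi_n(a)+z_2\pi_n(t)+z_3\pi_n(at)$. That the operator recursion induces the map $F$ means that $\det A_{\pi_{n+1}}(z)=\det A_{\pi_n}(F(z))$ for all $n\ge 0$ and $z\in\mathbb{C}^4$, where $F$ also denotes the homogeneous polynomial lift $\mathbb{C}^4\to\mathbb{C}^4$ given by the displayed coordinates. Dynamics: For a map $H$ of $\mathbb{P}^3$ given by homogeneous polynomials of the same degree $d\ge2$, with lift also denoted $H:\mathbb{C}^4\to\mathbb{C}^4$, $H^n$ is the $n$-th iterate, the $n$-th indeterminacy set is $I_n=\phi(H^{-n}(O))$ (images of nonzero vectors mapped to $O$ by the $n$-th iterate of the lift), and the extended indeterminacy set is $E=\overline{\bigcup_{n\ge1}I_n}$. A point $p\in\mathbb{P}^3\setminus E$ is a Fatou point if for every $\epsilon>0$ there is a neighborhood $U$ of $p$ such that $\operatorname{diam}H^n(U\setminus E)<\epsilon$ for all $n$, where the diameter is with respect to the Fubini–Study metric. The Fatou set $\mathcal{F}(H)$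 is the set of Fatou points and the Julia set is $\mathcal{J}(H)=\mathbb{P}^3\setminus\mathcal{F}(H)$ (so $E\subset\mathcal{J}(H)$). *)

theory Defs
  imports "HOL-Probability.Probability" "Jordan_Normal_Form.Determinant"
begin

text \<open>From here on \<open>$\<close> is component selection in \<open>complex ^ 4\<close>.\<close>

no_notation Matrix.vec_index (infixl "$" 100)

datatype gen = GenA | GenT

text \<open>The congruence on words in the generators that is generated by \<open>a a = 1\<close> and \<open>t t = 1\<close>.
  As the generators are involutions, positive words suffice and word reversal is inversion.\<close>

inductive dihedral_eq :: "gen list \<Rightarrow> gen list \<Rightarrow> bool" where
  dihedral_eq_refl: "dihedral_eq u u"
| dihedral_eq_sym: "dihedral_eq u v \<Longrightarrow> dihedral_eq v u"
| dihedral_eq_trans: "dihedral_eq u v \<Longrightarrow> dihedral_eq v w \<Longrightarrow> dihedral_eq u w"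
| dihedral_eq_cancel: "dihedral_eq (u @ [g, g] @ v) (u @ v)"

lemma dihedral_eq_append_left: "dihedral_eq u v \<Longrightarrow> dihedral_eq (w @ u) (w @ v)"
proof (induction rule: dihedral_eq.induct)
  case (dihedral_eq_cancel u g v)
  show ?case using dihedral_eq.intros(4)[of "w @ u" g v] by simp
qed (blast intro: dihedral_eq.intros)+

lemma dihedral_eq_append_right: "dihedral_eq u v \<Longrightarrow> dihedral_eq (u @ w) (v @ w)"
proof (induction rule: dihedral_eq.induct)
  case (dihedral_eq_cancel u g v)
  show ?case using dihedral_eq.intros(4)[of u g "v @ w"] by simp
qed (blast intro: dihedral_eq.intros)+

lemma dihedral_eq_rev: "dihedral_eq u v \<Longrightarrow> dihedral_eq (rev u) (rev v)"
proof (induction rule: dihedral_eq.induct)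
  case (dihedral_eq_cancel u g v)
  show ?case using dihedral_eq.intros(4)[of "rev v" g "rev u"] by simp
qed (blast intro: dihedral_eq.intros)+

lemma dihedral_eq_rev_append: "dihedral_eq (rev u @ u) []"
proof (induction u)
  case (Cons g u)
  show ?case
    using dihedral_eq_trans[OF dihedral_eq_cancel[of "rev u" g u] Cons.IH] by simp
qed (simp add: dihedral_eq_refl)

quotient_type dihedral = "gen list" / dihedral_eq
  by (intro equivpI reflpI sympI transpI) (blast intro: dihedral_eq.intros)+

instantiation dihedral :: "{monoid_mult, inverse}"
begin

lift_definition one_dihedral :: dihedral is "[]" .

lift_definition times_dihedral :: "dihedral \<Rightarrow> dihedral \<Rightarrow> dihedral" is "(@)"
  by (meson dihedral_eq_trans dihedral_eq_append_left dihedral_eq_append_right)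

lift_definition inverse_dihedral :: "dihedral \<Rightarrow> dihedral" is rev
  by (rule dihedral_eq_rev)

definition divide_dihedral :: "dihedral \<Rightarrow> dihedral \<Rightarrow> dihedral" where
  "divide_dihedral g h = g * inverse h"

instance
  by standard (transfer; simp add: dihedral_eq_refl)+

end

lemma dihedral_group: "Groups.group ((*) :: dihedral \<Rightarrow> dihedral \<Rightarrow> dihedral) 1 inverse"
proof -
  have "inverse g * g = 1" for g :: dihedral
    by transfer (rule dihedral_eq_rev_append)
  then show ?thesis by unfold_locales simp_all
qed

lift_definition dih_a :: dihedral is "[GenA]" .
lift_definition dih_t :: dihedral is "[GenT]" .

lemma dih_a_square: "dih_a * dih_a = 1"
  by transfer (use dihedral_eq_cancel[of "[]" GenA "[]"] in simp)

lemma dih_t_square: "dih_t * dih_t = 1"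
  by transfer (use dihedral_eq_cancel[of "[]" GenT "[]"] in simp)

text \<open>The boundary of the binary rooted tree consists of the infinite words \<open>bool stream\<close>,
  with \<open>False\<close> for the letter 0 and \<open>True\<close> for the letter 1.\<close>

primcorec flip_a :: "bool stream \<Rightarrow> bool stream" where
  "flip_a x = (\<not> shd x) ## stl x"

primcorec flip_t :: "bool stream \<Rightarrow> bool stream" where
  "shd (flip_t x) = shd x"
| "stl (flip_t x) = (if shd x then flip_t (stl x) else flip_a (stl x))"

lemma flip_a_Stream: "flip_a (False ## w) = True ## w" "flip_a (True ## w) = False ## w"
  by (simp_all add: flip_a.code)

lemma flip_t_Stream:
  "flip_t (False ## w) = False ## flip_a w" "flip_t (True ## w) = True ## flip_t w"
  by (simp_all add: stream.expand)

lemma flip_a_flip_a: "flip_a (flip_a x) = x"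
  by (simp add: stream.expand)

lemma flip_t_flip_t: "flip_t (flip_t x) = x"
proof (coinduction arbitrary: x rule: stream.coinduct_strong)
  case Eq_stream
  then show ?case
    by (cases "shd x")
      (simp_all only: flip_t.simps flip_a_flip_a if_True if_False simp_thms, blast)
qed

fun gen_act :: "gen \<Rightarrow> bool stream \<Rightarrow> bool stream" where
  "gen_act GenA = flip_a"
| "gen_act GenT = flip_t"

lift_definition dih_act :: "dihedral \<Rightarrow> bool stream \<Rightarrow> bool stream" is "foldr gen_act"
proof -
  fix u v :: "gen list"
  have inv: "gen_act g (gen_act g x) = x" for g x
    by (cases g) (simp_all add: flip_a_flip_a flip_t_flip_t)
  assume "dihedral_eq u v"
  then show "foldr gen_act u = foldr gen_act v"
    by (induction rule: dihedral_eq.induct) (auto simp: fun_eq_iff inv)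
qed

lemma dih_act_one: "dih_act 1 x = x"
  by transfer simp

lemma dih_act_mult: "dih_act (g * h) x = dih_act g (dih_act h x)"
  by transfer simp

lemma dih_act_gens: "dih_act dih_a = flip_a" "dih_act dih_t = flip_t"
  by (transfer, simp add: fun_eq_iff)+

text \<open>Each cylinder of a word of length \<open>p\<close> has measure \<open>(1 / 2) ^ p\<close>.\<close>

definition bernoulli_measure :: "bool stream measure" where
  "bernoulli_measure = stream_space (measure_pmf (bernoulli_pmf (1 / 2)))"

text \<open>Elements of the complex Hilbert space \<open>L\<^sup>2(M)\<close> are handled through representatives:
  square-integrable functions, with equality almost everywhere.\<close>

definition L2_functions :: "'a measure \<Rightarrow> ('a \<Rightarrow> complex) set" where
  "L2_functions M = {f \<in> borel_measurable M. integrable M (\<lambda>x. (cmod (f x))\<^sup>2)}"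

definition L2_norm :: "'a measure \<Rightarrow> ('a \<Rightarrow> complex) \<Rightarrow> real" where
  "L2_norm M f = sqrt (LINT x|M. (cmod (f x))\<^sup>2)"

definition bounded_L2_operator ::
    "'a measure \<Rightarrow> (('a \<Rightarrow> complex) \<Rightarrow> ('a \<Rightarrow> complex)) \<Rightarrow> bool" where
  "bounded_L2_operator M T \<longleftrightarrow>
     (\<forall>f\<in>L2_functions M. T f \<in> L2_functions M) \<and>
     (\<forall>f\<in>L2_functions M. \<forall>g\<in>L2_functions M.
        (AE x in M. f x = g x) \<longrightarrow> (AE x in M. T f x = T g x)) \<and>
     (\<forall>f\<in>L2_functions M. \<forall>g\<in>L2_functions M.
        AE x in M. T (\<lambda>y. f y + g y) x = T f x + T g x) \<and>
     (\<forall>c. \<forall>f\<in>L2_functions M. AE x in M. T (\<lambda>y. c * f y) x = c * T f x) \<and>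
     (\<exists>K. \<forall>f\<in>L2_functions M. L2_norm M (T f) \<le> K * L2_norm M f)"

definition invertible_L2_operator ::
    "'a measure \<Rightarrow> (('a \<Rightarrow> complex) \<Rightarrow> ('a \<Rightarrow> complex)) \<Rightarrow> bool" where
  "invertible_L2_operator M T \<longleftrightarrow>
     (\<exists>S. bounded_L2_operator M S \<and>
        (\<forall>f\<in>L2_functions M. (AE x in M. T (S f) x = f x) \<and> (AE x in M. S (T f) x = f x)))"

definition koopman :: "dihedral \<Rightarrow> (bool stream \<Rightarrow> complex) \<Rightarrow> (bool stream \<Rightarrow> complex)" where
  "koopman g f = (\<lambda>x. f (dih_act (inverse g) x))"

text \<open>The index type \<open>4\<close> has the elements \<open>0, 1, 2, 3\<close>, so the homogeneous coordinates
  \<open>z\<^sub>0, \<dots>, z\<^sub>3\<close> are \<open>z $ 0, \<dots>, z $ 3\<close>.\<close>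

definition koopman_pencil ::
    "complex ^ 4 \<Rightarrow> (bool stream \<Rightarrow> complex) \<Rightarrow> (bool stream \<Rightarrow> complex)" where
  "koopman_pencil z f =
     (\<lambda>x. z $ 0 * f x + z $ 1 * koopman dih_a f x + z $ 2 * koopman dih_t f x
          + z $ 3 * koopman (dih_a * dih_t) f x)"

definition cylinder_indicator :: "bool list \<Rightarrow> bool stream \<Rightarrow> complex" where
  "cylinder_indicator w = indicator {x. stake (length w) x = w}"

definition level_basis :: "nat \<Rightarrow> nat \<Rightarrow> bool stream \<Rightarrow> complex" where
  "level_basis n i = cylinder_indicator (List.n_lists n [False, True] ! i)"

text \<open>Matrix, with respect to \<open>level_basis n 0, \<dots>, level_basis n (2 ^ n - 1)\<close>, of the
  restriction of an operator to the span \<open>H\<^sub>n\<close> of these functions; it is well defined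
  whenever \<open>T\<close> maps them into \<open>H\<^sub>n\<close>.\<close>

definition level_matrix ::
    "nat \<Rightarrow> ((bool stream \<Rightarrow> complex) \<Rightarrow> (bool stream \<Rightarrow> complex)) \<Rightarrow> complex mat" where
  "level_matrix n T =
     (THE M. M \<in> carrier_mat (2 ^ n) (2 ^ n) \<and>
        (\<forall>j<2 ^ n. T (level_basis n j) = (\<lambda>x. \<Sum>i<2 ^ n. M $$ (i, j) * level_basis n i x)))"

lemma stake_flip_a_cong: "stake n x = stake n y \<Longrightarrow> stake n (flip_a x) = stake n (flip_a y)"
  by (cases n) simp_all

lemma stake_flip_t_cong: "stake n x = stake n y \<Longrightarrow> stake n (flip_t x) = stake n (flip_t y)"
proof (induction n arbitrary: x y)
  case (Suc n)
  then have "shd x = shd y" "stake n (stl x) = stake n (stl y)" by simp_all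
  with Suc.IH[of "stl x" "stl y"] stake_flip_a_cong[of n "stl x" "stl y"] show ?case
    by (simp only: stake.simps flip_t.simps split: if_split) blast
qed simp

lemma stake_dih_act_cong:
  "stake n x = stake n y \<Longrightarrow> stake n (dih_act g x) = stake n (dih_act g y)"
proof (transfer fixing: n x y)
  fix gs :: "gen list"
  assume xy: "stake n x = stake n y"
  show "stake n (foldr gen_act gs x) = stake n (foldr gen_act gs y)"
  proof (induction gs)
    case (Cons g gs)
    show ?case
    proof (cases g)
      case GenA
      show ?thesis using stake_flip_a_cong[OF Cons.IH] by (simp only: GenA foldr.simps o_apply gen_act.simps)
    next
      case GenT
      show ?thesis using stake_flip_t_cong[OF Cons.IH] by (simp only: GenT foldr.simps o_apply gen_act.simps)
    qed
  qed (simp add: xy)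
qed

lemma length_binary_words: "length (List.n_lists n [False, True]) = 2 ^ n"
proof -
  have "length [False, True] = 2" by simp
  then show ?thesis by (metis length_n_lists)
qed

lemma level_basis_eq:
  assumes "i < 2 ^ n"
  shows "level_basis n i x = (if stake n x = List.n_lists n [False, True] ! i then 1 else 0)"
proof -
  have "List.n_lists n [False, True] ! i \<in> set (List.n_lists n [False, True])"
    using assms by (intro nth_mem) (simp only: length_binary_words)
  then have "length (List.n_lists n [False, True] ! i) = n"
    by (simp add: set_n_lists)
  then show ?thesis by (simp add: level_basis_def cylinder_indicator_def indicator_def)
qed

text \<open>The Koopman operators leave \<open>H\<^sub>n\<close> invariant, so their level matrices are well defined.\<close>

lemma koopman_level_matrix_ex1:
  "\<exists>!M. M \<in> carrier_mat (2 ^ n) (2 ^ n) \<and>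
     (\<forall>j<2 ^ n. koopman g (level_basis n j) =
        (\<lambda>x. \<Sum>i<2 ^ n. M $$ (i, j) * level_basis n i x))"
proof -
  define W where "W = List.n_lists n [False, True]"
  have len: "length W = 2 ^ n" and dist: "distinct W"
    and setW: "set W = {w. length w = n}"
    by (auto simp: W_def length_binary_words set_n_lists distinct_n_lists)
  define p where "p i = (W ! i) @- sconst False" for i
  have lenW: "length (W ! i) = n" if "i < 2 ^ n" for i
    using nth_mem[of i W] that len setW by auto
  have stp: "stake n (p i) = W ! i" if "i < 2 ^ n" for i
    using lenW[OF that] by (simp add: p_def stake_shift)
  have expand: "(\<Sum>i<2 ^ n. c i * level_basis n i x) = c k"
    if "k < 2 ^ n" "stake n x = W ! k" for c :: "nat \<Rightarrow> complex" and k x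
  proof -
    have "(\<Sum>i<2 ^ n. c i * level_basis n i x) = (\<Sum>i<2 ^ n. if i = k then c i else 0)"
    proof (rule sum.cong)
      fix i :: nat assume "i \<in> {..<2 ^ n}"
      then show "c i * level_basis n i x = (if i = k then c i else 0)"
        using that len dist by (auto simp: level_basis_eq nth_eq_iff_index_eq simp flip: W_def)
    qed simp
    then show ?thesis using that by simp
  qed
  define M where "M = mat (2 ^ n) (2 ^ n) (\<lambda>(i, j). koopman g (level_basis n j) (p i))"
  show ?thesis
  proof (rule ex1I[of _ M], intro conjI allI impI)
    show "M \<in> carrier_mat (2 ^ n) (2 ^ n)" by (simp add: M_def)
    fix j :: nat assume j: "j < 2 ^ n"
    show "koopman g (level_basis n j) = (\<lambda>x. \<Sum>i<2 ^ n. M $$ (i, j) * level_basis n i x)"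
    proof
      fix x
      have "stake n x \<in> set W" by (simp add: setW)
      then obtain k where k: "k < 2 ^ n" "stake n x = W ! k"
        using len by (metis in_set_conv_nth)
      then have "stake n (dih_act (inverse g) x) = stake n (dih_act (inverse g) (p k))"
        by (intro stake_dih_act_cong) (simp add: stp)
      then have "koopman g (level_basis n j) x = koopman g (level_basis n j) (p k)"
        using j by (simp add: koopman_def level_basis_eq)
      also have "\<dots> = M $$ (k, j)" using k j by (simp add: M_def)
      finally show "koopman g (level_basis n j) x = (\<Sum>i<2 ^ n. M $$ (i, j) * level_basis n i x)"
        by (simp add: expand[OF k])
    qed
  next
    fix N
    assume N: "N \<in> carrier_mat (2 ^ n) (2 ^ n) \<and>
      (\<forall>j<2 ^ n. koopman g (level_basis n j) =
        (\<lambda>x. \<Sum>i<2 ^ n. N $$ (i, j) * level_basis n i x))"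
    show "N = M"
    proof (rule eq_matI)
      fix i j assume "i < dim_row M" "j < dim_col M"
      then have ij: "i < 2 ^ n" "j < 2 ^ n" by (simp_all add: M_def)
      then have "N $$ (i, j) = koopman g (level_basis n j) (p i)"
        using N expand[OF ij(1) stp[OF ij(1)], of "\<lambda>i. N $$ (i, j)"] by simp
      then show "N $$ (i, j) = M $$ (i, j)" using ij by (simp add: M_def)
    qed (use N in \<open>auto simp: M_def\<close>)
  qed
qed

definition koopman_matrix :: "nat \<Rightarrow> dihedral \<Rightarrow> complex mat" where
  "koopman_matrix n g = level_matrix n (koopman g)"

definition pencil_matrix :: "nat \<Rightarrow> complex ^ 4 \<Rightarrow> complex mat" where
  "pencil_matrix n z =
     z $ 0 \<cdot>\<^sub>m 1\<^sub>m (2 ^ n) + z $ 1 \<cdot>\<^sub>m koopman_matrix n dih_a + z $ 2 \<cdot>\<^sub>m koopman_matrix n dih_t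
     + z $ 3 \<cdot>\<^sub>m koopman_matrix n (dih_a * dih_t)"

definition proj_rel :: "complex ^ 4 \<Rightarrow> complex ^ 4 \<Rightarrow> bool" where
  "proj_rel v w \<longleftrightarrow> v \<noteq> 0 \<and> w \<noteq> 0 \<and> (\<exists>c. c \<noteq> 0 \<and> w = c *s v)"

quotient_type proj3 = "complex ^ 4" / partial: proj_rel
proof (rule part_equivpI)
  show "\<exists>x. proj_rel x x"
    unfolding proj_rel_def by (rule exI[of _ "\<chi> i. 1"]) (auto simp: Finite_Cartesian_Product.vec_eq_iff vector_scalar_mult_def intro!: exI[of _ 1])
  show "symp proj_rel"
  proof (rule sympI)
    fix v w assume "proj_rel v w"
    then obtain c where "v \<noteq> 0" "w \<noteq> 0" "c \<noteq> 0" "w = c *s v"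
      unfolding proj_rel_def by blast
    then have "v = inverse c *s w" by (simp add: vector_smult_assoc)
    with \<open>v \<noteq> 0\<close> \<open>w \<noteq> 0\<close> \<open>c \<noteq> 0\<close> show "proj_rel w v"
      unfolding proj_rel_def by (metis nonzero_imp_inverse_nonzero)
  qed
  show "transp proj_rel"
    unfolding proj_rel_def
    by (rule transpI) (metis mult_eq_0_iff vector_smult_assoc)
qed

text \<open>The canonical projection is meaningful on nonzero vectors only.\<close>

definition proj_point :: "complex ^ 4 \<Rightarrow> proj3" where
  "proj_point v = abs_proj3 v"

lemma proj_point_eq_iff:
  "v \<noteq> 0 \<Longrightarrow> w \<noteq> 0 \<Longrightarrow> proj_point v = proj_point w \<longleftrightarrow> (\<exists>c. c \<noteq> 0 \<and> w = c *s v)"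
proof -
  assume nz: "v \<noteq> 0" "w \<noteq> 0"
  have refl: "proj_rel u u" if "u \<noteq> 0" for u
    unfolding proj_rel_def using that by (metis vector_smult_lid zero_neq_one)
  show ?thesis
    using Quotient_rel[OF Quotient_proj3, of v w] refl[OF nz(1)] refl[OF nz(2)] nz
    unfolding proj_point_def proj_rel_def by blast
qed

instantiation proj3 :: topological_space
begin

definition open_proj3 :: "proj3 set \<Rightarrow> bool" where
  "open_proj3 U \<longleftrightarrow> open {v. v \<noteq> 0 \<and> proj_point v \<in> U}"

instance
proof
  have "{v :: complex ^ 4. v \<noteq> 0 \<and> proj_point v \<in> UNIV} = - {0}" by auto
  then show "open (UNIV :: proj3 set)" unfolding open_proj3_def by (metis open_Compl closed_singleton)
next
  fix S T :: "proj3 set"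
  assume "open S" "open T"
  moreover have "{v. v \<noteq> 0 \<and> proj_point v \<in> S \<inter> T} =
      {v. v \<noteq> 0 \<and> proj_point v \<in> S} \<inter> {v. v \<noteq> 0 \<and> proj_point v \<in> T}" by auto
  ultimately show "open (S \<inter> T)" unfolding open_proj3_def by (simp add: open_Int)
next
  fix K :: "proj3 set set"
  assume "\<forall>S\<in>K. open S"
  moreover have "{v. v \<noteq> 0 \<and> proj_point v \<in> \<Union>K} =
      (\<Union>S\<in>K. {v. v \<noteq> 0 \<and> proj_point v \<in> S})" by auto
  ultimately show "open (\<Union>K)" unfolding open_proj3_def by auto
qed

end

definition hermitian_prod :: "complex ^ 4 \<Rightarrow> complex ^ 4 \<Rightarrow> complex" where
  "hermitian_prod v w = (\<Sum>i\<in>UNIV. v $ i * cnj (w $ i))"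

lemma norm_smult_vec: "norm (c *s v) = cmod c * norm (v :: complex ^ 4)"
proof -
  have "(\<Sum>i\<in>UNIV. (norm ((c *s v) $ i))\<^sup>2) = (cmod c)\<^sup>2 * (\<Sum>i\<in>UNIV. (norm (v $ i))\<^sup>2)"
    by (simp add: norm_mult power_mult_distrib sum_distrib_left)
  then show ?thesis by (simp add: norm_vec_def L2_set_def real_sqrt_mult)
qed

lemma hermitian_prod_smult:
  "hermitian_prod (c *s v) (d *s w) = c * cnj d * hermitian_prod v w"
proof -
  have "(c *s v) $ i * cnj ((d *s w) $ i) = c * cnj d * (v $ i * cnj (w $ i))" for i
    by simp
  then show ?thesis unfolding hermitian_prod_def sum_distrib_left by (simp only:)
qed

text \<open>Fubini--Study distance: the angle between complex lines.\<close>

lift_definition fubini_study :: "proj3 \<Rightarrow> proj3 \<Rightarrow> real" is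
  "\<lambda>v w. arccos (cmod (hermitian_prod v w) / (norm v * norm w))"
proof -
  fix v v' w w' :: "complex ^ 4"
  assume "proj_rel v v'" "proj_rel w w'"
  then obtain c d where nz: "c \<noteq> 0" "d \<noteq> 0" and eq: "v' = c *s v" "w' = d *s w"
    unfolding proj_rel_def by blast
  have "cmod (hermitian_prod (c *s v) (d *s w)) / (norm (c *s v) * norm (d *s w))
      = (cmod c * cmod d * cmod (hermitian_prod v w))
        / ((cmod c * cmod d) * (norm v * norm w))"
    by (simp only: hermitian_prod_smult norm_smult_vec norm_mult complex_mod_cnj mult.assoc mult.left_commute)
  also have "\<dots> = cmod (hermitian_prod v w) / (norm v * norm w)"
    using nz by simp
  finally show "arccos (cmod (hermitian_prod v w) / (norm v * norm w)) =
      arccos (cmod (hermitian_prod v' w') / (norm v' * norm w'))"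
    unfolding eq by (rule arg_cong[OF sym])
qed

definition fs_diameter :: "proj3 set \<Rightarrow> real" where
  "fs_diameter S = (if S = {} then 0 else SUP (p, q)\<in>S \<times> S. fubini_study p q)"

definition proj_zeros :: "(complex ^ 4 \<Rightarrow> complex) \<Rightarrow> proj3 set" where
  "proj_zeros q = proj_point ` {v. v \<noteq> 0 \<and> q v = 0}"

definition joint_spectrum :: "proj3 set" where
  "joint_spectrum =
     proj_point ` ({z. \<not> invertible_L2_operator bernoulli_measure (koopman_pencil z)} - {0})"

text \<open>Throughout, \<open>H\<close> is the lift to \<open>\<complex>\<^sup>4\<close> of a map of projective space.\<close>

definition indeterminacy_set :: "(complex ^ 4 \<Rightarrow> complex ^ 4) \<Rightarrow> nat \<Rightarrow> proj3 set" where
  "indeterminacy_set H n = proj_point ` {v. v \<noteq> 0 \<and> (H ^^ n) v = 0}"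

definition extended_indeterminacy_set :: "(complex ^ 4 \<Rightarrow> complex ^ 4) \<Rightarrow> proj3 set" where
  "extended_indeterminacy_set H = closure (\<Union>n\<in>{1..}. indeterminacy_set H n)"

text \<open>Image of a set under the \<open>n\<close>-th iterate of the induced map; for homogeneous \<open>H\<close> and
  a set disjoint from the \<open>n\<close>-th indeterminacy set, no vector is mapped to \<open>0\<close> here.\<close>

definition proj_iterate_image ::
    "(complex ^ 4 \<Rightarrow> complex ^ 4) \<Rightarrow> nat \<Rightarrow> proj3 set \<Rightarrow> proj3 set" where
  "proj_iterate_image H n S = (\<lambda>v. proj_point ((H ^^ n) v)) ` {v. v \<noteq> 0 \<and> proj_point v \<in> S}"

definition fatou_set :: "(complex ^ 4 \<Rightarrow> complex ^ 4) \<Rightarrow> proj3 set" where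
  "fatou_set H =
     {p. p \<notin> extended_indeterminacy_set H \<and>
         (\<forall>\<epsilon>>0. \<exists>U. open U \<and> p \<in> U \<and>
            (\<forall>n. fs_diameter (proj_iterate_image H n (U - extended_indeterminacy_set H)) < \<epsilon>))}"

definition julia_set :: "(complex ^ 4 \<Rightarrow> complex ^ 4) \<Rightarrow> proj3 set" where
  "julia_set H = UNIV - fatou_set H"

definition dihedral_map :: "complex ^ 4 \<Rightarrow> complex ^ 4" where
  "dihedral_map z =
     (\<chi> i. if i = 0 then (z $ 0)\<^sup>2 - (z $ 1)\<^sup>2
          else if i = 1 then z $ 0 * z $ 2 - z $ 1 * z $ 3
          else if i = 2 then z $ 0 * z $ 2 - z $ 1 * z $ 3
          else (z $ 2)\<^sup>2 - (z $ 3)\<^sup>2)"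

lemma dihedral_map_homogeneous: "dihedral_map (c *s z) = c\<^sup>2 *s dihedral_map z"
  unfolding Finite_Cartesian_Product.vec_eq_iff dihedral_map_def vector_scalar_mult_def
  by (auto simp: power2_eq_square right_diff_distrib mult_ac)

definition quadric_form :: "real \<Rightarrow> complex ^ 4 \<Rightarrow> complex" where
  "quadric_form x z =
     (z $ 0)\<^sup>2 + (z $ 3)\<^sup>2 - (z $ 1)\<^sup>2 - (z $ 2)\<^sup>2
     + 2 * complex_of_real x * (z $ 0 * z $ 3 - z $ 1 * z $ 2)"

end

theory Submission
  imports Defs
begin

text \<open>
  Everything is governed by two quadratic forms on \<open>\<complex>\<^sup>4\<close>,
  \<open>P = z\<^sub>0\<^sup>2 + z\<^sub>3\<^sup>2 - z\<^sub>1\<^sup>2 - z\<^sub>2\<^sup>2\<close> and \<open>Q = z\<^sub>0 z\<^sub>3 - z\<^sub>1 z\<^sub>2\<close>; the quadric with parameter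
  \<open>x\<close> is \<open>P + 2 x Q = 0\<close>. The two forms have two independent meanings.

  For the operators: \<open>A(z)\<close> times its ``adjugate''
  \<open>z\<^sub>0 + z\<^sub>3 ta - z\<^sub>1 a - z\<^sub>2 t\<close> equals \<open>P + Q (at + ta)\<close>, in either order
  (\<open>pencil_adjugate\<close>). As \<open>at\<close> acts unitarily and \<open>ta\<close> is its inverse, \<open>(at + ta) / 2\<close>
  has spectrum in \<open>[-1, 1]\<close>, so \<open>A(z)\<close> is invertible when \<open>z\<close> is on no quadric with
  \<open>x \<in> [-1, 1]\<close>. The inverse is explicit: if \<open>Q \<noteq> 0\<close>, then \<open>P + Q (u + 1 / u)\<close> has no zero on the unit
  circle, so its reciprocal is a multiple of the geometric two-sided Laurent series
  \<open>\<Sum>n. c\<^bsup>|n|\<^esup> u\<^sup>n\<close> with \<open>|c| < 1\<close>, and \<open>at\<close> may be substituted for \<open>u\<close>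
  (\<open>laurent_operator_inverse\<close>).

  For the dynamics: \<open>P(F(z)) = P\<^sup>2 - 2 Q\<^sup>2\<close> and \<open>Q(F(z)) = - Q\<^sup>2\<close>. Hence
  \<open>x = - P / (2 Q)\<close> semiconjugates \<open>F\<close> to the Chebyshev polynomial \<open>2 x\<^sup>2 - 1\<close>, whose
  Julia set is \<open>[-1, 1]\<close>; and the common zeros of \<open>P\<close> and \<open>Q\<close> are exactly the
  extended indeterminacy set. The fibres are handled by solving the recursion: with \<open>L\<close> and
  \<open>M\<close> the roots of \<open>X\<^sup>2 - P X + Q\<^sup>2\<close>, the iterates are combinations of
  \<open>L\<^sup>N\<close> and \<open>M\<^sup>N\<close> with \<open>N = 2\<^sup>n\<close> (\<open>iterate_closed_form\<close>). Off the quadrics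
  \<open>|L| \<noteq> |M|\<close>, and the iterates converge locally uniformly to a continuous map, so such points
  are Fatou points (\<open>iterates_equicontinuous\<close>).

  One density statement serves both remaining inclusions. The zeros of the iterated Chebyshev
  polynomials are dense in \<open>[-1, 1]\<close>, so arbitrarily close to a point \<open>z\<close> of a quadric with
  \<open>x \<in> [-1, 1]\<close>, and for every large \<open>k\<close>, there is \<open>v\<close> with \<open>P(F\<^sup>k(v)) = 0\<close>
  (\<open>identity_coeff_iterate_zero_dense\<close>). The next iterate is of the form \<open>(a, m, m, a)\<close>, and
  all later ones are multiples of \<open>(1, 0, 0, -1)\<close>, which is orthogonal to it. Two such points with
  values of \<open>k\<close> at least \<open>2\<close> apart are therefore driven to orthogonal lines at the same time, which contradicts
  equicontinuity (\<open>proj_point_mem_julia_set\<close>). On the other hand, the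
  determinant recursion gives \<open>det A\<^sub>n(v) = \<Sum>i. F\<^sup>n(v)\<^sub>i\<close>, which vanishes for
  \<open>n = k + 2\<close>; a kernel vector of \<open>A\<^sub>n(v)\<close> is an approximate kernel vector of \<open>A(z)\<close>, and
  \<open>A(z)\<close> is not invertible (\<open>not_invertible_koopman_pencil\<close>).
\<close>

section \<open>The determinant recursion\<close>

definition binary_word :: "nat \<Rightarrow> nat \<Rightarrow> bool list" where
  "binary_word n i = List.n_lists n [False, True] ! i"

lemma length_binary_word: "i < 2 ^ n \<Longrightarrow> length (binary_word n i) = n"
  unfolding binary_word_def
  by (metis length_binary_words length_n_lists_elem nth_mem)

lemma binary_word_eq_iff:
  "i < 2 ^ n \<Longrightarrow> j < 2 ^ n \<Longrightarrow> binary_word n i = binary_word n j \<longleftrightarrow> i = j"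
  unfolding binary_word_def
  by (rule nth_eq_iff_index_eq) (simp_all add: distinct_n_lists length_binary_words)

lemma binary_word_Suc:
  assumes "i < 2 ^ n"
  shows "binary_word (Suc n) (2 * i) = False # binary_word n i"
    and "binary_word (Suc n) (Suc (2 * i)) = True # binary_word n i"
proof -
  have "concat (map (\<lambda>ys. [False # ys, True # ys]) L) ! (2 * i) = False # L ! i \<and>
        concat (map (\<lambda>ys. [False # ys, True # ys]) L) ! (Suc (2 * i)) = True # L ! i"
    if "i < length L" for L
    using that
  proof (induction L arbitrary: i)
    case (Cons l L)
    then show ?case by (cases i) simp_all
  qed simp
  from this[of "List.n_lists n [False, True]"] assms
  show "binary_word (Suc n) (2 * i) = False # binary_word n i"
    and "binary_word (Suc n) (Suc (2 * i)) = True # binary_word n i"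
    by (simp_all add: binary_word_def length_binary_words)
qed

lemma level_basis_stake:
  "i < 2 ^ n \<Longrightarrow> level_basis n i x = (if stake n x = binary_word n i then 1 else 0)"
  by (simp add: level_basis_eq binary_word_def)

lemma stake_binary_word: "i < 2 ^ n \<Longrightarrow> stake n (binary_word n i @- s) = binary_word n i"
  by (simp add: stake_shift length_binary_word)

lemma sum_level_basis:
  assumes "k < 2 ^ n" "stake n x = binary_word n k"
  shows "(\<Sum>i<2 ^ n. c i * level_basis n i x) = c k"
proof -
  have "(\<Sum>i<2 ^ n. c i * level_basis n i x) = (\<Sum>i<2 ^ n. if i = k then c i else 0)"
    using assms by (intro sum.cong) (auto simp: level_basis_stake binary_word_eq_iff)
  then show ?thesis using assms(1) by simp
qed

lemma
  shows koopman_matrix_carrier: "koopman_matrix n g \<in> carrier_mat (2 ^ n) (2 ^ n)"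
    and koopman_level_basis: "j < 2 ^ n \<Longrightarrow> koopman g (level_basis n j) =
        (\<lambda>x. \<Sum>i<2 ^ n. koopman_matrix n g $$ (i, j) * level_basis n i x)"
  using theI'[OF koopman_level_matrix_ex1[of n g]]
  unfolding koopman_matrix_def level_matrix_def by blast+

lemma koopman_matrix_entry:
  assumes "i < 2 ^ n" "j < 2 ^ n" "stake n x = binary_word n i"
  shows "koopman_matrix n g $$ (i, j)
     = (if stake n (dih_act (inverse g) x) = binary_word n j then 1 else 0)"
proof -
  have "koopman_matrix n g $$ (i, j) = koopman g (level_basis n j) x"
    unfolding koopman_level_basis[OF assms(2)] by (rule sum_level_basis[OF assms(1,3), symmetric])
  then show ?thesis using assms by (simp add: koopman_def level_basis_stake)
qed

lemma dihedral_inverse_mult: "inverse (g * h) = inverse h * inverse (g :: dihedral)"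
  by transfer (simp add: dihedral_eq_refl)

lemma dihedral_inverse_gens: "inverse dih_a = dih_a" "inverse dih_t = dih_t"
  by (transfer, simp add: dihedral_eq_refl)+

lemma koopman_mult: "koopman (g * h) f = koopman g (koopman h f)"
  by (simp add: koopman_def dihedral_inverse_mult dih_act_mult)

lemma koopman_sum: "koopman g (\<lambda>x. \<Sum>i\<in>I. c i * f i x) = (\<lambda>x. \<Sum>i\<in>I. c i * koopman g (f i) x)"
  by (simp add: koopman_def)

lemma koopman_matrix_apply:
  assumes c: "c \<in> carrier_vec (2 ^ n)"
  shows "koopman g (\<lambda>x. \<Sum>j<2 ^ n. vec_index c j * level_basis n j x)
     = (\<lambda>x. \<Sum>i<2 ^ n. vec_index (koopman_matrix n g *\<^sub>v c) i * level_basis n i x)"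
proof
  fix x
  let ?K = "koopman_matrix n g"
  have K: "?K \<in> carrier_mat (2 ^ n) (2 ^ n)" by (rule koopman_matrix_carrier)
  have "koopman g (\<lambda>x. \<Sum>j<2 ^ n. vec_index c j * level_basis n j x) x
      = (\<Sum>j<2 ^ n. vec_index c j * (\<Sum>i<2 ^ n. ?K $$ (i, j) * level_basis n i x))"
    unfolding koopman_sum by (intro sum.cong) (simp_all add: koopman_level_basis)
  also have "\<dots> = (\<Sum>i<2 ^ n. (\<Sum>j<2 ^ n. ?K $$ (i, j) * vec_index c j) * level_basis n i x)"
    unfolding sum_distrib_left sum_distrib_right
    by (subst sum.swap) (simp add: mult_ac)
  also have "\<dots> = (\<Sum>i<2 ^ n. vec_index (?K *\<^sub>v c) i * level_basis n i x)"
    using K c by (intro sum.cong) (auto simp: scalar_prod_def atLeast0LessThan)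
  finally show "koopman g (\<lambda>x. \<Sum>j<2 ^ n. vec_index c j * level_basis n j x) x
     = (\<Sum>i<2 ^ n. vec_index (?K *\<^sub>v c) i * level_basis n i x)" .
qed

text \<open>The cylinder functions of one level have disjoint nonempty supports, so coefficients can be
compared one at a time by evaluating at a word extended arbitrarily to an infinite one.\<close>

lemma level_basis_coeffs_eq:
  assumes "(\<lambda>x. \<Sum>i<2 ^ n. c i * level_basis n i x) = (\<lambda>x. \<Sum>i<2 ^ n. d i * level_basis n i x)"
    and "k < 2 ^ n"
  shows "c k = d k"
  using fun_cong[OF assms(1), of "binary_word n k @- sconst False"] assms(2)
  by (simp add: sum_level_basis[OF assms(2) stake_binary_word[OF assms(2)]])

lemma koopman_matrix_mult:
  "koopman_matrix n (g * h) = koopman_matrix n g * koopman_matrix n h"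
proof (rule eq_matI)
  let ?G = "koopman_matrix n g" and ?H = "koopman_matrix n h"
  have car: "?G \<in> carrier_mat (2 ^ n) (2 ^ n)" "?H \<in> carrier_mat (2 ^ n) (2 ^ n)"
    by (rule koopman_matrix_carrier)+
  show "dim_row (koopman_matrix n (g * h)) = dim_row (?G * ?H)"
    and "dim_col (koopman_matrix n (g * h)) = dim_col (?G * ?H)"
    using car koopman_matrix_carrier[of n "g * h"] by auto
  fix i j assume "i < dim_row (?G * ?H)" "j < dim_col (?G * ?H)"
  then have i: "i < 2 ^ n" and j: "j < 2 ^ n" using car by auto
  have colH: "Matrix.col ?H j \<in> carrier_vec (2 ^ n)" using car j by auto
  have "(\<lambda>x. \<Sum>i<2 ^ n. koopman_matrix n (g * h) $$ (i, j) * level_basis n i x)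
      = koopman g (\<lambda>x. \<Sum>k<2 ^ n. ?H $$ (k, j) * level_basis n k x)"
    by (simp only: koopman_level_basis[OF j, symmetric] koopman_mult)
  also have "\<dots> = koopman g (\<lambda>x. \<Sum>k<2 ^ n. vec_index (Matrix.col ?H j) k * level_basis n k x)"
    using car j by (intro arg_cong[of _ _ "koopman g"] ext sum.cong) auto
  also have "\<dots> = (\<lambda>x. \<Sum>i<2 ^ n. vec_index (?G *\<^sub>v Matrix.col ?H j) i * level_basis n i x)"
    by (rule koopman_matrix_apply[OF colH])
  finally have "koopman_matrix n (g * h) $$ (i, j) = vec_index (?G *\<^sub>v Matrix.col ?H j) i"
    by (rule level_basis_coeffs_eq[OF _ i])
  then show "koopman_matrix n (g * h) $$ (i, j) = (?G * ?H) $$ (i, j)"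
    using car i j by auto
qed

lemma koopman_matrix_one: "koopman_matrix n 1 = 1\<^sub>m (2 ^ n)"
proof (rule eq_matI)
  have inv1: "inverse (1 :: dihedral) = 1" by transfer (simp add: dihedral_eq_refl)
  fix i j assume "i < dim_row (1\<^sub>m (2 ^ n) :: complex mat)" "j < dim_col (1\<^sub>m (2 ^ n) :: complex mat)"
  then show "koopman_matrix n 1 $$ (i, j) = 1\<^sub>m (2 ^ n) $$ (i, j)"
    by (subst koopman_matrix_entry[where x = "binary_word n i @- sconst False"])
       (auto simp: inv1 dih_act_one stake_binary_word binary_word_eq_iff)
qed (use koopman_matrix_carrier[of n 1] in auto)

text \<open>The matrices are permutation matrices, so the matrix of an involution is symmetric. This
makes the blocks of the pencil symmetric, so that transposing the pencil only exchanges the two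
off-diagonal ones.\<close>

lemma koopman_matrix_involution_sym:
  assumes "g * g = 1" "inverse g = g" "i < 2 ^ n" "j < 2 ^ n"
  shows "koopman_matrix n g $$ (i, j) = koopman_matrix n g $$ (j, i)"
proof -
  define x y where "x = binary_word n i @- sconst False" and "y = binary_word n j @- sconst False"
  have x: "stake n x = binary_word n i" and y: "stake n y = binary_word n j"
    using assms(3,4) by (simp_all add: x_def y_def stake_binary_word)
  have inv: "dih_act g (dih_act g u) = u" for u
    by (simp add: dih_act_mult[symmetric] assms(1) dih_act_one)
  have "stake n (dih_act g x) = stake n y \<longleftrightarrow> stake n (dih_act g y) = stake n x"
    using stake_dih_act_cong[of n "dih_act g x" y g] stake_dih_act_cong[of n "dih_act g y" x g]
    by (auto simp: inv)
  then show ?thesis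
    by (simp add: koopman_matrix_entry[OF assms(3,4) x] koopman_matrix_entry[OF assms(4,3) y]
        assms(2) x y)
qed

text \<open>The enumeration of words varies the first letter fastest, while the operator recursion splits
the tree by the first letter. This permutation of the indices lists the words beginning with
\<open>0\<close> before those beginning with \<open>1\<close>; it is the identity beyond \<open>2 N\<close>, as a
permutation of \<open>{0..<2 * N}\<close> has to be.\<close>

definition first_letter_index :: "nat \<Rightarrow> nat \<Rightarrow> nat" where
  "first_letter_index N i = (if i < N then 2 * i else if i < 2 * N then Suc (2 * (i - N)) else i)"

lemma first_letter_index_permutes: "first_letter_index N permutes {0..<2 * N}"
proof (rule bij_imp_permutes)
  have inj: "inj_on (first_letter_index N) {0..<2 * N}"
    by (rule inj_onI) (auto simp: first_letter_index_def split: if_splits; presburger)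
  have "first_letter_index N ` {0..<2 * N} \<subseteq> {0..<2 * N}"
    by (auto simp: first_letter_index_def)
  then show "bij_betw (first_letter_index N) {0..<2 * N} {0..<2 * N}"
    using inj by (simp add: bij_betw_def endo_inj_surj)
qed (simp add: first_letter_index_def)

lemma det_permute_both:
  fixes A :: "complex mat"
  assumes A: "A \<in> carrier_mat n n" and p: "p permutes {0..<n}"
  shows "Determinant.det (mat n n (\<lambda>(i, j). A $$ (p i, p j))) = Determinant.det A"
proof -
  define B where "B = mat n n (\<lambda>(i, j). A $$ (p i, j))"
  have B: "B \<in> carrier_mat n n" by (simp add: B_def)
  have pi: "p i < n" if "i < n" for i
    using permutes_in_image[OF p, of i] that by simp
  have "mat n n (\<lambda>(i, j). A $$ (p i, p j)) = transpose_mat (mat n n (\<lambda>(i, j). transpose_mat B $$ (p i, j)))"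
    by (rule eq_matI) (auto simp: B_def pi)
  also have "Determinant.det \<dots> = Determinant.det (mat n n (\<lambda>(i, j). transpose_mat B $$ (p i, j)))"
    by (rule Determinant.det_transpose[OF mat_carrier])
  also have "\<dots> = signof p * Determinant.det (transpose_mat B)"
    using B by (intro det_permute_rows[OF _ p]) simp
  also have "Determinant.det (transpose_mat B) = Determinant.det B" by (rule Determinant.det_transpose[OF B])
  also have "Determinant.det B = signof p * Determinant.det A"
    unfolding B_def by (rule det_permute_rows[OF A p])
  finally show ?thesis by (simp add: sign_def)
qed

lemma pencil_matrix_carrier: "pencil_matrix n z \<in> carrier_mat (2 ^ n) (2 ^ n)"
  unfolding pencil_matrix_def by (intro add_carrier_mat smult_carrier_mat koopman_matrix_carrier)

lemma pencil_matrix_entry: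
  assumes "i < 2 ^ n" "j < 2 ^ n"
  shows "pencil_matrix n z $$ (i, j) = z $ 0 * (if i = j then 1 else 0)
     + z $ 1 * koopman_matrix n dih_a $$ (i, j) + z $ 2 * koopman_matrix n dih_t $$ (i, j)
     + z $ 3 * koopman_matrix n (dih_a * dih_t) $$ (i, j)"
  using assms koopman_matrix_carrier[of n dih_a] koopman_matrix_carrier[of n dih_t]
    koopman_matrix_carrier[of n "dih_a * dih_t"]
  by (auto simp: pencil_matrix_def)

text \<open>The operator recursions \<open>a = \<sigma>\<close>, \<open>t = (a, t)\<close> and hence \<open>at = \<sigma> (a, t)\<close>, read off
entrywise: \<open>b\<close> and \<open>c\<close> are the first letters, \<open>i\<close> and \<open>j\<close> index the remaining words.\<close>

lemma koopman_matrix_Suc_entries: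
  fixes b c :: bool
  assumes ij: "i < 2 ^ n" "j < 2 ^ n"
  defines "I \<equiv> \<lambda>b i. if b then Suc (2 * i) else 2 * i"
  shows "koopman_matrix (Suc n) dih_a $$ (I b i, I c j) = (if b \<noteq> c \<and> i = j then 1 else 0)"
    and "koopman_matrix (Suc n) dih_t $$ (I b i, I c j) =
      (if b \<noteq> c then 0 else if b then koopman_matrix n dih_t $$ (i, j) else koopman_matrix n dih_a $$ (i, j))"
    and "koopman_matrix (Suc n) (dih_a * dih_t) $$ (I b i, I c j) =
      (if b = c then 0 else if b then koopman_matrix n dih_a $$ (i, j) else koopman_matrix n dih_t $$ (i, j))"
proof -
  define x where "x = binary_word n i @- sconst False"
  have x: "stake n x = binary_word n i" using ij by (simp add: x_def stake_binary_word)
  have I: "I b i < 2 ^ Suc n" "I c j < 2 ^ Suc n" using ij by (auto simp: I_def)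
  have wI: "binary_word (Suc n) (I b k) = b # binary_word n k" if "k < 2 ^ n" for b k
    using binary_word_Suc[OF that] by (simp add: I_def)
  have bx: "stake (Suc n) (b ## x) = binary_word (Suc n) (I b i)"
    by (simp add: wI ij x)
  note entry = koopman_matrix_entry[OF I bx] koopman_matrix_entry[OF ij x]
  have ta: "flip_t (b ## y) = b ## (if b then flip_t y else flip_a y)" for b y
    by (cases b) (simp_all add: flip_t_Stream)
  have aa: "flip_a (b ## y) = (\<not> b) ## y" for b y
    by (cases b) (simp_all add: flip_a_Stream)
  show "koopman_matrix (Suc n) dih_a $$ (I b i, I c j) = (if b \<noteq> c \<and> i = j then 1 else 0)"
    by (auto simp: entry dihedral_inverse_gens dih_act_gens aa wI ij x binary_word_eq_iff)
  show "koopman_matrix (Suc n) dih_t $$ (I b i, I c j) =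
      (if b \<noteq> c then 0 else if b then koopman_matrix n dih_t $$ (i, j) else koopman_matrix n dih_a $$ (i, j))"
    by (auto simp: entry dihedral_inverse_gens dih_act_gens ta wI ij)
  show "koopman_matrix (Suc n) (dih_a * dih_t) $$ (I b i, I c j) =
      (if b = c then 0 else if b then koopman_matrix n dih_a $$ (i, j) else koopman_matrix n dih_t $$ (i, j))"
    by (auto simp: entry dihedral_inverse_mult dihedral_inverse_gens dih_act_mult dih_act_gens
        ta aa wI ij)
qed

lemma dihedral_map_nth:
  "dihedral_map z $ 0 = (z $ 0)\<^sup>2 - (z $ 1)\<^sup>2"
  "dihedral_map z $ 1 = z $ 0 * z $ 2 - z $ 1 * z $ 3"
  "dihedral_map z $ 2 = z $ 0 * z $ 2 - z $ 1 * z $ 3"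
  "dihedral_map z $ 3 = (z $ 2)\<^sup>2 - (z $ 3)\<^sup>2"
  by (simp_all add: dihedral_map_def)

lemma index_add_smult_one:
  assumes "G \<in> carrier_mat N N" "i < N" "j < N"
  shows "(c \<cdot>\<^sub>m 1\<^sub>m N + d \<cdot>\<^sub>m G) $$ (i, j) = c * (if i = j then 1 else 0) + d * (G $$ (i, j) :: complex)"
  using assms by auto

lemma affine_mat_mult:
  fixes G H :: "complex mat"
  assumes G: "G \<in> carrier_mat N N" and H: "H \<in> carrier_mat N N"
  shows "(c \<cdot>\<^sub>m 1\<^sub>m N + d \<cdot>\<^sub>m G) * (c' \<cdot>\<^sub>m 1\<^sub>m N + d' \<cdot>\<^sub>m H)
    = (c * c') \<cdot>\<^sub>m 1\<^sub>m N + (c' * d) \<cdot>\<^sub>m G + (c * d') \<cdot>\<^sub>m H + (d * d') \<cdot>\<^sub>m (G * H)"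
proof -
  have "(c \<cdot>\<^sub>m 1\<^sub>m N + d \<cdot>\<^sub>m G) * (c' \<cdot>\<^sub>m 1\<^sub>m N + d' \<cdot>\<^sub>m H)
     = (c \<cdot>\<^sub>m 1\<^sub>m N) * (c' \<cdot>\<^sub>m 1\<^sub>m N + d' \<cdot>\<^sub>m H) + (d \<cdot>\<^sub>m G) * (c' \<cdot>\<^sub>m 1\<^sub>m N + d' \<cdot>\<^sub>m H)"
    using G H by (intro add_mult_distrib_mat[of _ N N _ _ N]) auto
  also have "(c \<cdot>\<^sub>m 1\<^sub>m N) * (c' \<cdot>\<^sub>m 1\<^sub>m N + d' \<cdot>\<^sub>m H) = c \<cdot>\<^sub>m (c' \<cdot>\<^sub>m 1\<^sub>m N + d' \<cdot>\<^sub>m H)"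
    using H by (subst mult_smult_assoc_mat[of _ N N _ N]) auto
  also have "(d \<cdot>\<^sub>m G) * (c' \<cdot>\<^sub>m 1\<^sub>m N + d' \<cdot>\<^sub>m H)
     = d \<cdot>\<^sub>m (G * (c' \<cdot>\<^sub>m 1\<^sub>m N + d' \<cdot>\<^sub>m H))"
    using G H by (intro mult_smult_assoc_mat[of _ N N _ N]) auto
  also have "G * (c' \<cdot>\<^sub>m 1\<^sub>m N + d' \<cdot>\<^sub>m H) = G * (c' \<cdot>\<^sub>m 1\<^sub>m N) + G * (d' \<cdot>\<^sub>m H)"
    using G H by (intro mult_add_distrib_mat[of _ N N _ N]) auto
  also have "G * (c' \<cdot>\<^sub>m 1\<^sub>m N) = c' \<cdot>\<^sub>m G"
    using G by (subst mult_smult_distrib[of _ N N _ N]) auto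
  also have "G * (d' \<cdot>\<^sub>m H) = d' \<cdot>\<^sub>m (G * H)"
    using G H by (intro mult_smult_distrib[of _ N N _ N]) auto
  finally have eq: "(c \<cdot>\<^sub>m 1\<^sub>m N + d \<cdot>\<^sub>m G) * (c' \<cdot>\<^sub>m 1\<^sub>m N + d' \<cdot>\<^sub>m H)
     = c \<cdot>\<^sub>m (c' \<cdot>\<^sub>m 1\<^sub>m N + d' \<cdot>\<^sub>m H) + d \<cdot>\<^sub>m (c' \<cdot>\<^sub>m G + d' \<cdot>\<^sub>m (G * H))" .
  have GH: "G * H \<in> carrier_mat N N" using G H by simp
  show ?thesis
    unfolding eq using G H GH
    by (intro eq_matI) (auto simp: algebra_simps simp del: index_mult_mat(1))
qed

text \<open>After sorting by the first letter and transposing, the pencil is a block matrix whose blocks in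
the first row are affine in \<open>\<pi>\<^sub>n(a)\<close> and those in the second row affine in \<open>\<pi>\<^sub>n(t)\<close>. The
two lower blocks commute, so the determinant is that of \<open>A D - B C\<close>, which multiplies out
to the pencil at \<open>F(z)\<close>. The transposition moves the commuting blocks from a common column
into a common row, as the determinant formula requires.\<close>

lemma det_pencil_Suc:
  "Determinant.det (pencil_matrix (Suc n) z) = Determinant.det (pencil_matrix n (dihedral_map z))"
proof -
  define N where "N = (2 :: nat) ^ n"
  define G H where "G = koopman_matrix n dih_a" and "H = koopman_matrix n dih_t"
  have G: "G \<in> carrier_mat N N" and H: "H \<in> carrier_mat N N"
    unfolding G_def H_def N_def by (rule koopman_matrix_carrier)+
  have GG: "G * G = 1\<^sub>m N" and HH: "H * H = 1\<^sub>m N"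
    by (simp_all add: G_def H_def N_def koopman_matrix_mult[symmetric] dih_a_square dih_t_square
        koopman_matrix_one)
  have GH: "G * H = koopman_matrix n (dih_a * dih_t)"
    by (simp add: G_def H_def koopman_matrix_mult)
  have symG: "G $$ (i, j) = G $$ (j, i)" and symH: "H $$ (i, j) = H $$ (j, i)"
    if "i < N" "j < N" for i j
    using that koopman_matrix_involution_sym[OF dih_a_square dihedral_inverse_gens(1)]
      koopman_matrix_involution_sym[OF dih_t_square dihedral_inverse_gens(2)]
    by (auto simp: G_def H_def N_def)
  define A B C D where "A = z $ 0 \<cdot>\<^sub>m 1\<^sub>m N + z $ 2 \<cdot>\<^sub>m G" and "B = z $ 1 \<cdot>\<^sub>m 1\<^sub>m N + z $ 3 \<cdot>\<^sub>m G"
    and "C = z $ 1 \<cdot>\<^sub>m 1\<^sub>m N + z $ 3 \<cdot>\<^sub>m H" and "D = z $ 0 \<cdot>\<^sub>m 1\<^sub>m N + z $ 2 \<cdot>\<^sub>m H"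
  have car: "A \<in> carrier_mat N N" "B \<in> carrier_mat N N" "C \<in> carrier_mat N N" "D \<in> carrier_mat N N"
    using G H by (simp_all add: A_def B_def C_def D_def)
  define p where "p = first_letter_index N"
  define P where "P = pencil_matrix (Suc n) z"
  have P: "P \<in> carrier_mat (2 * N) (2 * N)"
    using pencil_matrix_carrier[of "Suc n" z] by (simp add: P_def N_def)
  have perm: "p permutes {0..<2 * N}" unfolding p_def by (rule first_letter_index_permutes)
  have "Determinant.det P = Determinant.det (mat (2 * N) (2 * N) (\<lambda>(i, j). P $$ (p i, p j)))"
    by (rule det_permute_both[OF P perm, symmetric])
  also have "\<dots> = Determinant.det (transpose_mat (mat (2 * N) (2 * N) (\<lambda>(i, j). P $$ (p i, p j))))"
    by (rule Determinant.det_transpose[OF mat_carrier, symmetric])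
  also have "transpose_mat (mat (2 * N) (2 * N) (\<lambda>(i, j). P $$ (p i, p j))) = four_block_mat A B C D"
  proof (rule eq_matI)
    fix i j assume "i < dim_row (four_block_mat A B C D)" "j < dim_col (four_block_mat A B C D)"
    then have ij: "i < 2 * N" "j < 2 * N" using car by auto
    define b c where "b = (\<not> i < N)" and "c = (\<not> j < N)"
    define k l where "k = (if b then i - N else i)" and "l = (if c then j - N else j)"
    have kl: "k < N" "l < N" using ij by (auto simp: k_def l_def b_def c_def)
    have pk: "p i = (if b then Suc (2 * k) else 2 * k)" and pl: "p j = (if c then Suc (2 * l) else 2 * l)"
      using ij by (auto simp: p_def first_letter_index_def k_def l_def b_def c_def)
    have "transpose_mat (mat (2 * N) (2 * N) (\<lambda>(i, j). P $$ (p i, p j))) $$ (i, j) = P $$ (p j, p i)"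
      using ij by simp
    also have "\<dots> = z $ 0 * (if p j = p i then 1 else 0)
       + z $ 1 * (if c \<noteq> b \<and> l = k then 1 else 0)
       + z $ 2 * (if c \<noteq> b then 0 else if c then H $$ (l, k) else G $$ (l, k))
       + z $ 3 * (if c = b then 0 else if c then G $$ (l, k) else H $$ (l, k))"
    proof -
      have "p j < 2 ^ Suc n" "p i < 2 ^ Suc n"
        using permutes_in_image[OF perm] ij by (auto simp: N_def)
      then show ?thesis
        unfolding P_def pencil_matrix_entry[OF \<open>p j < 2 ^ Suc n\<close> \<open>p i < 2 ^ Suc n\<close>]
        unfolding pk pl G_def H_def
        using koopman_matrix_Suc_entries[OF kl(2,1)[unfolded N_def], of c b] by simp
    qed
    also have "(p j = p i) = (c = b \<and> l = k)"
      using pk pl by (auto; presburger)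
    also have "H $$ (l, k) = H $$ (k, l)" by (rule symH) (use kl in auto)
    also have "G $$ (l, k) = G $$ (k, l)" by (rule symG) (use kl in auto)
    also have "z $ 0 * (if c = b \<and> l = k then 1 else 0)
       + z $ 1 * (if c \<noteq> b \<and> l = k then 1 else 0)
       + z $ 2 * (if c \<noteq> b then 0 else if c then H $$ (k, l) else G $$ (k, l))
       + z $ 3 * (if c = b then 0 else if c then G $$ (k, l) else H $$ (k, l))
       = (if b then if c then D $$ (k, l) else C $$ (k, l) else if c then B $$ (k, l) else A $$ (k, l))"
      unfolding A_def B_def C_def D_def index_add_smult_one[OF G kl] index_add_smult_one[OF H kl]
      by auto
    also have "\<dots> = four_block_mat A B C D $$ (i, j)"
      using ij car by (auto simp: k_def l_def b_def c_def)
    finally show "transpose_mat (mat (2 * N) (2 * N) (\<lambda>(i, j). P $$ (p i, p j))) $$ (i, j)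
      = four_block_mat A B C D $$ (i, j)" .
  qed (use car in auto)
  also have "Determinant.det (four_block_mat A B C D) = Determinant.det (A * D - B * C)"
  proof (rule det_four_block_mat[OF car])
    show "C * D = D * C"
      unfolding C_def D_def affine_mat_mult[OF H H] HH using H
      by (intro eq_matI) (auto simp: algebra_simps)
  qed
  also have "A * D - B * C = pencil_matrix n (dihedral_map z)"
    unfolding A_def B_def C_def D_def affine_mat_mult[OF G H] GH pencil_matrix_def
      dihedral_map_nth
    unfolding G_def[symmetric] H_def[symmetric] N_def[symmetric]
    using G H koopman_matrix_carrier[of n "dih_a * dih_t"]
    by (intro eq_matI) (auto simp: algebra_simps power2_eq_square N_def)
  finally show ?thesis unfolding P_def .
qed

lemma det_pencil_0: "Determinant.det (pencil_matrix 0 z) = z $ 0 + z $ 1 + z $ 2 + z $ 3"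
proof -
  have "koopman_matrix 0 g $$ (0, 0) = 1" for g
    by (subst koopman_matrix_entry[where x = "sconst False"]) (simp_all add: binary_word_def)
  then have "pencil_matrix 0 z $$ (0, 0) = z $ 0 + z $ 1 + z $ 2 + z $ 3"
    by (subst pencil_matrix_entry) simp_all
  then show ?thesis
    using pencil_matrix_carrier[of 0 z] by (simp add: det_single)
qed

text \<open>At level \<open>0\<close> all group elements act trivially, so iterating the recursion down to it leaves the
sum of the coordinates.\<close>

lemma det_pencil:
  "Determinant.det (pencil_matrix n z)
     = (let w = (dihedral_map ^^ n) z in w $ 0 + w $ 1 + w $ 2 + w $ 3)"
  by (induction n arbitrary: z) (simp_all add: det_pencil_0 det_pencil_Suc funpow_Suc_right Let_def del: funpow.simps)

section \<open>Two quadratic forms and the Chebyshev semiconjugacy\<close>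

text \<open>\<open>identity_coeff\<close> and \<open>rotation_coeff\<close> are the coefficients of \<open>1\<close> and of \<open>at + ta\<close>
in the product of the pencil with its adjugate (\<open>pencil_adjugate\<close> below).\<close>

definition identity_coeff :: "complex ^ 4 \<Rightarrow> complex" where
  "identity_coeff z = (z $ 0)\<^sup>2 + (z $ 3)\<^sup>2 - (z $ 1)\<^sup>2 - (z $ 2)\<^sup>2"

definition rotation_coeff :: "complex ^ 4 \<Rightarrow> complex" where
  "rotation_coeff z = z $ 0 * z $ 3 - z $ 1 * z $ 2"

lemma quadric_form_eq: "quadric_form x z = identity_coeff z + 2 * complex_of_real x * rotation_coeff z"
  by (simp add: quadric_form_def identity_coeff_def rotation_coeff_def)

lemma identity_coeff_dihedral_map:
  "identity_coeff (dihedral_map z) = (identity_coeff z)\<^sup>2 - 2 * (rotation_coeff z)\<^sup>2"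
  by (simp add: identity_coeff_def rotation_coeff_def dihedral_map_nth power2_eq_square algebra_simps)

lemma rotation_coeff_dihedral_map: "rotation_coeff (dihedral_map z) = - (rotation_coeff z)\<^sup>2"
  by (simp add: rotation_coeff_def dihedral_map_nth power2_eq_square algebra_simps)

lemma rotation_coeff_iterate_eq_0: "rotation_coeff ((dihedral_map ^^ n) z) = 0 \<longleftrightarrow> rotation_coeff z = 0"
  by (induction n) (simp_all add: rotation_coeff_dihedral_map)

lemma coeffs_smult:
  "identity_coeff (c *s z) = c\<^sup>2 * identity_coeff z" "rotation_coeff (c *s z) = c\<^sup>2 * rotation_coeff z"
  by (simp_all add: identity_coeff_def rotation_coeff_def power2_eq_square algebra_simps)

lemma coeffs_zero [simp]: "identity_coeff 0 = 0" "rotation_coeff 0 = 0"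
  by (simp_all add: identity_coeff_def rotation_coeff_def)

text \<open>The semiconjugacy to \<open>2 x\<^sup>2 - 1\<close> in the coordinate \<open>x = cos \<theta>\<close>, where the Chebyshev
polynomial doubles the angle. Written as an equation between forms it needs no division by
\<open>rotation_coeff\<close>.\<close>

lemma quadric_form_iterate:
  assumes "quadric_form (cos \<theta>) z = 0"
  shows "quadric_form (cos (2 ^ k * \<theta>)) ((dihedral_map ^^ k) z) = 0"
proof (induction k)
  case (Suc k)
  define w c where "w = (dihedral_map ^^ k) z" and "c = complex_of_real (cos (2 ^ k * \<theta>))"
  have c2: "complex_of_real (cos (2 ^ Suc k * \<theta>)) = 2 * c\<^sup>2 - 1"
    using cos_double_cos[of "2 ^ k * \<theta>"] by (simp add: c_def mult.assoc)
  have "identity_coeff w = - (2 * c * rotation_coeff w)"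
    using Suc.IH by (simp add: quadric_form_eq w_def c_def add_eq_0_iff2)
  then have "quadric_form (cos (2 ^ Suc k * \<theta>)) (dihedral_map w) = 0"
    unfolding quadric_form_eq c2 identity_coeff_dihedral_map rotation_coeff_dihedral_map
    by (simp add: power2_eq_square algebra_simps)
  then show ?case by (simp add: w_def)
qed (use assms in simp)

text \<open>The angles \<open>\<theta>\<close> with \<open>2\<^sup>k \<theta> \<in> \<pi> / 2 + \<pi> \<int>\<close> have spacing \<open>\<pi> / 2\<^sup>k\<close>.\<close>

lemma cos_zeros_dense:
  fixes x :: real
  assumes "x \<in> {-1..1}" "\<delta> > 0"
  shows "\<forall>\<^sub>F k in sequentially. \<exists>\<theta>. \<bar>cos \<theta> - x\<bar> < \<delta> \<and> cos (2 ^ k * \<theta>) = 0"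
proof -
  define t where "t = arccos x"
  have t: "cos t = x" using assms(1) by (simp add: t_def)
  have "isCont cos t" by simp
  then obtain e where e: "e > 0" "\<And>\<theta>. \<bar>\<theta> - t\<bar> < e \<Longrightarrow> \<bar>cos \<theta> - x\<bar> < \<delta>"
    using assms(2) unfolding continuous_at_eps_delta dist_real_def t by blast
  have "(\<lambda>k. pi * (1 / 2) ^ k) \<longlonglongrightarrow> pi * 0"
    by (intro tendsto_intros LIMSEQ_power_zero) simp
  then have "\<forall>\<^sub>F k in sequentially. pi * (1 / 2) ^ k < e"
    by (rule order_tendstoD(2)) (simp add: e(1))
  then show ?thesis
  proof eventually_elim
    case (elim k)
    \<comment> \<open>The zero of cosine in the interval of length \<open>\<pi>\<close> that contains \<open>2\<^sup>k t\<close>.\<close>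
    define j where "j = \<lfloor>2 ^ k * t / pi\<rfloor>"
    define \<theta> where "\<theta> = (pi / 2 + of_int j * pi) / 2 ^ k"
    have k\<theta>: "2 ^ k * \<theta> = pi / 2 + of_int j * pi" by (simp add: \<theta>_def)
    have "cos (2 ^ k * \<theta>) = 0"
      unfolding k\<theta> cos_add using sin_zero_iff_int2[of "of_int j * pi"] by auto
    moreover have "of_int j * pi \<le> 2 ^ k * t" "2 ^ k * t < of_int j * pi + pi"
      using floor_correct[of "2 ^ k * t / pi"] unfolding j_def[symmetric]
      by (simp_all add: field_simps)
    then have "\<bar>2 ^ k * \<theta> - 2 ^ k * t\<bar> \<le> pi" unfolding k\<theta> using pi_gt_zero by linarith
    then have "2 ^ k * \<bar>\<theta> - t\<bar> \<le> pi"
      by (simp add: abs_mult right_diff_distrib[symmetric])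
    then have "\<bar>\<theta> - t\<bar> \<le> pi * (1 / 2) ^ k" by (simp add: field_simps)
    then have "\<bar>cos \<theta> - x\<bar> < \<delta>" using e(2) elim by simp
    ultimately show ?case by blast
  qed
qed

text \<open>The value of a monic quadratic at \<open>w\<close> is the product of the distances of \<open>w\<close> to the two roots.
So a small value forces a root nearby, with an explicit bound; this replaces any appeal to the
continuity of roots or to open mappings.\<close>

lemma monic_quadratic_near_root:
  fixes b c w :: complex
  obtains r where "r\<^sup>2 + b * r + c = 0" "(cmod (r - w))\<^sup>2 \<le> cmod (w\<^sup>2 + b * w + c)"
proof -
  define s where "s = csqrt ((b / 2)\<^sup>2 - c)"
  have s: "s\<^sup>2 = (b / 2)\<^sup>2 - c" by (simp add: s_def)
  define r1 r2 where "r1 = - (b / 2) + s" and "r2 = - (b / 2) - s"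
  have fac: "y\<^sup>2 + b * y + c = (y - r1) * (y - r2)" for y
  proof -
    have "(y - r1) * (y - r2) = (y + b / 2)\<^sup>2 - s\<^sup>2"
      by (simp add: r1_def r2_def power2_eq_square algebra_simps)
    also have "\<dots> = y\<^sup>2 + b * y + c" unfolding s by (simp add: power2_eq_square field_simps)
    finally show ?thesis ..
  qed
  have root: "r1\<^sup>2 + b * r1 + c = 0" "r2\<^sup>2 + b * r2 + c = 0" unfolding fac by simp_all
  have prod: "cmod (w\<^sup>2 + b * w + c) = cmod (r1 - w) * cmod (r2 - w)"
    unfolding fac norm_mult by (simp add: norm_minus_commute)
  show ?thesis
  proof (cases "cmod (r1 - w) \<le> cmod (r2 - w)")
    case True
    show ?thesis
      by (rule that[OF root(1)]) (unfold prod, simp add: power2_eq_square mult_left_mono[OF True norm_ge_zero])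
  next
    case False
    show ?thesis
      by (rule that[OF root(2)]) (unfold prod, use False in \<open>simp add: power2_eq_square mult_right_mono\<close>)
  qed
qed

text \<open>The quadrics are monic in \<open>z\<^sub>0\<close>, so a point of one of them can be moved to a neighbouring one
by changing only this coordinate. That only \<open>z\<^sub>0\<close> changes matters for the spectrum: the two
pencils then differ by a multiple of the identity.\<close>

lemma quadric_form_perturb:
  assumes "quadric_form x z = 0"
  obtains h where "quadric_form y (z + axis 0 h) = 0" "(cmod h)\<^sup>2 \<le> 2 * \<bar>y - x\<bar> * cmod (rotation_coeff z)"
proof -
  \<comment> \<open>The coefficients of the quadric as a monic quadratic in the coordinate with index \<open>0\<close>.\<close>
  define b c where "b = 2 * complex_of_real y * z $ 3"
    and "c = (z $ 3)\<^sup>2 - (z $ 1)\<^sup>2 - (z $ 2)\<^sup>2 - 2 * complex_of_real y * (z $ 1 * z $ 2)"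
  have q: "quadric_form y (z + axis 0 h) = (z $ 0 + h)\<^sup>2 + b * (z $ 0 + h) + c" for h
    by (simp add: quadric_form_def b_def c_def axis_def algebra_simps)
  obtain r where r: "r\<^sup>2 + b * r + c = 0"
      "(cmod (r - z $ 0))\<^sup>2 \<le> cmod ((z $ 0)\<^sup>2 + b * z $ 0 + c)"
    by (rule monic_quadratic_near_root)
  have "(z $ 0)\<^sup>2 + b * z $ 0 + c = quadric_form y z - quadric_form x z"
    unfolding assms by (simp add: quadric_form_def b_def c_def algebra_simps)
  also have "\<dots> = 2 * complex_of_real (y - x) * rotation_coeff z"
    by (simp add: quadric_form_eq algebra_simps)
  finally have "cmod ((z $ 0)\<^sup>2 + b * z $ 0 + c) = 2 * \<bar>y - x\<bar> * cmod (rotation_coeff z)"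
    by (simp add: norm_mult del: of_real_diff)
  with r show ?thesis by (intro that[of "r - z $ 0"]) (simp_all add: q)
qed

text \<open>The density statement that yields both the Julia points and the spectral points: a quadric with
parameter in \<open>[-1, 1]\<close> is approached by quadrics whose parameter is sent to \<open>0\<close> by
the \<open>k\<close>-th iterate of the Chebyshev polynomial.\<close>

lemma identity_coeff_iterate_zero_dense:
  assumes "x \<in> {-1..1}" "quadric_form x z = 0" "\<delta> > 0"
  shows "\<forall>\<^sub>F k in sequentially. \<exists>h. cmod h < \<delta> \<and> identity_coeff ((dihedral_map ^^ k) (z + axis 0 h)) = 0"
proof -
  define \<eta> where "\<eta> = \<delta>\<^sup>2 / (2 * (cmod (rotation_coeff z) + 1))"
  have "2 * (cmod (rotation_coeff z) + 1) > 0" by (simp add: add_nonneg_pos)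
  then have \<eta>: "\<eta> > 0" "\<eta> * (2 * (cmod (rotation_coeff z) + 1)) = \<delta>\<^sup>2"
    using assms(3) by (simp_all add: \<eta>_def)
  have "\<forall>\<^sub>F k in sequentially. \<exists>\<theta>. \<bar>cos \<theta> - x\<bar> < \<eta> \<and> cos (2 ^ k * \<theta>) = 0"
    using assms(1) \<eta>(1) by (rule cos_zeros_dense)
  then show ?thesis
  proof eventually_elim
    case (elim k)
    then obtain \<theta> where \<theta>: "\<bar>cos \<theta> - x\<bar> < \<eta>" "cos (2 ^ k * \<theta>) = 0" by blast
    obtain h where h: "quadric_form (cos \<theta>) (z + axis 0 h) = 0"
        "(cmod h)\<^sup>2 \<le> 2 * \<bar>cos \<theta> - x\<bar> * cmod (rotation_coeff z)"
      using quadric_form_perturb[OF assms(2)] .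
    have "(cmod h)\<^sup>2 \<le> 2 * \<eta> * cmod (rotation_coeff z)"
      using h(2) \<theta>(1) by (meson less_eq_real_def mult_left_mono mult_right_mono norm_ge_zero order_trans zero_le_numeral)
    also have "\<dots> < \<delta>\<^sup>2" using \<eta> by (simp add: algebra_simps)
    finally have "cmod h < \<delta>" using assms(3) by (simp add: power_less_imp_less_base)
    moreover have "identity_coeff ((dihedral_map ^^ k) (z + axis 0 h)) = 0"
      using quadric_form_iterate[OF h(1), of k] \<theta>(2) by (simp add: quadric_form_eq)
    ultimately show ?case by blast
  qed
qed

lemma dihedral_map_identity_coeff_zero:
  assumes "identity_coeff z = 0"
  shows "dihedral_map z $ 3 = dihedral_map z $ 0" "dihedral_map z $ 2 = dihedral_map z $ 1"
  using assms by (simp_all add: identity_coeff_def dihedral_map_nth algebra_simps)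

text \<open>The point \<open>[1 : 0 : 0 : -1]\<close> is fixed by \<open>F\<close>, and it is reached in two steps from every point
where \<open>identity_coeff\<close> vanishes (unless the iterate is \<open>0\<close>).\<close>

lemma iterate_identity_coeff_zero:
  assumes "identity_coeff z = 0"
  defines "w n \<equiv> (dihedral_map ^^ (n + 2)) z"
  shows "w n $ 1 = 0 \<and> w n $ 2 = 0 \<and> w n $ 3 = - w n $ 0"
proof (induction n)
  case 0
  have "w 0 = dihedral_map (dihedral_map z)" by (simp add: w_def numeral_2_eq_2)
  then show ?case
    using dihedral_map_identity_coeff_zero[OF assms(1)]
    by (simp add: dihedral_map_nth[of "dihedral_map z"] power2_eq_square)
next
  case (Suc n)
  have "w (Suc n) = dihedral_map (w n)" by (simp add: w_def)
  then show ?case using Suc.IH by (simp add: dihedral_map_nth)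
qed

text \<open>The library enumerates the index type \<open>4\<close> as \<open>1, 2, 3, 4\<close>.\<close>

lemma four_eq_0: "(4 :: 4) = 0"
  by simp

section \<open>Projective space\<close>

lemma proj3_exhaust:
  obtains v where "v \<noteq> 0" "p = proj_point v"
proof -
  have "proj_rel (rep_proj3 p) (rep_proj3 p)"
    using Quotient_rep_reflp[OF Quotient_proj3] by blast
  moreover have "p = proj_point (rep_proj3 p)"
    using Quotient_abs_rep[OF Quotient_proj3] by (simp add: proj_point_def)
  ultimately show ?thesis using that unfolding proj_rel_def by blast
qed

lemma proj_point_smult: "c \<noteq> 0 \<Longrightarrow> v \<noteq> 0 \<Longrightarrow> proj_point (c *s v) = proj_point v"
  by (metis proj_point_eq_iff vector_mul_eq_0)

lemma proj_point_mem_image_iff: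
  assumes "\<And>c u. c \<noteq> 0 \<Longrightarrow> P (c *s u) \<longleftrightarrow> P u" "v \<noteq> 0"
  shows "proj_point v \<in> proj_point ` {u. u \<noteq> 0 \<and> P u} \<longleftrightarrow> P v"
proof
  assume "proj_point v \<in> proj_point ` {u. u \<noteq> 0 \<and> P u}"
  then obtain u where u: "u \<noteq> 0" "P u" "proj_point v = proj_point u" by blast
  then obtain c where "c \<noteq> 0" "u = c *s v" using proj_point_eq_iff[OF assms(2)] by blast
  then show "P v" using u(2) assms(1) by simp
qed (use assms(2) in blast)

lemma open_proj_point_image:
  assumes "open B" "0 \<notin> B"
  shows "open (proj_point ` B)"
proof -
  have "{v. v \<noteq> 0 \<and> proj_point v \<in> proj_point ` B} = (\<Union>c\<in>-{0}. (\<lambda>v. c *s v) -` B)"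
  proof (intro equalityI subsetI)
    fix v assume "v \<in> {v. v \<noteq> 0 \<and> proj_point v \<in> proj_point ` B}"
    then obtain b where "v \<noteq> 0" "b \<in> B" "proj_point v = proj_point b" by auto
    then show "v \<in> (\<Union>c\<in>-{0}. (\<lambda>v. c *s v) -` B)"
      using assms(2) proj_point_eq_iff[of v b] by auto
  next
    fix v assume "v \<in> (\<Union>c\<in>-{0}. (\<lambda>v. c *s v) -` B)"
    then obtain c where c: "c \<noteq> 0" "c *s v \<in> B" by auto
    then have "v \<noteq> 0" using assms(2) by auto
    then show "v \<in> {v. v \<noteq> 0 \<and> proj_point v \<in> proj_point ` B}"
      using c proj_point_smult[OF c(1)] by (auto intro!: image_eqI[where x = "c *s v"])
  qed
  moreover have "open ((\<lambda>v :: complex ^ 4. c *s v) -` B)" for c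
  proof (rule open_vimage[OF assms(1)])
    show "continuous_on UNIV (\<lambda>v :: complex ^ 4. c *s v)"
      unfolding vector_scalar_mult_def by (intro continuous_intros)
  qed
  ultimately show ?thesis unfolding open_proj3_def by auto
qed

lemma proj_rel_refl: "v \<noteq> 0 \<Longrightarrow> proj_rel v v"
  unfolding proj_rel_def by (metis vector_smult_lid zero_neq_one)

lemma fubini_study_proj_point:
  "v \<noteq> 0 \<Longrightarrow> w \<noteq> 0 \<Longrightarrow> fubini_study (proj_point v) (proj_point w)
     = arccos (cmod (hermitian_prod v w) / (norm v * norm w))"
  unfolding proj_point_def by (rule fubini_study.abs_eq) (simp_all add: proj_rel_refl)

lemma hermitian_prod_Cauchy_Schwarz: "cmod (hermitian_prod v w) \<le> norm v * norm w"
proof -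
  have "cmod (hermitian_prod v w) \<le> (\<Sum>i\<in>UNIV. norm (v $ i) * norm (w $ i))"
    unfolding hermitian_prod_def by (rule order_trans[OF norm_sum]) (simp add: norm_mult)
  also have "\<dots> \<le> norm v * norm w"
    unfolding norm_vec_def using L2_set_mult_ineq[of "\<lambda>i. norm (v $ i)" "\<lambda>i. norm (w $ i)" UNIV] by simp
  finally show ?thesis .
qed

lemma fubini_study_ratio_bounds:
  assumes "v \<noteq> 0" "w \<noteq> 0"
  shows "- 1 \<le> cmod (hermitian_prod v w) / (norm v * norm w)"
    and "cmod (hermitian_prod v w) / (norm v * norm w) \<le> 1"
proof -
  have "0 \<le> cmod (hermitian_prod v w) / (norm v * norm w)" by simp
  then show "- 1 \<le> cmod (hermitian_prod v w) / (norm v * norm w)" by linarith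
  show "cmod (hermitian_prod v w) / (norm v * norm w) \<le> 1"
    using hermitian_prod_Cauchy_Schwarz[of v w] assms by (simp add: divide_le_eq)
qed

lemma fubini_study_le_pi: "fubini_study p q \<le> pi"
proof -
  obtain v w where vw: "v \<noteq> 0" "p = proj_point v" "w \<noteq> 0" "q = proj_point w"
    by (metis proj3_exhaust)
  have "arccos (cmod (hermitian_prod v w) / (norm v * norm w)) \<le> pi"
    using fubini_study_ratio_bounds[OF vw(1,3)] by (rule arccos_ubound)
  then show ?thesis by (simp add: fubini_study_proj_point vw)
qed

lemma fubini_study_le_fs_diameter:
  assumes "p \<in> S" "q \<in> S"
  shows "fubini_study p q \<le> fs_diameter S"
proof -
  have "bdd_above ((\<lambda>(p, q). fubini_study p q) ` (S \<times> S))"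
    by (rule bdd_aboveI[of _ pi]) (auto simp: fubini_study_le_pi)
  then have "(\<lambda>(p, q). fubini_study p q) (p, q) \<le> (SUP (p, q)\<in>S \<times> S. fubini_study p q)"
    using assms by (intro cSUP_upper) auto
  then show ?thesis using assms(1) by (auto simp: fs_diameter_def)
qed

section \<open>The Julia set\<close>

lemma continuous_on_coeffs:
  "continuous_on S identity_coeff" "continuous_on S rotation_coeff"
  unfolding identity_coeff_def rotation_coeff_def by (intro continuous_intros)+

lemma iterate_eq_0_imp_coeffs_eq_0:
  assumes "(dihedral_map ^^ n) z = 0"
  shows "identity_coeff z = 0 \<and> rotation_coeff z = 0"
proof -
  have d: "rotation_coeff z = 0" using rotation_coeff_iterate_eq_0[of n z] assms by simp
  have "identity_coeff ((dihedral_map ^^ k) z) = 0 \<longleftrightarrow> identity_coeff z = 0" for k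
  proof (induction k)
    case (Suc k)
    have "rotation_coeff ((dihedral_map ^^ k) z) = 0" by (simp add: rotation_coeff_iterate_eq_0 d)
    then show ?case using Suc.IH by (simp add: identity_coeff_dihedral_map)
  qed simp
  from this[of n] show ?thesis using assms d by simp
qed

lemma coeffs_eq_0_imp_iterate_eq_0:
  assumes "identity_coeff z = 0" "rotation_coeff z = 0"
  shows "(dihedral_map ^^ 2) z = 0"
proof -
  define w where "w = dihedral_map (dihedral_map z)"
  have ww: "w = (dihedral_map ^^ (0 + 2)) z" by (simp add: w_def numeral_2_eq_2)
  have w: "w $ 1 = 0" "w $ 2 = 0" "w $ 3 = - w $ 0"
    unfolding ww using iterate_identity_coeff_zero[OF assms(1), of 0] by blast+
  have "rotation_coeff w = 0" by (simp add: w_def rotation_coeff_dihedral_map assms)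
  then have "w $ 0 = 0" by (simp add: rotation_coeff_def w)
  then have "w = 0" using w by (simp add: Finite_Cartesian_Product.vec_eq_iff forall_4 four_eq_0)
  then show ?thesis by (simp add: w_def numeral_2_eq_2)
qed

text \<open>The second iterate vanishes exactly on the common zeros of the two forms, and no other iterate
can vanish elsewhere, because being a common zero is preserved by taking preimages. So the
union of the indeterminacy sets is already closed.\<close>

lemma proj_point_mem_extended_indeterminacy_iff:
  assumes "z \<noteq> 0"
  shows "proj_point z \<in> extended_indeterminacy_set dihedral_map \<longleftrightarrow> identity_coeff z = 0 \<and> rotation_coeff z = 0"
proof
  define K where "K = proj_point ` {u. u \<noteq> 0 \<and> identity_coeff u = 0 \<and> rotation_coeff u = 0}"
  have mem: "proj_point v \<in> K \<longleftrightarrow> identity_coeff v = 0 \<and> rotation_coeff v = 0" if "v \<noteq> 0" for v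
    unfolding K_def by (rule proj_point_mem_image_iff[OF _ that]) (simp add: coeffs_smult)
  have "{v. v \<noteq> 0 \<and> proj_point v \<in> - K} = - ({0} \<union> ({v. identity_coeff v = 0} \<inter> {v. rotation_coeff v = 0}))"
    using mem by auto
  moreover have "closed ({0} \<union> ({v. identity_coeff v = 0} \<inter> {v. rotation_coeff v = 0}))"
    by (intro closed_Un closed_Int closed_Collect_eq continuous_on_coeffs continuous_on_const)
       simp_all
  ultimately have "closed K" unfolding closed_def open_proj3_def by (metis open_Compl)
  moreover have "indeterminacy_set dihedral_map n \<subseteq> K" for n
    unfolding indeterminacy_set_def K_def using iterate_eq_0_imp_coeffs_eq_0 by blast
  ultimately have "extended_indeterminacy_set dihedral_map \<subseteq> K"
    unfolding extended_indeterminacy_set_def by (intro closure_minimal) auto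
  then show "proj_point z \<in> extended_indeterminacy_set dihedral_map \<Longrightarrow> identity_coeff z = 0 \<and> rotation_coeff z = 0"
    using mem[OF assms] by blast
next
  assume "identity_coeff z = 0 \<and> rotation_coeff z = 0"
  then have "proj_point z \<in> indeterminacy_set dihedral_map 2"
    using coeffs_eq_0_imp_iterate_eq_0 assms by (auto simp: indeterminacy_set_def)
  then show "proj_point z \<in> extended_indeterminacy_set dihedral_map"
    unfolding extended_indeterminacy_set_def by (intro subsetD[OF closure_subset]) auto
qed

lemma norm_axis_complex: "norm (axis i h :: complex ^ 4) = cmod h"
proof -
  have "norm (axis i h :: complex ^ 4) = sqrt (\<Sum>j\<in>UNIV. if j = i then (cmod h)\<^sup>2 else 0)"
    unfolding norm_vec_def L2_set_def by (intro arg_cong[of _ _ sqrt] sum.cong) (auto simp: axis_def)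
  then show ?thesis by simp
qed

text \<open>Where \<open>rotation_coeff\<close> vanishes the point lies in the extended indeterminacy set. Elsewhere,
choose \<open>v\<close> and \<open>v'\<close> near \<open>z\<close> whose iterates number \<open>K\<close> and \<open>K + 3\<close>, respectively, are
zeros of \<open>identity_coeff\<close>. At time \<open>K + 4\<close> the first has already arrived at
\<open>[1 : 0 : 0 : -1]\<close>, while the second is of the form \<open>[a : m : m : a]\<close>; these are orthogonal, at
distance \<open>\<pi> / 2\<close>.\<close>

lemma proj_point_mem_julia_set:
  assumes z: "z \<noteq> 0" and x: "x \<in> {-1..1}" and quad: "quadric_form x z = 0"
  shows "proj_point z \<in> julia_set dihedral_map"
proof (cases "rotation_coeff z = 0")
  case True
  then have "proj_point z \<in> extended_indeterminacy_set dihedral_map"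
    using quad z by (simp add: proj_point_mem_extended_indeterminacy_iff quadric_form_eq)
  then show ?thesis by (simp add: julia_set_def fatou_set_def)
next
  case False
  show ?thesis
  proof (rule ccontr)
    let ?E = "extended_indeterminacy_set dihedral_map"
    assume "proj_point z \<notin> julia_set dihedral_map"
    then have "\<forall>\<epsilon>>0. \<exists>U. open U \<and> proj_point z \<in> U \<and>
        (\<forall>n. fs_diameter (proj_iterate_image dihedral_map n (U - ?E)) < \<epsilon>)"
      unfolding julia_set_def fatou_set_def by blast
    from this[THEN spec, of 1] obtain U where U: "open U" "proj_point z \<in> U"
      and diam: "\<And>n. fs_diameter (proj_iterate_image dihedral_map n (U - ?E)) < 1"
      by auto
    define V where "V = {v. v \<noteq> 0 \<and> proj_point v \<in> U} \<inter> {v. rotation_coeff v \<noteq> 0}"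
    have "open V" using U(1) unfolding V_def open_proj3_def
      by (intro open_Int open_Collect_neq continuous_on_coeffs continuous_on_const)
    moreover have "z \<in> V" using False U z by (simp add: V_def)
    ultimately obtain \<delta> where \<delta>: "\<delta> > 0" "ball z \<delta> \<subseteq> V" by (auto simp: open_contains_ball)
    obtain K where K: "\<And>k. k \<ge> K \<Longrightarrow> \<exists>h. cmod h < \<delta> \<and> identity_coeff ((dihedral_map ^^ k) (z + axis 0 h)) = 0"
      using identity_coeff_iterate_zero_dense[OF x quad \<delta>(1)] unfolding eventually_sequentially by blast
    have pick: "\<exists>v\<in>V. identity_coeff ((dihedral_map ^^ k) v) = 0" if k: "k \<ge> K" for k
    proof -
      obtain h where h: "cmod h < \<delta>" "identity_coeff ((dihedral_map ^^ k) (z + axis 0 h)) = 0"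
        using K[OF k] by blast
      have "z + axis 0 h \<in> ball z \<delta>" using h(1) by (simp add: dist_norm norm_axis_complex)
      then show ?thesis using h(2) \<delta>(2) by blast
    qed
    obtain v where v: "v \<in> V" "identity_coeff ((dihedral_map ^^ K) v) = 0" using pick by blast
    \<comment> \<open>Three steps more, so that the two orbits are out of phase at time \<open>K + 4\<close>.\<close>
    obtain v' where v': "v' \<in> V" "identity_coeff ((dihedral_map ^^ (K + 3)) v') = 0"
      using pick[of "K + 3"] by auto
    define w w' where "w = (dihedral_map ^^ (K + 4)) v" and "w' = (dihedral_map ^^ (K + 4)) v'"
    have "rotation_coeff w \<noteq> 0" "rotation_coeff w' \<noteq> 0"
      using v(1) v'(1) by (auto simp: V_def w_def w'_def rotation_coeff_iterate_eq_0)
    then have nz: "w \<noteq> 0" "w' \<noteq> 0" by auto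
    have "w = (dihedral_map ^^ (2 + 2)) ((dihedral_map ^^ K) v)"
      using fun_cong[OF funpow_add[of "2 + 2" K dihedral_map], of v] by (simp add: w_def add.commute)
    then have w: "w $ 1 = 0" "w $ 2 = 0" "w $ 3 = - w $ 0"
      using iterate_identity_coeff_zero[OF v(2), of 2] by simp_all
    have "K + 4 = Suc (K + 3)" by simp
    then have "w' = dihedral_map ((dihedral_map ^^ (K + 3)) v')"
      unfolding w'_def by (simp only: funpow.simps o_apply)
    then have w': "w' $ 3 = w' $ 0"
      using dihedral_map_identity_coeff_zero[OF v'(2)] by simp
    have "hermitian_prod w w' = 0"
      by (simp add: hermitian_prod_def sum_4 four_eq_0 w w')
    then have "fubini_study (proj_point w) (proj_point w') = pi / 2"
      by (simp add: fubini_study_proj_point nz)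
    moreover have "fubini_study (proj_point w) (proj_point w')
      \<le> fs_diameter (proj_iterate_image dihedral_map (K + 4) (U - ?E))"
      using v(1) v'(1)
      by (intro fubini_study_le_fs_diameter)
        (auto simp: proj_iterate_image_def w_def w'_def V_def proj_point_mem_extended_indeterminacy_iff)
    ultimately show False using diam[of "K + 4"] pi_gt3 by linarith
  qed
qed

section \<open>The Fatou set\<close>

lemma iterate_smult:
  "(dihedral_map ^^ n) (c *s z) = (c ^ 2 ^ n) *s (dihedral_map ^^ n) z"
proof (induction n)
  case (Suc n)
  have "(dihedral_map ^^ Suc n) (c *s z) = dihedral_map ((c ^ 2 ^ n) *s (dihedral_map ^^ n) z)"
    by (simp add: Suc.IH)
  also have "\<dots> = ((c ^ 2 ^ n)\<^sup>2) *s dihedral_map ((dihedral_map ^^ n) z)"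
    by (rule dihedral_map_homogeneous)
  also have "(c ^ 2 ^ n)\<^sup>2 = c ^ 2 ^ Suc n" by (simp add: power_mult[symmetric] mult.commute)
  finally show ?case by simp
qed simp

lemma continuous_on_dihedral_map: "continuous_on S dihedral_map"
  unfolding dihedral_map_def
proof (rule continuous_on_vec_lambda)
  fix i :: 4
  show "continuous_on S (\<lambda>z. if i = 0 then (z $ 0)\<^sup>2 - (z $ 1)\<^sup>2
     else if i = 1 then z $ 0 * z $ 2 - z $ 1 * z $ 3
     else if i = 2 then z $ 0 * z $ 2 - z $ 1 * z $ 3 else (z $ 2)\<^sup>2 - (z $ 3)\<^sup>2 :: complex)"
    by (cases "i = 0"; cases "i = 1"; cases "i = 2"; simp; intro continuous_intros)
qed

lemma continuous_on_dihedral_map_iterate: "continuous_on S (dihedral_map ^^ n)"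
proof (induction n)
  case (Suc n)
  show ?case
    unfolding funpow.simps o_def
    by (rule continuous_on_compose2[OF continuous_on_dihedral_map[of UNIV] Suc]) simp
qed (simp add: id_def)

text \<open>The angle between lines is controlled by any pair of nearby representatives, so estimates can be
made for suitably normalised vectors in \<open>\<complex>\<^sup>4\<close>.\<close>

lemma fubini_study_locally_small:
  assumes g: "g \<noteq> 0" and \<epsilon>: "\<epsilon> > 0"
  obtains \<eta> where "\<eta> > 0"
    "\<And>u u'. dist u g < \<eta> \<Longrightarrow> dist u' g < \<eta> \<Longrightarrow>
       u \<noteq> 0 \<and> u' \<noteq> 0 \<and> fubini_study (proj_point u) (proj_point u') < \<epsilon>"
proof -
  define e where "e = min \<epsilon> 1"
  have e: "0 < e" "e \<le> 1" "e \<le> \<epsilon>" using \<epsilon> by (auto simp: e_def)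
  have cos_e: "cos e < 1" using cos_monotone_0_pi[of 0 e] e pi_gt3 by simp
  define ratio where "ratio = (\<lambda>(u, u'). cmod (hermitian_prod u u') / (norm u * norm u'))"
  have "hermitian_prod g g = complex_of_real ((norm g)\<^sup>2)"
    unfolding hermitian_prod_def norm_vec_def L2_set_def
    by (simp add: complex_norm_square[symmetric] sum_nonneg)
  then have "cmod (hermitian_prod g g) = norm g * norm g"
    by (simp add: power2_eq_square norm_mult)
  then have 1: "ratio (g, g) = 1"
    using g by (simp add: ratio_def)
  have "(ratio \<longlongrightarrow> ratio (g, g)) (nhds (g, g))"
  proof -
    have "isCont ratio (g, g)"
      unfolding ratio_def hermitian_prod_def case_prod_beta
      by (intro continuous_intros) (use g in auto)
    then show ?thesis unfolding isCont_def tendsto_at_iff_tendsto_nhds .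
  qed
  then have "\<forall>\<^sub>F x in nhds (g, g). ratio x > cos e"
    using cos_e by (auto simp: 1 dest: order_tendstoD(1))
  moreover have "\<forall>\<^sub>F x in nhds (g, g). fst x \<noteq> 0 \<and> snd x \<noteq> 0"
  proof -
    have "\<forall>\<^sub>F x in nhds (g, g). x \<in> (- {0}) \<times> (- {0})"
      using g by (intro eventually_nhds_in_open open_Times) auto
    then show ?thesis by eventually_elim auto
  qed
  ultimately have "\<forall>\<^sub>F x in nhds (g, g). fst x \<noteq> 0 \<and> snd x \<noteq> 0 \<and> ratio x > cos e"
    by eventually_elim simp
  then obtain P Q where PQ: "eventually P (nhds g)" "eventually Q (nhds g)"
      "\<And>u u'. P u \<Longrightarrow> Q u' \<Longrightarrow> u \<noteq> 0 \<and> u' \<noteq> 0 \<and> ratio (u, u') > cos e"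
    unfolding nhds_prod eventually_prod_filter by auto
  have "eventually (\<lambda>u. P u \<and> Q u) (nhds g)" using PQ(1,2) by eventually_elim simp
  then obtain \<eta> where \<eta>: "\<eta> > 0" "\<And>u. dist u g < \<eta> \<Longrightarrow> P u \<and> Q u"
    unfolding eventually_nhds_metric by blast
  show ?thesis
  proof (rule that[OF \<eta>(1)])
    fix u u' assume "dist u g < \<eta>" "dist u' g < \<eta>"
    then have nz: "u \<noteq> 0" "u' \<noteq> 0" and r: "ratio (u, u') > cos e"
      using PQ(3)[of u u'] \<eta>(2) by auto
    have "arccos (ratio (u, u')) < arccos (cos e)"
      using r fubini_study_ratio_bounds[OF nz]
      by (intro arccos_less_mono[THEN iffD2]) (auto simp: ratio_def abs_le_iff)
    also have "\<dots> = e" using e pi_gt3 by (intro arccos_cos) auto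
    finally show "u \<noteq> 0 \<and> u' \<noteq> 0 \<and> fubini_study (proj_point u) (proj_point u') < \<epsilon>"
      using nz e(3) by (simp add: fubini_study_proj_point ratio_def)
  qed
qed

text \<open>If \<open>|L| = |M|\<close> then \<open>L / M\<close> lies on the unit circle and
\<open>(p / (2 q))\<^sup>2 = (L / M + M / L + 2) / 4\<close> lies in \<open>[0, 1]\<close>. So \<open>- p / (2 q)\<close> is a
parameter in \<open>[-1, 1]\<close>. For \<open>q = 0\<close> equal moduli mean \<open>L = M = 0\<close>, hence \<open>p = 0\<close>.\<close>

lemma quadric_free_roots:
  fixes p q L M :: complex
  assumes "\<And>x. x \<in> {-1..1} \<Longrightarrow> p + 2 * complex_of_real x * q \<noteq> 0"
    and LM: "L + M = p" "L * M = q\<^sup>2"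
  shows "cmod L \<noteq> cmod M"
proof
  assume eq: "cmod L = cmod M"
  show False
  proof (cases "q = 0")
    case True
    then have "L = 0 \<and> M = 0" using eq LM(2) by auto
    then show False using assms(1)[of 0] LM(1) by simp
  next
    case False
    then have L: "L \<noteq> 0" "M \<noteq> 0" using LM by auto
    define c where "c = Re (L / M)"
    have unit: "cmod (L / M) = 1" using eq L by (simp add: norm_divide)
    have "M / L = cnj (L / M)"
    proof -
      have "(L / M) * cnj (L / M) = 1"
        unfolding complex_norm_square[symmetric] unit by simp
      then have "inverse (L / M) = cnj (L / M)" by (rule inverse_unique)
      then show ?thesis by simp
    qed
    then have "L / M + M / L = complex_of_real (2 * c)"
      by (simp only: complex_add_cnj c_def)
    moreover have "(p / (2 * q))\<^sup>2 = (L / M + M / L + 2) / 4"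
    proof -
      have "(p / (2 * q))\<^sup>2 = (L + M)\<^sup>2 / (4 * (L * M))"
        by (simp add: power_divide power_mult_distrib LM)
      also have "\<dots> = (L / M + M / L + 2) / 4"
        using L by (simp add: field_simps power2_eq_square)
      finally show ?thesis .
    qed
    ultimately have "(p / (2 * q))\<^sup>2 = (complex_of_real (2 * c) + 2) / 4" by (simp only:)
    also have "\<dots> = complex_of_real ((c + 1) / 2)" by simp
    finally have sq: "(p / (2 * q))\<^sup>2 = complex_of_real ((c + 1) / 2)" .
    have c: "\<bar>c\<bar> \<le> 1" using abs_Re_le_cmod[of "L / M"] unit by (simp add: c_def)
    define x where "x = sqrt ((c + 1) / 2)"
    have "0 \<le> x" "x \<le> 1" using c by (auto simp: x_def abs_le_iff)
    moreover have "x\<^sup>2 = (c + 1) / 2" using c by (simp add: x_def abs_le_iff)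
    then have "complex_of_real ((c + 1) / 2) = (complex_of_real x)\<^sup>2" by (metis of_real_power)
    ultimately have x: "x \<in> {-1..1}" "- x \<in> {-1..1}" "complex_of_real ((c + 1) / 2) = (complex_of_real x)\<^sup>2"
      by simp_all
    have "p / (2 * q) = x \<or> p / (2 * q) = - x"
      using sq unfolding x(3) power2_eq_iff by simp
    then show False
      using assms(1)[OF x(1)] assms(1)[OF x(2)] False by (auto simp: field_simps)
  qed
qed

text \<open>After one step the two middle coordinates agree, and on vectors \<open>(a, m, m, b)\<close> the map sends
\<open>d = a - b\<close> to the value of \<open>identity_coeff\<close> and multiplies both \<open>a + b\<close> and \<open>m\<close> by
\<open>d\<close>. Since \<open>d\<close> becomes \<open>L\<^sup>N + M\<^sup>N\<close>, the factors telescope: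
\<open>(L - M) (L + M) (L\<^sup>2 + M\<^sup>2) \<dots> = L\<^sup>N - M\<^sup>N\<close>.\<close>

lemma iterate_closed_form:
  fixes L M :: complex
  assumes LM: "L + M = identity_coeff z" "L * M = (rotation_coeff z)\<^sup>2"
  defines "w n \<equiv> (dihedral_map ^^ Suc n) z"
  shows "w n $ 0 - w n $ 3 = L ^ 2 ^ n + M ^ 2 ^ n
    \<and> (L - M) * (w n $ 0 + w n $ 3) = (w 0 $ 0 + w 0 $ 3) * (L ^ 2 ^ n - M ^ 2 ^ n)
    \<and> (L - M) * w n $ 1 = w 0 $ 1 * (L ^ 2 ^ n - M ^ 2 ^ n)
    \<and> w n $ 2 = w n $ 1 \<and> (rotation_coeff ((dihedral_map ^^ n) z))\<^sup>2 = L ^ 2 ^ n * M ^ 2 ^ n"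
proof (induction n)
  case 0
  show ?case using LM by (simp add: w_def dihedral_map_nth identity_coeff_def)
next
  case (Suc n)
  define A B where "A = L ^ 2 ^ n" and "B = M ^ 2 ^ n"
  have AB: "L ^ 2 ^ Suc n = A\<^sup>2" "M ^ 2 ^ Suc n = B\<^sup>2"
    by (simp_all add: A_def B_def power_mult[symmetric] mult.commute)
  have IH: "w n $ 0 - w n $ 3 = A + B" "(L - M) * (w n $ 0 + w n $ 3) = (w 0 $ 0 + w 0 $ 3) * (A - B)"
    "(L - M) * w n $ 1 = w 0 $ 1 * (A - B)" "w n $ 2 = w n $ 1"
    "(rotation_coeff ((dihedral_map ^^ n) z))\<^sup>2 = A * B"
    using Suc.IH by (simp_all add: A_def B_def)
  have wn: "w n = dihedral_map ((dihedral_map ^^ n) z)" and wSn: "w (Suc n) = dihedral_map (w n)"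
    by (simp_all add: w_def)
  have det: "(rotation_coeff (w n))\<^sup>2 = (A * B)\<^sup>2"
    unfolding wn rotation_coeff_dihedral_map IH(5) by simp
  have trace: "identity_coeff (w n) = A\<^sup>2 + B\<^sup>2"
  proof -
    have "identity_coeff ((dihedral_map ^^ n) z) = w n $ 0 - w n $ 3"
      unfolding wn by (simp add: dihedral_map_nth identity_coeff_def)
    then show ?thesis
      unfolding wn identity_coeff_dihedral_map IH(5) IH(1)[unfolded wn]
      by (simp add: IH(1) wn[symmetric] power2_eq_square algebra_simps)
  qed
  have d: "w (Suc n) $ 0 - w (Suc n) $ 3 = identity_coeff (w n)"
    unfolding wSn by (simp add: dihedral_map_nth identity_coeff_def)
  have s: "w (Suc n) $ 0 + w (Suc n) $ 3 = (w n $ 0 - w n $ 3) * (w n $ 0 + w n $ 3)"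
    unfolding wSn by (simp add: dihedral_map_nth IH(4) power2_eq_square algebra_simps)
  have m: "w (Suc n) $ 1 = (w n $ 0 - w n $ 3) * w n $ 1" "w (Suc n) $ 2 = w (Suc n) $ 1"
    unfolding wSn by (simp_all add: dihedral_map_nth IH(4) algebra_simps)
  have "(L - M) * (w (Suc n) $ 0 + w (Suc n) $ 3) = (A + B) * ((w 0 $ 0 + w 0 $ 3) * (A - B))"
    unfolding s IH(1) IH(2)[symmetric] by (simp only: ac_simps)
  moreover have "(L - M) * w (Suc n) $ 1 = (A + B) * (w 0 $ 1 * (A - B))"
    unfolding m(1) IH(1) IH(3)[symmetric] by (simp only: ac_simps)
  moreover have "(rotation_coeff ((dihedral_map ^^ Suc n) z))\<^sup>2 = A\<^sup>2 * B\<^sup>2"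
    using det by (simp add: w_def power_mult_distrib)
  ultimately show ?case
    unfolding AB d trace m(2) by (simp add: power2_eq_square algebra_simps)
qed

text \<open>The closed form divided by the dominant power \<open>L\<^sup>N\<close>: as \<open>t = (M / L)\<^sup>N\<close> tends to \<open>0\<close>, the
vector on the right converges.\<close>

lemma iterate_normal_form:
  fixes L M :: complex and n :: nat
  assumes LM: "L + M = identity_coeff v" "L * M = (rotation_coeff v)\<^sup>2" and nz: "L \<noteq> 0" "L \<noteq> M"
  defines "s \<equiv> dihedral_map v $ 0 + dihedral_map v $ 3" and "m \<equiv> dihedral_map v $ 1"
    and "t \<equiv> (M / L) ^ 2 ^ n"
  shows "(dihedral_map ^^ Suc n) v = (L ^ 2 ^ n) *s
    (\<chi> i. if i = 0 then (1 + t + s * (1 - t) / (L - M)) / 2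
          else if i = 1 \<or> i = 2 then m * (1 - t) / (L - M)
          else (s * (1 - t) / (L - M) - (1 + t)) / 2)"
proof -
  define w where "w = (dihedral_map ^^ Suc n) v"
  define A where "A = L ^ 2 ^ n"
  have M: "M ^ 2 ^ n = A * t" using nz by (simp add: A_def t_def power_divide)
  have w: "w $ 0 - w $ 3 = A + A * t" "(L - M) * (w $ 0 + w $ 3) = s * (A - A * t)"
    "(L - M) * w $ 1 = m * (A - A * t)" "w $ 2 = w $ 1"
    using iterate_closed_form[OF LM, of n]
    by (simp_all only: w_def M A_def[symmetric] s_def m_def funpow.simps funpow_0 o_apply id_apply)
  have e: "L - M \<noteq> 0" using nz by simp
  have sum: "w $ 0 + w $ 3 = s * (A - A * t) / (L - M)" and w1: "w $ 1 = m * (A - A * t) / (L - M)"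
    using w(2,3) e by (simp_all add: nonzero_eq_divide_eq mult.commute)
  have "2 * w $ 0 = (w $ 0 - w $ 3) + (w $ 0 + w $ 3)" "2 * w $ 3 = (w $ 0 + w $ 3) - (w $ 0 - w $ 3)" by simp_all
  then have "2 * w $ 0 = A + A * t + s * (A - A * t) / (L - M)" "2 * w $ 3 = s * (A - A * t) / (L - M) - (A + A * t)"
    unfolding sum w(1) by simp_all
  then have w03: "w $ 0 = (A + A * t + s * (A - A * t) / (L - M)) / 2"
    "w $ 3 = (s * (A - A * t) / (L - M) - (A + A * t)) / 2" by (simp_all add: mult.commute)
  have "s * (A - A * t) / (L - M) = A * (s * (1 - t) / (L - M))" "m * (A - A * t) / (L - M) = A * (m * (1 - t) / (L - M))"
    by (simp_all add: algebra_simps)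
  note w' = w03[unfolded this(1)] w1[unfolded this(2)] w(4)
  show ?thesis
    unfolding w_def[symmetric] A_def[symmetric] Finite_Cartesian_Product.vec_eq_iff forall_4
    by (simp add: four_eq_0 w' algebra_simps add_divide_distrib)
qed

text \<open>By \<open>iterate_normal_form\<close> the point \<open>F\<^bsup>n+1\<^esup>(v)\<close> is represented by a vector that
depends continuously on \<open>v\<close> and \<open>t = (M / L)\<^sup>N\<close> near \<open>(z, 0)\<close>. Since \<open>|M / L|\<close> stays
below some \<open>r < 1\<close> near \<open>z\<close>, all late iterates are uniformly close to the one vector obtained at
\<open>(z, 0)\<close>.\<close>

lemma iterates_eventually_close:
  assumes free: "\<And>x. x \<in> {-1..1} \<Longrightarrow> quadric_form x z \<noteq> 0" and \<epsilon>: "\<epsilon> > 0"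
  obtains \<delta> n\<^sub>0 where "\<delta> > 0" "\<And>v v' n. dist v z < \<delta> \<Longrightarrow> dist v' z < \<delta> \<Longrightarrow> n \<ge> n\<^sub>0 \<Longrightarrow>
      fubini_study (proj_point ((dihedral_map ^^ n) v)) (proj_point ((dihedral_map ^^ n) v')) < \<epsilon>"
proof -
  define D where "D v = (identity_coeff v)\<^sup>2 - 4 * (rotation_coeff v)\<^sup>2" for v
  have roots: "(identity_coeff v + e) / 2 * ((identity_coeff v - e) / 2) = (rotation_coeff v)\<^sup>2"
    if "e\<^sup>2 = D v" for e v
    using that by (simp add: D_def power2_eq_square field_simps)
  have ne: "cmod ((identity_coeff z + e) / 2) \<noteq> cmod ((identity_coeff z - e) / 2)" if "e\<^sup>2 = D z" for e
    by (rule quadric_free_roots[where p = "identity_coeff z" and q = "rotation_coeff z"])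
       (use free roots[OF that] in \<open>auto simp: quadric_form_eq add_divide_distrib[symmetric]\<close>)
  \<comment> \<open>Choose the square root of the discriminant for which \<open>L\<close> becomes the dominant root.\<close>
  obtain e\<^sub>0 where e0: "e\<^sub>0\<^sup>2 = D z"
    "cmod ((identity_coeff z - e\<^sub>0) / 2) < cmod ((identity_coeff z + e\<^sub>0) / 2)"
  proof (cases "cmod ((identity_coeff z - csqrt (D z)) / 2) < cmod ((identity_coeff z + csqrt (D z)) / 2)")
    case True
    then show ?thesis by (intro that[of "csqrt (D z)"]) auto
  next
    case False
    then show ?thesis using ne[of "csqrt (D z)"] by (intro that[of "- csqrt (D z)"]) auto
  qed
  have e0_nz: "e\<^sub>0 \<noteq> 0" using e0(2) by auto
  \<comment> \<open>A branch of the square root of \<open>D\<close> that is continuous at \<open>z\<close>: the argument of the principal root is \<open>1\<close> there.\<close>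
  define e where "e v = e\<^sub>0 * csqrt (D v / e\<^sub>0\<^sup>2)" for v
  have e_sq: "(e v)\<^sup>2 = D v" for v using e0_nz by (simp add: e_def power_mult_distrib)
  have ez: "e z = e\<^sub>0" using e0_nz by (simp add: e_def e0(1)[symmetric])
  have cont_coeffs: "isCont identity_coeff z" "isCont rotation_coeff z"
    using continuous_on_coeffs[of UNIV] by (simp_all add: continuous_on_eq_continuous_at)
  have cont_e: "isCont e z"
  proof -
    have "isCont (\<lambda>v. csqrt (D v / e\<^sub>0\<^sup>2)) z"
      unfolding D_def
      by (intro continuous_intros isCont_csqrt' cont_coeffs) (use e0 e0_nz in \<open>auto simp: D_def complex_nonpos_Reals_iff\<close>)
    then show ?thesis unfolding e_def by (intro continuous_intros)
  qed
  define L M where "L v = (identity_coeff v + e v) / 2" and "M v = (identity_coeff v - e v) / 2" for v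
  have LM: "L v + M v = identity_coeff v" "L v * M v = (rotation_coeff v)\<^sup>2" "L v - M v = e v" for v
    using roots[OF e_sq] by (simp_all add: L_def M_def field_simps)
  have cont_LM: "isCont L z" "isCont M z"
    unfolding L_def M_def by (intro continuous_intros cont_coeffs cont_e; simp)+
  have "cmod (M z) < cmod (L z)" using e0(2) by (simp add: L_def M_def ez)
  then have Lz: "L z \<noteq> 0" and "cmod (M z / L z) < 1" by (auto simp: norm_divide divide_less_eq_1)
  then obtain r where r: "cmod (M z / L z) < r" "r < 1" using dense by blast
  have r0: "0 \<le> r" using r(1) norm_ge_zero[of "M z / L z"] by linarith
  define s where "s v = dihedral_map v $ 0 + dihedral_map v $ 3" for v
  define m where "m v = dihedral_map v $ 1" for v
  define G :: "(complex ^ 4) \<times> complex \<Rightarrow> complex ^ 4" where "G x = (\<chi> i. if i = 0 then (1 + snd x + s (fst x) * (1 - snd x) / e (fst x)) / 2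
      else if i = 1 \<or> i = 2 then m (fst x) * (1 - snd x) / e (fst x)
      else (s (fst x) * (1 - snd x) / e (fst x) - (1 + snd x)) / 2)" for x
  have form: "(dihedral_map ^^ Suc n) v = (L v ^ 2 ^ n) *s G (v, (M v / L v) ^ 2 ^ n)"
    if "L v \<noteq> 0" "e v \<noteq> 0" for v n
  proof -
    have "L v \<noteq> M v" using LM(3)[of v] that(2) by auto
    from iterate_normal_form[OF LM(1,2) that(1) this, of n]
    show ?thesis by (simp only: G_def s_def m_def LM(3) fst_conv snd_conv)
  qed
  define g where "g = G (z, 0)"
  have "g $ 0 - g $ 3 = 1" by (simp add: g_def G_def field_simps)
  then have g: "g \<noteq> 0" by auto
  obtain \<eta> where \<eta>: "\<eta> > 0"
    "\<And>u u'. dist u g < \<eta> \<Longrightarrow> dist u' g < \<eta> \<Longrightarrow>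
       u \<noteq> 0 \<and> u' \<noteq> 0 \<and> fubini_study (proj_point u) (proj_point u') < \<epsilon>"
    using fubini_study_locally_small[OF g \<epsilon>] by blast
  have cont_sm: "isCont s z" "isCont m z"
  proof -
    have c: "isCont dihedral_map z"
      using continuous_on_dihedral_map[of UNIV] by (simp add: continuous_on_eq_continuous_at)
    show "isCont s z" "isCont m z"
      unfolding s_def m_def by (intro continuous_intros c)+
  qed
  have lim_z: "(f \<longlongrightarrow> f z) (nhds z)" if "isCont f z" for f :: "complex ^ 4 \<Rightarrow> complex"
    using that unfolding isCont_def tendsto_at_iff_tendsto_nhds .
  have lim_fst: "((\<lambda>x. f (fst x)) \<longlongrightarrow> f z) (nhds (z, 0))"
    if "isCont f z" for f :: "complex ^ 4 \<Rightarrow> complex"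
    by (rule filterlim_compose[OF lim_z[OF that]]) (auto simp: nhds_prod intro: filterlim_fst)
  have lim_snd: "(snd \<longlongrightarrow> (0 :: complex)) (nhds (z, 0))"
    by (auto simp: nhds_prod intro: filterlim_snd)
  have lim_if: "((\<lambda>x. if B then f x else h x) \<longlongrightarrow> (if B then a else b)) F"
    if "(f \<longlongrightarrow> a) F" "(h \<longlongrightarrow> b) F" for B f h and a b :: complex and F :: "((complex ^ 4) \<times> complex) filter"
    using that by simp
  have "(G \<longlongrightarrow> g) (nhds (z, 0))"
  proof (rule vec_tendstoI)
    fix i :: 4
    show "((\<lambda>x. G x $ i) \<longlongrightarrow> g $ i) (nhds (z, 0))"
      unfolding g_def G_def vec_lambda_beta fst_conv snd_conv
      by (intro lim_if tendsto_intros lim_fst lim_snd cont_sm cont_e) (simp_all add: ez e0_nz)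
  qed
  then have "\<forall>\<^sub>F x in nhds (z, 0). dist (G x) g < \<eta>"
    using \<eta>(1) by (rule tendstoD)
  then obtain P Q where PQ: "eventually P (nhds z)" "eventually Q (nhds 0)"
      "\<And>v t. P v \<Longrightarrow> Q t \<Longrightarrow> dist (G (v, t)) g < \<eta>"
    unfolding nhds_prod eventually_prod_filter by auto
  obtain \<rho> where \<rho>: "\<rho> > 0" "\<And>t. cmod t < \<rho> \<Longrightarrow> Q t"
    using PQ(2) unfolding eventually_nhds_metric dist_norm by auto
  have "(\<lambda>n. r ^ n) \<longlonglongrightarrow> 0" using r0 r(2) by (intro LIMSEQ_power_zero) simp
  then have "\<forall>\<^sub>F n in sequentially. r ^ n < \<rho>" using \<rho>(1) by (rule order_tendstoD(2))
  then obtain n\<^sub>1 where n1: "\<And>n. n \<ge> n\<^sub>1 \<Longrightarrow> r ^ n < \<rho>" unfolding eventually_sequentially by blast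
  define good where "good v \<longleftrightarrow> P v \<and> L v \<noteq> 0 \<and> e v \<noteq> 0 \<and> cmod (M v / L v) < r" for v
  have near: "\<forall>\<^sub>F v in nhds z. good v"
  proof -
    have "\<forall>\<^sub>F v in nhds z. L v \<noteq> 0" by (rule tendsto_imp_eventually_ne[OF lim_z[OF cont_LM(1)] Lz])
    moreover have "\<forall>\<^sub>F v in nhds z. e v \<noteq> 0"
      by (rule tendsto_imp_eventually_ne[OF lim_z[OF cont_e]]) (simp add: ez e0_nz)
    moreover have "((\<lambda>v. cmod (M v / L v)) \<longlongrightarrow> cmod (M z / L z)) (nhds z)"
      by (intro tendsto_intros lim_z cont_LM Lz)
    then have "\<forall>\<^sub>F v in nhds z. cmod (M v / L v) < r" using r(1) by (rule order_tendstoD(2))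
    ultimately show ?thesis using PQ(1) by eventually_elim (simp add: good_def)
  qed
  have close: "dist (G (v, (M v / L v) ^ 2 ^ n)) g < \<eta>" if "good v" "n \<ge> n\<^sub>1" for v n
  proof -
    have "cmod ((M v / L v) ^ 2 ^ n) \<le> r ^ 2 ^ n"
      unfolding norm_power using that(1) by (intro power_mono) (auto simp: good_def)
    also have "\<dots> \<le> r ^ n" using r0 r(2) by (intro power_decreasing) (auto intro: less_imp_le less_exp)
    also have "\<dots> < \<rho>" by (rule n1[OF that(2)])
    finally show ?thesis using that(1) by (intro PQ(3) \<rho>(2)) (auto simp: good_def)
  qed
  have main: "fubini_study (proj_point ((dihedral_map ^^ n) v)) (proj_point ((dihedral_map ^^ n) v')) < \<epsilon>"
    if v: "good v" "good v'" and n: "n \<ge> Suc n\<^sub>1" for v v' n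
  proof -
    obtain k where k: "n = Suc k" "k \<ge> n\<^sub>1" using n by (cases n) auto
    define u where "u v = G (v, (M v / L v) ^ 2 ^ k)" for v
    have u: "u v \<noteq> 0" "u v' \<noteq> 0" "fubini_study (proj_point (u v)) (proj_point (u v')) < \<epsilon>"
      unfolding u_def using \<eta>(2)[OF close[OF v(1) k(2)] close[OF v(2) k(2)]] by auto
    have "proj_point ((dihedral_map ^^ n) y) = proj_point (u y)" if "good y" "u y \<noteq> 0" for y
      using form[of y k] that unfolding k(1) u_def[symmetric]
      by (auto simp: good_def intro!: proj_point_smult)
    then show ?thesis using u v by simp
  qed
  obtain \<delta> where "\<delta> > 0" "\<And>v. dist v z < \<delta> \<Longrightarrow> good v"
    using near unfolding eventually_nhds_metric by blast
  then show ?thesis using main by (intro that[of \<delta> "Suc n\<^sub>1"]) blast+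
qed

text \<open>The late iterates are controlled by \<open>iterates_eventually_close\<close>, the finitely many others by their
continuity at \<open>z\<close>, where no iterate vanishes.\<close>

lemma iterates_equicontinuous:
  assumes free: "\<And>x. x \<in> {-1..1} \<Longrightarrow> quadric_form x z \<noteq> 0" and \<epsilon>: "\<epsilon> > 0"
  obtains \<delta> where "\<delta> > 0" "\<And>v v' n. dist v z < \<delta> \<Longrightarrow> dist v' z < \<delta> \<Longrightarrow>
      fubini_study (proj_point ((dihedral_map ^^ n) v)) (proj_point ((dihedral_map ^^ n) v')) < \<epsilon>"
proof -
  obtain \<delta>\<^sub>1 n\<^sub>0 where tail: "\<delta>\<^sub>1 > 0" "\<And>v v' n. dist v z < \<delta>\<^sub>1 \<Longrightarrow> dist v' z < \<delta>\<^sub>1 \<Longrightarrow> n \<ge> n\<^sub>0 \<Longrightarrow>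
      fubini_study (proj_point ((dihedral_map ^^ n) v)) (proj_point ((dihedral_map ^^ n) v')) < \<epsilon>"
    using iterates_eventually_close[OF free \<epsilon>] by metis
  have "\<exists>\<eta>>0. \<forall>u u'. dist u ((dihedral_map ^^ n) z) < \<eta> \<longrightarrow> dist u' ((dihedral_map ^^ n) z) < \<eta> \<longrightarrow>
      fubini_study (proj_point u) (proj_point u') < \<epsilon>" for n
  proof -
    have "(dihedral_map ^^ n) z \<noteq> 0"
      using iterate_eq_0_imp_coeffs_eq_0[of n z] free[of 0] by (auto simp: quadric_form_eq)
    then show ?thesis using fubini_study_locally_small[OF _ \<epsilon>] by metis
  qed
  then obtain \<eta> where \<eta>: "\<And>n. \<eta> n > 0"
    "\<And>n u u'. dist u ((dihedral_map ^^ n) z) < \<eta> n \<Longrightarrow> dist u' ((dihedral_map ^^ n) z) < \<eta> n \<Longrightarrow>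
      fubini_study (proj_point u) (proj_point u') < \<epsilon>"
    by metis
  have "\<forall>\<^sub>F v in nhds z. dist ((dihedral_map ^^ n) v) ((dihedral_map ^^ n) z) < \<eta> n" for n
  proof -
    have "isCont (dihedral_map ^^ n) z"
      using continuous_on_dihedral_map_iterate[of UNIV n] by (simp add: continuous_on_eq_continuous_at)
    then show ?thesis
      unfolding isCont_def tendsto_at_iff_tendsto_nhds using \<eta>(1) by (rule tendstoD)
  qed
  then have "\<forall>\<^sub>F v in nhds z. \<forall>n\<in>{..<n\<^sub>0}. dist ((dihedral_map ^^ n) v) ((dihedral_map ^^ n) z) < \<eta> n"
    by (intro eventually_ball_finite) auto
  then obtain \<delta>\<^sub>2 where \<delta>2: "\<delta>\<^sub>2 > 0" "\<And>v n. dist v z < \<delta>\<^sub>2 \<Longrightarrow> n < n\<^sub>0 \<Longrightarrow>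
      dist ((dihedral_map ^^ n) v) ((dihedral_map ^^ n) z) < \<eta> n"
    unfolding eventually_nhds_metric by auto
  show ?thesis
  proof (rule that[of "min \<delta>\<^sub>1 \<delta>\<^sub>2"])
    fix v v' n assume "dist v z < min \<delta>\<^sub>1 \<delta>\<^sub>2" "dist v' z < min \<delta>\<^sub>1 \<delta>\<^sub>2"
    then show "fubini_study (proj_point ((dihedral_map ^^ n) v)) (proj_point ((dihedral_map ^^ n) v')) < \<epsilon>"
      using tail(2)[of v v' n] \<eta>(2)[OF \<delta>2(2) \<delta>2(2), of v n v'] by (cases "n < n\<^sub>0") auto
  qed (use tail(1) \<delta>2(1) in simp)
qed

lemma proj_point_mem_fatou_set:
  assumes z: "z \<noteq> 0" and free: "\<And>x. x \<in> {-1..1} \<Longrightarrow> quadric_form x z \<noteq> 0"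
  shows "proj_point z \<in> fatou_set dihedral_map"
proof -
  let ?E = "extended_indeterminacy_set dihedral_map"
  have "proj_point z \<notin> ?E"
    using free[of 0] z by (simp add: proj_point_mem_extended_indeterminacy_iff quadric_form_eq)
  moreover have "\<exists>U. open U \<and> proj_point z \<in> U \<and>
      (\<forall>n. fs_diameter (proj_iterate_image dihedral_map n (U - ?E)) < \<epsilon>)" if \<epsilon>: "\<epsilon> > 0" for \<epsilon> :: real
  proof -
    obtain \<delta> where \<delta>: "\<delta> > 0" "\<And>v v' n. dist v z < \<delta> \<Longrightarrow> dist v' z < \<delta> \<Longrightarrow>
        fubini_study (proj_point ((dihedral_map ^^ n) v)) (proj_point ((dihedral_map ^^ n) v')) < \<epsilon> / 2"
      using iterates_equicontinuous[OF free, of "\<epsilon> / 2"] \<epsilon> by (metis half_gt_zero)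
    \<comment> \<open>The ball is punctured because \<open>proj_point\<close> is meaningful on nonzero vectors only.\<close>
    define B where "B = ball z \<delta> - {0}"
    define U where "U = proj_point ` B"
    have "open U" unfolding U_def B_def by (rule open_proj_point_image) (auto intro: open_delete)
    moreover have "proj_point z \<in> U" using z \<delta>(1) by (simp add: U_def B_def)
    moreover have "fs_diameter (proj_iterate_image dihedral_map n (U - ?E)) < \<epsilon>" for n
    proof -
      define S where "S = proj_iterate_image dihedral_map n (U - ?E)"
      have rep: "\<exists>b\<in>B. p = proj_point ((dihedral_map ^^ n) b)" if p: "p \<in> S" for p
      proof -
        obtain v where v: "p = proj_point ((dihedral_map ^^ n) v)" "v \<noteq> 0" "proj_point v \<in> U"
          using p by (auto simp: S_def proj_iterate_image_def)
        then obtain b where b: "b \<in> B" "proj_point v = proj_point b" by (auto simp: U_def)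
        then obtain c where c: "c \<noteq> 0" "b = c *s v"
          using proj_point_eq_iff[of v b] v(2) by (auto simp: B_def)
        have "proj_point ((dihedral_map ^^ n) b) = p"
        proof (cases "(dihedral_map ^^ n) v = 0")
          case True
          then show ?thesis by (simp add: c(2) iterate_smult v(1))
        next
          case False
          then show ?thesis using c(1) by (simp add: c(2) iterate_smult v(1) proj_point_smult)
        qed
        then show ?thesis using b(1) by blast
      qed
      have "fubini_study p q \<le> \<epsilon> / 2" if pq: "p \<in> S" "q \<in> S" for p q
      proof -
        obtain b b' where bb': "b \<in> B" "b' \<in> B" "p = proj_point ((dihedral_map ^^ n) b)"
          "q = proj_point ((dihedral_map ^^ n) b')" using rep[OF pq(1)] rep[OF pq(2)] by blast
        have "dist b z < \<delta>" "dist b' z < \<delta>" using bb'(1,2) by (auto simp: B_def dist_commute)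
        then show ?thesis unfolding bb'(3,4) by (intro less_imp_le \<delta>(2))
      qed
      then have "S \<noteq> {} \<Longrightarrow> (SUP (p, q)\<in>S \<times> S. fubini_study p q) \<le> \<epsilon> / 2"
        by (intro cSUP_least) auto
      then show ?thesis using \<epsilon> unfolding S_def[symmetric] by (cases "S = {}") (auto simp: fs_diameter_def)
    qed
    ultimately show ?thesis by blast
  qed
  ultimately show ?thesis unfolding fatou_set_def by blast
qed

lemma proj_zeros_quadric_form_Union:
  "(\<Union>x\<in>{-1..1}. proj_zeros (quadric_form x)) = proj_point ` {v. v \<noteq> 0 \<and> (\<exists>x\<in>{-1..1}. quadric_form x v = 0)}"
  by (auto simp: proj_zeros_def)

lemma julia_set_dihedral_map:
  "julia_set dihedral_map = (\<Union>x\<in>{-1..1}. proj_zeros (quadric_form x))"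
proof (intro equalityI subsetI)
  fix p assume p: "p \<in> julia_set dihedral_map"
  obtain z where z: "z \<noteq> 0" "p = proj_point z" by (rule proj3_exhaust)
  have "\<exists>x\<in>{-1..1}. quadric_form x z = 0"
  proof (rule ccontr)
    assume "\<not> (\<exists>x\<in>{-1..1}. quadric_form x z = 0)"
    then have "proj_point z \<in> fatou_set dihedral_map"
      by (intro proj_point_mem_fatou_set[OF z(1)]) blast
    then show False using p by (simp add: julia_set_def z(2))
  qed
  then show "p \<in> (\<Union>x\<in>{-1..1}. proj_zeros (quadric_form x))"
    using z unfolding proj_zeros_quadric_form_Union by blast
next
  fix p assume "p \<in> (\<Union>x\<in>{-1..1}. proj_zeros (quadric_form x))"
  then show "p \<in> julia_set dihedral_map"
    using proj_point_mem_julia_set unfolding proj_zeros_quadric_form_Union by blast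
qed

section \<open>Bounded operators on square-integrable representatives\<close>

lemma L2_functionsD:
  assumes "f \<in> L2_functions M"
  shows "f \<in> borel_measurable M" "integrable M (\<lambda>x. (cmod (f x))\<^sup>2)"
  using assms by (auto simp: L2_functions_def)

lemma L2_norm_nonneg: "L2_norm M f \<ge> 0"
  by (simp add: L2_norm_def)

lemma L2_norm_square: "(L2_norm M f)\<^sup>2 = (LINT x|M. (cmod (f x))\<^sup>2)"
  by (simp add: L2_norm_def)

lemma cmod_add_square_le: "(cmod (a + b))\<^sup>2 \<le> 2 * (cmod a)\<^sup>2 + 2 * (cmod b)\<^sup>2"
proof -
  have "(cmod (a + b))\<^sup>2 \<le> (cmod a + cmod b)\<^sup>2"
    by (intro power_mono norm_triangle_ineq) simp
  also have "\<dots> \<le> 2 * (cmod a)\<^sup>2 + 2 * (cmod b)\<^sup>2"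
    using sum_squares_bound[of "cmod a" "cmod b"] by (simp add: power2_sum)
  finally show ?thesis .
qed

text \<open>The triangle inequality up to a factor \<open>2\<close>, which is elementary and enough for boundedness.\<close>

lemma L2_add:
  assumes f: "f \<in> L2_functions M" and g: "g \<in> L2_functions M"
  shows "(\<lambda>x. f x + g x) \<in> L2_functions M"
    and "L2_norm M (\<lambda>x. f x + g x) \<le> 2 * (L2_norm M f + L2_norm M g)"
proof -
  note [measurable] = L2_functionsD(1)[OF f] L2_functionsD(1)[OF g]
  note int = L2_functionsD(2)[OF f] L2_functionsD(2)[OF g]
  have bnd: "integrable M (\<lambda>x. 2 * (cmod (f x))\<^sup>2 + 2 * (cmod (g x))\<^sup>2)"
    using int by auto
  have int': "integrable M (\<lambda>x. (cmod (f x + g x))\<^sup>2)"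
    by (rule Bochner_Integration.integrable_bound[OF bnd]) (auto simp: cmod_add_square_le)
  then show "(\<lambda>x. f x + g x) \<in> L2_functions M" by (simp add: L2_functions_def)
  have "(L2_norm M (\<lambda>x. f x + g x))\<^sup>2 \<le> (LINT x|M. 2 * (cmod (f x))\<^sup>2 + 2 * (cmod (g x))\<^sup>2)"
    unfolding L2_norm_square by (rule integral_mono[OF int' bnd cmod_add_square_le])
  also have "\<dots> = 2 * (L2_norm M f)\<^sup>2 + 2 * (L2_norm M g)\<^sup>2"
    using int by (simp add: L2_norm_square)
  also have "\<dots> \<le> (2 * (L2_norm M f + L2_norm M g))\<^sup>2"
    using L2_norm_nonneg[of M f] L2_norm_nonneg[of M g]
    by (simp add: power2_sum power_mult_distrib)
  finally show "L2_norm M (\<lambda>x. f x + g x) \<le> 2 * (L2_norm M f + L2_norm M g)"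
    by (rule power2_le_imp_le) (simp add: L2_norm_nonneg)
qed

lemma L2_scale:
  assumes f: "f \<in> L2_functions M"
  shows "(\<lambda>x. c * f x) \<in> L2_functions M" and "L2_norm M (\<lambda>x. c * f x) = cmod c * L2_norm M f"
proof -
  note [measurable] = L2_functionsD(1)[OF f]
  show "(\<lambda>x. c * f x) \<in> L2_functions M"
    using L2_functionsD(2)[OF f] by (simp add: L2_functions_def norm_mult power_mult_distrib)
  show "L2_norm M (\<lambda>x. c * f x) = cmod c * L2_norm M f"
    by (simp add: L2_norm_def norm_mult power_mult_distrib real_sqrt_mult)
qed

lemma bounded_L2_operator_id: "bounded_L2_operator M (\<lambda>f. f)"
  unfolding bounded_L2_operator_def by (auto intro!: exI[of _ 1])

lemma bounded_L2_operatorD: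
  assumes "bounded_L2_operator M T"
  shows "f \<in> L2_functions M \<Longrightarrow> T f \<in> L2_functions M"
    and "f \<in> L2_functions M \<Longrightarrow> g \<in> L2_functions M \<Longrightarrow> AE x in M. f x = g x \<Longrightarrow> AE x in M. T f x = T g x"
    and "f \<in> L2_functions M \<Longrightarrow> g \<in> L2_functions M \<Longrightarrow> AE x in M. T (\<lambda>y. f y + g y) x = T f x + T g x"
    and "f \<in> L2_functions M \<Longrightarrow> AE x in M. T (\<lambda>y. c * f y) x = c * T f x"
    and "\<exists>K\<ge>0. \<forall>f\<in>L2_functions M. L2_norm M (T f) \<le> K * L2_norm M f"
proof -
  show "\<exists>K\<ge>0. \<forall>f\<in>L2_functions M. L2_norm M (T f) \<le> K * L2_norm M f"
  proof -
    obtain K where K: "\<And>f. f \<in> L2_functions M \<Longrightarrow> L2_norm M (T f) \<le> K * L2_norm M f"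
      using assms unfolding bounded_L2_operator_def by blast
    have "L2_norm M (T f) \<le> max K 0 * L2_norm M f" if "f \<in> L2_functions M" for f
      using K[OF that] mult_right_mono[of K "max K 0" "L2_norm M f"] L2_norm_nonneg[of M f] by simp
    then show ?thesis by (intro exI[of _ "max K 0"]) simp
  qed
qed (use assms in \<open>simp_all add: bounded_L2_operator_def\<close>)

lemma bounded_L2_operator_add:
  assumes S: "bounded_L2_operator M S" and T: "bounded_L2_operator M T"
  shows "bounded_L2_operator M (\<lambda>f x. S f x + T f x)"
  unfolding bounded_L2_operator_def
proof (intro conjI ballI allI impI)
  fix f assume f: "f \<in> L2_functions M"
  show "(\<lambda>x. S f x + T f x) \<in> L2_functions M"
    by (intro L2_add bounded_L2_operatorD(1)[OF S f] bounded_L2_operatorD(1)[OF T f])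
  show "AE x in M. S (\<lambda>y. c * f y) x + T (\<lambda>y. c * f y) x = c * (S f x + T f x)" for c
    using bounded_L2_operatorD(4)[OF S f, of c] bounded_L2_operatorD(4)[OF T f, of c]
    by eventually_elim (simp add: distrib_left)
  fix g assume g: "g \<in> L2_functions M"
  show "AE x in M. S f x + T f x = S g x + T g x" if "AE x in M. f x = g x"
    using bounded_L2_operatorD(2)[OF S f g that] bounded_L2_operatorD(2)[OF T f g that]
    by eventually_elim simp
  show "AE x in M. S (\<lambda>y. f y + g y) x + T (\<lambda>y. f y + g y) x = S f x + T f x + (S g x + T g x)"
    using bounded_L2_operatorD(3)[OF S f g] bounded_L2_operatorD(3)[OF T f g]
    by eventually_elim simp
next
  obtain K K' where K: "\<forall>f\<in>L2_functions M. L2_norm M (S f) \<le> K * L2_norm M f"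
    "\<forall>f\<in>L2_functions M. L2_norm M (T f) \<le> K' * L2_norm M f"
    using bounded_L2_operatorD(5)[OF S] bounded_L2_operatorD(5)[OF T] by blast
  have "L2_norm M (\<lambda>x. S f x + T f x) \<le> (2 * (K + K')) * L2_norm M f" if f: "f \<in> L2_functions M" for f
  proof -
    have "L2_norm M (\<lambda>x. S f x + T f x) \<le> 2 * (L2_norm M (S f) + L2_norm M (T f))"
      by (intro L2_add bounded_L2_operatorD(1)[OF S f] bounded_L2_operatorD(1)[OF T f])
    also have "\<dots> \<le> 2 * (K * L2_norm M f + K' * L2_norm M f)" using K f by (intro mult_left_mono add_mono) auto
    finally show ?thesis by (simp add: algebra_simps)
  qed
  then show "\<exists>K. \<forall>f\<in>L2_functions M. L2_norm M (\<lambda>x. S f x + T f x) \<le> K * L2_norm M f" by blast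
qed

lemma bounded_L2_operator_scale:
  assumes T: "bounded_L2_operator M T"
  shows "bounded_L2_operator M (\<lambda>f x. c * T f x)"
  unfolding bounded_L2_operator_def
proof (intro conjI ballI allI impI)
  fix f assume f: "f \<in> L2_functions M"
  show "(\<lambda>x. c * T f x) \<in> L2_functions M"
    by (intro L2_scale bounded_L2_operatorD(1)[OF T f])
  show "AE x in M. c * T (\<lambda>y. d * f y) x = d * (c * T f x)" for d
    using bounded_L2_operatorD(4)[OF T f, of d] by eventually_elim simp
  fix g assume g: "g \<in> L2_functions M"
  show "AE x in M. c * T f x = c * T g x" if "AE x in M. f x = g x"
    using bounded_L2_operatorD(2)[OF T f g that] by eventually_elim simp
  show "AE x in M. c * T (\<lambda>y. f y + g y) x = c * T f x + c * T g x"
    using bounded_L2_operatorD(3)[OF T f g] by eventually_elim (simp add: distrib_left)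
next
  obtain K where K: "\<forall>f\<in>L2_functions M. L2_norm M (T f) \<le> K * L2_norm M f"
    using bounded_L2_operatorD(5)[OF T] by blast
  have "L2_norm M (\<lambda>x. c * T f x) \<le> (cmod c * K) * L2_norm M f" if f: "f \<in> L2_functions M" for f
    using mult_left_mono[OF K[rule_format, OF f], of "cmod c"] L2_scale(2)[OF bounded_L2_operatorD(1)[OF T f], of c]
    by (simp add: mult.assoc)
  then show "\<exists>K. \<forall>f\<in>L2_functions M. L2_norm M (\<lambda>x. c * T f x) \<le> K * L2_norm M f" by blast
qed

lemma bounded_L2_operator_compose:
  assumes S: "bounded_L2_operator M S" and T: "bounded_L2_operator M T"
  shows "bounded_L2_operator M (\<lambda>f. S (T f))"
  unfolding bounded_L2_operator_def
proof (intro conjI ballI allI impI)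
  note SD = bounded_L2_operatorD[OF S] and TD = bounded_L2_operatorD[OF T]
  fix f assume f: "f \<in> L2_functions M"
  show "S (T f) \<in> L2_functions M" by (intro SD(1) TD(1) f)
  show "AE x in M. S (T (\<lambda>y. c * f y)) x = c * S (T f) x" for c
    using SD(2)[OF TD(1)[OF L2_scale(1)[OF f]] L2_scale(1)[OF TD(1)[OF f]] TD(4)[OF f, of c]] SD(4)[OF TD(1)[OF f], of c]
    by eventually_elim simp
  fix g assume g: "g \<in> L2_functions M"
  show "AE x in M. S (T f) x = S (T g) x" if "AE x in M. f x = g x"
    by (intro SD(2) TD(1) TD(2) f g that)
  show "AE x in M. S (T (\<lambda>y. f y + g y)) x = S (T f) x + S (T g) x"
    using SD(2)[OF TD(1)[OF L2_add(1)[OF f g]] L2_add(1)[OF TD(1)[OF f] TD(1)[OF g]] TD(3)[OF f g]]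
      SD(3)[OF TD(1)[OF f] TD(1)[OF g]]
    by eventually_elim simp
next
  obtain K K' where K: "0 \<le> K" "\<forall>f\<in>L2_functions M. L2_norm M (S f) \<le> K * L2_norm M f"
    "\<forall>f\<in>L2_functions M. L2_norm M (T f) \<le> K' * L2_norm M f"
    using bounded_L2_operatorD(5)[OF S] bounded_L2_operatorD(5)[OF T] by blast
  have "L2_norm M (S (T f)) \<le> (K * K') * L2_norm M f" if f: "f \<in> L2_functions M" for f
    using K(2)[rule_format, OF bounded_L2_operatorD(1)[OF T f]]
      mult_left_mono[OF K(3)[rule_format, OF f] K(1)] by (simp add: mult.assoc)
  then show "\<exists>K. \<forall>f\<in>L2_functions M. L2_norm M (S (T f)) \<le> K * L2_norm M f" by blast
qed

text \<open>A left and a right inverse suffice, since they agree: \<open>L = L (T R) = R\<close>.\<close>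

lemma invertible_L2_operatorI:
  assumes T: "bounded_L2_operator M T"
    and L: "bounded_L2_operator M L" "\<And>f. f \<in> L2_functions M \<Longrightarrow> AE x in M. L (T f) x = f x"
    and R: "bounded_L2_operator M R" "\<And>f. f \<in> L2_functions M \<Longrightarrow> AE x in M. T (R f) x = f x"
  shows "invertible_L2_operator M T"
  unfolding invertible_L2_operator_def
proof (intro exI[of _ R] conjI R(1) ballI)
  note TD = bounded_L2_operatorD[OF T] and LD = bounded_L2_operatorD[OF L(1)] and RD = bounded_L2_operatorD[OF R(1)]
  fix f assume f: "f \<in> L2_functions M"
  show "AE x in M. T (R f) x = f x" by (rule R(2)[OF f])
  have "AE x in M. L (T (R (T f))) x = R (T f) x" by (intro L(2) RD(1) TD(1) f)
  moreover have "AE x in M. L (T (R (T f))) x = L (T f) x"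
    by (intro LD(2) R(2) TD(1) RD(1) f)
  moreover have "AE x in M. L (T f) x = f x" by (rule L(2)[OF f])
  ultimately show "AE x in M. R (T f) x = f x" by eventually_elim simp
qed

section \<open>Neumann series of a measure-preserving map\<close>

lemma compose_measure_preserving:
  assumes \<phi>[measurable]: "\<phi> \<in> measurable M M" and dist: "distr M M \<phi> = M"
  shows "f \<in> L2_functions M \<Longrightarrow> (\<lambda>x. f (\<phi> x)) \<in> L2_functions M"
    and "f \<in> L2_functions M \<Longrightarrow> L2_norm M (\<lambda>x. f (\<phi> x)) = L2_norm M f"
    and "AE x in M. P x \<Longrightarrow> AE x in M. P (\<phi> x)"
proof -
  assume f: "f \<in> L2_functions M"
  note [measurable] = L2_functionsD(1)[OF f]
  have "integrable (distr M M \<phi>) (\<lambda>x. (cmod (f x))\<^sup>2)" using L2_functionsD(2)[OF f] dist by simp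
  then have "integrable M (\<lambda>x. (cmod (f (\<phi> x)))\<^sup>2)" by (subst (asm) integrable_distr_eq) simp_all
  then show "(\<lambda>x. f (\<phi> x)) \<in> L2_functions M" by (simp add: L2_functions_def)
  have "(LINT x|M. (cmod (f (\<phi> x)))\<^sup>2) = (LINT x|distr M M \<phi>. (cmod (f x))\<^sup>2)"
    by (subst integral_distr) simp_all
  then show "L2_norm M (\<lambda>x. f (\<phi> x)) = L2_norm M f" by (simp add: L2_norm_def dist)
next
  assume P: "AE x in M. P x"
  show "AE x in M. P (\<phi> x)"
    by (rule AE_distrD[OF \<phi>], subst dist, rule P)
qed

lemma bounded_L2_operator_compose_map:
  assumes "\<phi> \<in> measurable M M" "distr M M \<phi> = M"
  shows "bounded_L2_operator M (\<lambda>f x. f (\<phi> x))"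
  unfolding bounded_L2_operator_def
proof (intro conjI ballI allI impI exI[of _ 1])
  fix f g assume "f \<in> L2_functions M" "g \<in> L2_functions M" "AE x in M. f x = g x"
  then show "AE x in M. f (\<phi> x) = g (\<phi> x)" by (intro compose_measure_preserving(3)[OF assms])
qed (simp_all add: compose_measure_preserving(1,2)[OF assms])

lemma measure_preserving_funpow:
  assumes \<phi>[measurable]: "\<phi> \<in> measurable M M" and dist: "distr M M \<phi> = M"
  shows "\<phi> ^^ n \<in> measurable M M \<and> distr M M (\<phi> ^^ n) = M"
proof (induction n)
  case (Suc n)
  then have [measurable]: "\<phi> ^^ n \<in> measurable M M" by simp
  have "distr M M (\<phi> \<circ> \<phi> ^^ n) = distr (distr M M (\<phi> ^^ n)) M \<phi>"
    by (rule distr_distr[symmetric]) simp_all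
  then have "distr M M (\<phi> \<circ> \<phi> ^^ n) = M" using Suc dist by simp
  moreover have "\<phi> \<circ> \<phi> ^^ n \<in> measurable M M" by (rule measurable_comp[OF _ \<phi>]) simp
  ultimately show ?case by (simp only: funpow.simps simp_thms)
qed (simp add: distr_id id_def)

text \<open>The inverse of \<open>1 - c U\<close> for the composition operator \<open>U f = f \<circ> \<phi>\<close>, defined pointwise. Where
the series diverges the value is arbitrary; that happens only on a null set if \<open>\<phi>\<close> preserves the
measure, \<open>|c| < 1\<close> and \<open>f\<close> is square-integrable.\<close>

definition neumann_series :: "complex \<Rightarrow> ('a \<Rightarrow> 'a) \<Rightarrow> ('a \<Rightarrow> complex) \<Rightarrow> 'a \<Rightarrow> complex" where
  "neumann_series c \<phi> f x = (\<Sum>n. c ^ n * f ((\<phi> ^^ n) x))"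

text \<open>The Cauchy--Schwarz inequality for the weights \<open>|c|\<^sup>n\<close>.\<close>

lemma weighted_suminf_square_le:
  fixes c :: complex
  assumes c: "cmod c < 1" and sm: "summable (\<lambda>n. cmod c ^ n * (cmod (a n))\<^sup>2)"
  shows "summable (\<lambda>n. c ^ n * a n)"
    and "(cmod (\<Sum>n. c ^ n * a n))\<^sup>2 \<le> (\<Sum>n. cmod c ^ n * (cmod (a n))\<^sup>2) / (1 - cmod c)"
proof -
  define r where "r = cmod c"
  have r: "0 \<le> r" "r < 1" using c by (auto simp: r_def)
  have sr: "summable (\<lambda>n. r ^ n)" using r by (simp add: summable_geometric)
  have "summable (\<lambda>n. r ^ n + r ^ n * (cmod (a n))\<^sup>2)" using sr sm by (intro summable_add) (simp_all add: r_def)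
  moreover have "norm (c ^ n * a n) \<le> r ^ n + r ^ n * (cmod (a n))\<^sup>2" for n
  proof -
    have "cmod (a n) \<le> 1 + (cmod (a n))\<^sup>2"
      using sum_squares_bound[of "cmod (a n)" 1] by (smt (verit) norm_ge_zero one_power2 zero_le_power2)
    then have "r ^ n * cmod (a n) \<le> r ^ n * (1 + (cmod (a n))\<^sup>2)"
      using r by (intro mult_left_mono) auto
    then show ?thesis by (simp add: norm_mult norm_power r_def distrib_left)
  qed
  ultimately have sn: "summable (\<lambda>n. norm (c ^ n * a n))"
    by (intro summable_comparison_test[of "\<lambda>n. norm (c ^ n * a n)"]) auto
  then show "summable (\<lambda>n. c ^ n * a n)" by (rule summable_norm_cancel)
  then have lim: "(\<lambda>N. (cmod (\<Sum>n<N. c ^ n * a n))\<^sup>2) \<longlonglongrightarrow> (cmod (\<Sum>n. c ^ n * a n))\<^sup>2"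
    by (intro tendsto_intros summable_LIMSEQ)
  have "(cmod (\<Sum>n<N. c ^ n * a n))\<^sup>2 \<le> (\<Sum>n. r ^ n * (cmod (a n))\<^sup>2) / (1 - r)" for N
  proof -
    have "cmod (\<Sum>n<N. c ^ n * a n) \<le> (\<Sum>n<N. sqrt (r ^ n) * (sqrt (r ^ n) * cmod (a n)))"
      using r by (intro order_trans[OF norm_sum] sum_mono)
        (simp add: norm_mult norm_power r_def mult.assoc[symmetric] del: real_sqrt_power)
    then have "(cmod (\<Sum>n<N. c ^ n * a n))\<^sup>2 \<le> (\<Sum>n<N. sqrt (r ^ n) * (sqrt (r ^ n) * cmod (a n)))\<^sup>2"
      by (intro power_mono) auto
    also have "\<dots> \<le> (\<Sum>n<N. (sqrt (r ^ n))\<^sup>2) * (\<Sum>n<N. (sqrt (r ^ n) * cmod (a n))\<^sup>2)"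
      by (rule Cauchy_Schwarz_ineq_sum)
    also have "\<dots> = (\<Sum>n<N. r ^ n) * (\<Sum>n<N. r ^ n * (cmod (a n))\<^sup>2)"
      using r by (simp add: power_mult_distrib del: real_sqrt_power)
    also have "\<dots> \<le> (1 / (1 - r)) * (\<Sum>n. r ^ n * (cmod (a n))\<^sup>2)"
    proof (rule mult_mono)
      show "(\<Sum>n<N. r ^ n) \<le> 1 / (1 - r)"
        using sum_le_suminf[OF sr, of "{..<N}"] r by (simp add: suminf_geometric)
      show "(\<Sum>n<N. r ^ n * (cmod (a n))\<^sup>2) \<le> (\<Sum>n. r ^ n * (cmod (a n))\<^sup>2)"
        using sm r by (intro sum_le_suminf) (auto simp: r_def)
    qed (use r in \<open>auto intro!: sum_nonneg\<close>)
    finally show ?thesis by simp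
  qed
  then show "(cmod (\<Sum>n. c ^ n * a n))\<^sup>2 \<le> (\<Sum>n. cmod c ^ n * (cmod (a n))\<^sup>2) / (1 - cmod c)"
    unfolding r_def[symmetric] by (intro LIMSEQ_le_const2[OF lim]) auto
qed

text \<open>The sum \<open>\<Sum>n. |c|\<^sup>n |f \<circ> \<phi>\<^sup>n|\<^sup>2\<close> has finite integral because \<open>\<phi>\<close> preserves the measure, so it is
finite almost everywhere, and the weighted Cauchy--Schwarz inequality bounds the Neumann series
pointwise by it.\<close>

lemma neumann_series_L2:
  assumes \<phi>: "\<phi> \<in> measurable M M" "distr M M \<phi> = M" and c: "cmod c < 1" and f: "f \<in> L2_functions M"
  shows "AE x in M. summable (\<lambda>n. c ^ n * f ((\<phi> ^^ n) x))"
    and "neumann_series c \<phi> f \<in> L2_functions M"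
    and "L2_norm M (neumann_series c \<phi> f) \<le> (1 / (1 - cmod c)) * L2_norm M f"
proof -
  define r where "r = cmod c"
  have r: "0 \<le> r" "r < 1" using c by (auto simp: r_def)
  define g where "g n x = r ^ n * (cmod (f ((\<phi> ^^ n) x)))\<^sup>2" for n x
  have pw: "\<phi> ^^ n \<in> measurable M M" "distr M M (\<phi> ^^ n) = M" for n
    using measure_preserving_funpow[OF \<phi>] by blast+
  note fn = compose_measure_preserving(1,2)[OF pw f]
  have int_g: "integrable M (g n)" for n
    unfolding g_def using L2_functionsD(2)[OF fn(1)] by auto
  have lint_g: "(LINT x|M. g n x) = r ^ n * (L2_norm M f)\<^sup>2" for n
    using fn(2)[of n] by (simp add: g_def L2_norm_square[symmetric])
  have [measurable]: "g n \<in> borel_measurable M" for n using int_g by auto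
  have g0: "0 \<le> g n x" for n x using r by (simp add: g_def)
  have nn_g: "(\<integral>\<^sup>+x. ennreal (g n x) \<partial>M) = ennreal (r ^ n * (L2_norm M f)\<^sup>2)" for n
    using int_g g0 by (simp add: nn_integral_eq_integral lint_g)
  have sums: "(\<lambda>n. r ^ n * (L2_norm M f)\<^sup>2) sums (1 / (1 - r) * (L2_norm M f)\<^sup>2)"
    using r by (intro sums_mult2 geometric_sums) simp
  have nn_sum: "(\<integral>\<^sup>+x. (\<Sum>n. ennreal (g n x)) \<partial>M) = ennreal (1 / (1 - r) * (L2_norm M f)\<^sup>2)"
  proof -
    have "(\<integral>\<^sup>+x. (\<Sum>n. ennreal (g n x)) \<partial>M) = (\<Sum>n. ennreal (r ^ n * (L2_norm M f)\<^sup>2))"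
      by (subst nn_integral_suminf) (simp_all add: nn_g)
    also have "\<dots> = ennreal (1 / (1 - r) * (L2_norm M f)\<^sup>2)"
      using r sums by (intro suminf_ennreal_eq) auto
    finally show ?thesis .
  qed
  then have "AE x in M. (\<Sum>n. ennreal (g n x)) \<noteq> \<infinity>"
    by (intro nn_integral_noteq_infinite) simp_all
  then have sm: "AE x in M. summable (\<lambda>n. g n x)"
    by eventually_elim (auto intro!: summable_suminf_not_top g0)
  then show "AE x in M. summable (\<lambda>n. c ^ n * f ((\<phi> ^^ n) x))"
    by eventually_elim (intro weighted_suminf_square_le(1)[OF c], simp add: g_def r_def)
  have [measurable]: "(\<lambda>x. f ((\<phi> ^^ n) x)) \<in> borel_measurable M" for n
    by (rule L2_functionsD(1)[OF fn(1)])
  have meas[measurable]: "neumann_series c \<phi> f \<in> borel_measurable M"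
    unfolding neumann_series_def[abs_def] by measurable
  have "(\<integral>\<^sup>+x. ennreal ((cmod (neumann_series c \<phi> f x))\<^sup>2) \<partial>M)
      \<le> (\<integral>\<^sup>+x. ennreal (1 / (1 - r)) * (\<Sum>n. ennreal (g n x)) \<partial>M)"
  proof (rule nn_integral_mono_AE, use sm in eventually_elim)
    case (elim x)
    have "(cmod (neumann_series c \<phi> f x))\<^sup>2 \<le> (\<Sum>n. g n x) / (1 - r)"
      unfolding neumann_series_def using weighted_suminf_square_le(2)[OF c, of "\<lambda>n. f ((\<phi> ^^ n) x)"] elim
      by (simp add: g_def r_def)
    then have "ennreal ((cmod (neumann_series c \<phi> f x))\<^sup>2) \<le> ennreal (1 / (1 - r) * (\<Sum>n. g n x))"
      by (intro ennreal_leI) simp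
    also have "\<dots> = ennreal (1 / (1 - r)) * ennreal (\<Sum>n. g n x)"
      using r elim g0 by (intro ennreal_mult suminf_nonneg) auto
    also have "ennreal (\<Sum>n. g n x) = (\<Sum>n. ennreal (g n x))"
      using elim g0 by (intro suminf_ennreal2[symmetric]) auto
    finally show ?case .
  qed
  also have "\<dots> = ennreal (1 / (1 - r)) * ennreal (1 / (1 - r) * (L2_norm M f)\<^sup>2)"
    by (subst nn_integral_cmult) (simp_all add: nn_sum)
  also have "\<dots> = ennreal ((1 / (1 - r) * L2_norm M f)\<^sup>2)"
    using r by (simp add: ennreal_mult[symmetric] power2_eq_square)
  finally have le: "(\<integral>\<^sup>+x. ennreal ((cmod (neumann_series c \<phi> f x))\<^sup>2) \<partial>M)
      \<le> ennreal ((1 / (1 - r) * L2_norm M f)\<^sup>2)" .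
  have int: "integrable M (\<lambda>x. (cmod (neumann_series c \<phi> f x))\<^sup>2)"
    using le by (intro integrableI_nonneg) (auto simp: top_unique less_top[symmetric])
  then show "neumann_series c \<phi> f \<in> L2_functions M" by (simp add: L2_functions_def)
  have "(L2_norm M (neumann_series c \<phi> f))\<^sup>2 \<le> (1 / (1 - r) * L2_norm M f)\<^sup>2"
    using le unfolding L2_norm_square by (simp add: nn_integral_eq_integral[OF int])
  then show "L2_norm M (neumann_series c \<phi> f) \<le> (1 / (1 - cmod c)) * L2_norm M f"
    unfolding r_def[symmetric] by (rule power2_le_imp_le) (use r in \<open>simp add: L2_norm_nonneg\<close>)
qed

lemma bounded_L2_operator_neumann_series:
  assumes \<phi>: "\<phi> \<in> measurable M M" "distr M M \<phi> = M" and c: "cmod c < 1"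
  shows "bounded_L2_operator M (neumann_series c \<phi>)"
  unfolding bounded_L2_operator_def
proof (intro conjI ballI allI impI)
  note N = neumann_series_L2[OF \<phi> c]
  fix f assume f: "f \<in> L2_functions M"
  show "neumann_series c \<phi> f \<in> L2_functions M" by (rule N(2)[OF f])
  show "AE x in M. neumann_series c \<phi> (\<lambda>y. d * f y) x = d * neumann_series c \<phi> f x" for d
    using N(1)[OF f]
  proof eventually_elim
    case (elim x)
    have "neumann_series c \<phi> (\<lambda>y. d * f y) x = (\<Sum>n. d * (c ^ n * f ((\<phi> ^^ n) x)))"
      by (simp add: neumann_series_def mult_ac)
    then show ?case using suminf_mult[OF elim, of d] by (simp add: neumann_series_def)
  qed
  fix g assume g: "g \<in> L2_functions M"
  show "AE x in M. neumann_series c \<phi> f x = neumann_series c \<phi> g x" if eq: "AE x in M. f x = g x"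
  proof -
    have "AE x in M. f ((\<phi> ^^ n) x) = g ((\<phi> ^^ n) x)" for n
      using compose_measure_preserving(3)[OF _ _ eq] measure_preserving_funpow[OF \<phi>, of n] by blast
    then have "AE x in M. \<forall>n. f ((\<phi> ^^ n) x) = g ((\<phi> ^^ n) x)" by (simp add: AE_all_countable)
    then show ?thesis by eventually_elim (simp add: neumann_series_def)
  qed
  show "AE x in M. neumann_series c \<phi> (\<lambda>y. f y + g y) x = neumann_series c \<phi> f x + neumann_series c \<phi> g x"
    using N(1)[OF f] N(1)[OF g]
    by eventually_elim (simp add: neumann_series_def distrib_left suminf_add)
qed (use neumann_series_L2(3)[OF \<phi> c] in blast)

section \<open>Bernoulli measure\<close>

lemma space_bernoulli_measure [simp]: "space bernoulli_measure = UNIV"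
  by (simp add: bernoulli_measure_def space_stream_space)

lemma prob_space_bernoulli_measure: "prob_space bernoulli_measure"
  unfolding bernoulli_measure_def
  by (rule prob_space.prob_space_stream_space) (rule prob_space_measure_pmf)

lemma sets_bernoulli_measure [measurable_cong]:
  "sets bernoulli_measure = sets (stream_space (count_space UNIV))"
  unfolding bernoulli_measure_def by (rule sets_stream_space_cong) simp

lemma cylinder_measurable: "{x. stake n x = w} \<in> sets bernoulli_measure"
proof -
  have "{x \<in> space bernoulli_measure. stake n x \<in> {w}} \<in> sets bernoulli_measure"
    by measurable
  then show ?thesis by simp
qed

lemma emeasure_cylinder:
  "length w = n \<Longrightarrow> emeasure bernoulli_measure {x. stake n x = w} = ennreal ((1 / 2) ^ n)"
proof (induction w arbitrary: n)
  case Nil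
  interpret prob_space bernoulli_measure by (rule prob_space_bernoulli_measure)
  show ?case using Nil emeasure_space_1 by simp
next
  case (Cons b w)
  then obtain m where m: "n = Suc m" "length w = m" by auto
  have "emeasure bernoulli_measure {x. stake n x = b # w}
      = (\<integral>\<^sup>+t. emeasure bernoulli_measure {x. t ## x \<in> {x. stake n x = b # w}} \<partial>measure_pmf (bernoulli_pmf (1 / 2)))"
    using prob_space.emeasure_stream_space[OF prob_space_measure_pmf,
        of "{x. stake n x = b # w}" "bernoulli_pmf (1 / 2)"]
      cylinder_measurable[of n "b # w"]
    by (simp add: bernoulli_measure_def[symmetric])
  also have "\<dots> = (\<integral>\<^sup>+t. ennreal ((1 / 2) ^ m) * indicator {b} t \<partial>measure_pmf (bernoulli_pmf (1 / 2)))"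
    using Cons.IH[OF m(2)] by (intro nn_integral_cong) (auto simp: m(1) indicator_def)
  also have "\<dots> = ennreal ((1 / 2) ^ m) * emeasure (measure_pmf (bernoulli_pmf (1 / 2))) {b}"
    by (subst nn_integral_cmult_indicator) simp_all
  also have "emeasure (measure_pmf (bernoulli_pmf (1 / 2))) {b} = ennreal (1 / 2)"
    by (cases b) (simp_all add: emeasure_pmf_single)
  also have "ennreal ((1 / 2) ^ m) * ennreal (1 / 2) = ennreal ((1 / 2) ^ n)"
    by (subst ennreal_mult[symmetric]) (simp_all add: m(1))
  finally show ?case .
qed

lemma dih_act_inverse: "dih_act (inverse g) (dih_act g x) = x" "dih_act g (dih_act (inverse g) x) = x"
proof -
  interpret Groups.group "(*) :: dihedral \<Rightarrow> dihedral \<Rightarrow> dihedral" 1 inverse by (rule dihedral_group)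
  show "dih_act (inverse g) (dih_act g x) = x" "dih_act g (dih_act (inverse g) x) = x"
    by (simp_all add: dih_act_mult[symmetric] dih_act_one)
qed

text \<open>The first \<open>n + 1\<close> letters of the image depend only on the first \<open>n + 1\<close> letters of the argument.\<close>

lemma dih_act_measurable [measurable]: "dih_act g \<in> measurable bernoulli_measure bernoulli_measure"
proof -
  have "(\<lambda>x. dih_act g x !! n) \<in> measurable bernoulli_measure (count_space UNIV)" for n
  proof -
    have "(\<lambda>x. dih_act g x !! n) = (\<lambda>x. dih_act g (stake (Suc n) x @- sconst False) !! n)"
    proof
      fix x
      have "stake (Suc n) (stake (Suc n) x @- sconst False) = stake (Suc n) x"
        by (subst stake_shift) (simp del: stake.simps)
      then have "stake (Suc n) (dih_act g x) = stake (Suc n) (dih_act g (stake (Suc n) x @- sconst False))"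
        by (intro stake_dih_act_cong) simp
      then show "dih_act g x !! n = dih_act g (stake (Suc n) x @- sconst False) !! n"
        by (metis lessI stake_nth)
    qed
    also have "\<dots> \<in> measurable bernoulli_measure (count_space UNIV)"
      by (rule measurable_compose[of "stake (Suc n)" _ "count_space UNIV"]) measurable
    finally show ?thesis .
  qed
  then have "dih_act g \<in> measurable bernoulli_measure (stream_space (count_space UNIV))"
    by (intro measurable_stream_space2)
  then show ?thesis by (simp cong: measurable_cong_sets add: measurable_cong_sets[OF refl sets_bernoulli_measure])
qed

lemma sstart_UNIV: "sstart UNIV w = {x. stake (length w) x = w}"
  by (induction w) (auto simp: set_eq_iff)

text \<open>A tree automorphism permutes the cylinders of each length, and these all have the same measure.\<close>

lemma distr_dih_act: "distr bernoulli_measure bernoulli_measure (dih_act g) = bernoulli_measure"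
proof (rule stream_space_eq_sstart[of UNIV])
  interpret prob_space bernoulli_measure by (rule prob_space_bernoulli_measure)
  show "prob_space (distr bernoulli_measure bernoulli_measure (dih_act g))" "prob_space bernoulli_measure"
    by (intro prob_space_distr dih_act_measurable) unfold_locales
  fix w :: "bool list"
  define n where "n = length w"
  define w' where "w' = stake n (dih_act (inverse g) (w @- sconst False))"
  have w: "stake n (w @- sconst False) = w" by (simp add: n_def stake_shift)
  have "stake n (dih_act g x) = w \<longleftrightarrow> stake n x = w'" for x
    using stake_dih_act_cong[of n "dih_act g x" "w @- sconst False" "inverse g"]
      stake_dih_act_cong[of n x "dih_act (inverse g) (w @- sconst False)" g]
    by (auto simp: dih_act_inverse w w'_def)
  then have "dih_act g -` {x. stake n x = w} \<inter> space bernoulli_measure = {x. stake n x = w'}" by auto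
  then have "emeasure (distr bernoulli_measure bernoulli_measure (dih_act g)) {x. stake n x = w}
      = emeasure bernoulli_measure {x. stake n x = w'}"
    by (subst emeasure_distr) (auto simp: cylinder_measurable)
  also have "\<dots> = emeasure bernoulli_measure {x. stake n x = w}"
    by (subst (1 2) emeasure_cylinder) (simp_all add: n_def w'_def)
  finally show "emeasure (distr bernoulli_measure bernoulli_measure (dih_act g)) (sstart UNIV w)
      = emeasure bernoulli_measure (sstart UNIV w)"
    by (simp add: sstart_UNIV n_def)
qed (simp_all add: sets_bernoulli_measure)

section \<open>Points of the quadrics belong to the spectrum\<close>

text \<open>An invertible operator is bounded below; this is what approximate kernel vectors contradict.\<close>

lemma invertible_L2_operator_lower_bound:
  assumes "invertible_L2_operator M T"
  obtains K where "K \<ge> 0" "\<And>f. f \<in> L2_functions M \<Longrightarrow> T f \<in> L2_functions M \<Longrightarrow> L2_norm M f \<le> K * L2_norm M (T f)"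
proof -
  obtain S where S: "bounded_L2_operator M S" "\<And>f. f \<in> L2_functions M \<Longrightarrow> AE x in M. S (T f) x = f x"
    using assms unfolding invertible_L2_operator_def by blast
  obtain K where K: "K \<ge> 0" "\<And>f. f \<in> L2_functions M \<Longrightarrow> L2_norm M (S f) \<le> K * L2_norm M f"
    using bounded_L2_operatorD(5)[OF S(1)] by blast
  have "L2_norm M f \<le> K * L2_norm M (T f)" if f: "f \<in> L2_functions M" "T f \<in> L2_functions M" for f
  proof -
    note [measurable] = L2_functionsD(1)[OF f(1)] L2_functionsD(1)[OF bounded_L2_operatorD(1)[OF S(1) f(2)]]
    have "(LINT x|M. (cmod (S (T f) x))\<^sup>2) = (LINT x|M. (cmod (f x))\<^sup>2)"
      by (rule integral_cong_AE) (use S(2)[OF f(1)] in auto)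
    then have "L2_norm M f = L2_norm M (S (T f))" by (simp add: L2_norm_def)
    then show ?thesis using K(2)[OF f(2)] by simp
  qed
  then show ?thesis using K(1) that by blast
qed

lemma level_basis_L2:
  assumes "i < 2 ^ n"
  shows "level_basis n i \<in> L2_functions bernoulli_measure"
proof -
  interpret prob_space bernoulli_measure by (rule prob_space_bernoulli_measure)
  have eq: "level_basis n i = indicator {x. stake n x = binary_word n i}"
    using level_basis_stake[OF assms] by (auto simp: indicator_def)
  have [measurable]: "level_basis n i \<in> borel_measurable bernoulli_measure"
    unfolding eq using cylinder_measurable by (intro borel_measurable_indicator) auto
  have "integrable bernoulli_measure (\<lambda>x. (cmod (level_basis n i x))\<^sup>2)"
    by (rule integrable_const_bound[where B = 1]) (auto simp: eq indicator_def)
  then show ?thesis by (simp add: L2_functions_def)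
qed

lemma L2_sum:
  assumes "finite I" "\<And>i. i \<in> I \<Longrightarrow> f i \<in> L2_functions M"
  shows "(\<lambda>x. \<Sum>i\<in>I. c i * f i x) \<in> L2_functions M"
  using assms
proof (induction I rule: finite_induct)
  case (insert i I)
  then have "(\<lambda>x. c i * f i x + (\<Sum>i\<in>I. c i * f i x)) \<in> L2_functions M"
    by (intro L2_add(1) L2_scale(1)) auto
  then show ?case using insert.hyps by simp
qed (simp add: L2_functions_def)

lemma L2_norm_level_sum_pos:
  assumes k: "k < 2 ^ n" "c k \<noteq> 0"
  shows "L2_norm bernoulli_measure (\<lambda>x. \<Sum>i<2 ^ n. c i * level_basis n i x) > 0"
proof -
  interpret prob_space bernoulli_measure by (rule prob_space_bernoulli_measure)
  define f where "f x = (\<Sum>i<2 ^ n. c i * level_basis n i x)" for x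
  define C where "C = {x. stake n x = binary_word n k}"
  have f: "f \<in> L2_functions bernoulli_measure"
    unfolding f_def by (intro L2_sum level_basis_L2) auto
  have C: "C \<in> sets bernoulli_measure" by (simp add: C_def cylinder_measurable)
  have "emeasure bernoulli_measure C = ennreal ((1 / 2) ^ n)"
    unfolding C_def by (rule emeasure_cylinder) (rule length_binary_word[OF k(1)])
  then have "measure bernoulli_measure C = (1 / 2) ^ n" by (simp add: measure_def)
  then have "0 < (cmod (c k))\<^sup>2 * measure bernoulli_measure C" using k(2) by simp
  also have "\<dots> = (LINT x|bernoulli_measure. (cmod (c k))\<^sup>2 * indicator C x)"
    using C by simp
  also have "\<dots> \<le> (LINT x|bernoulli_measure. (cmod (f x))\<^sup>2)"
  proof (rule integral_mono)
    show "integrable bernoulli_measure (\<lambda>x. (cmod (c k))\<^sup>2 * indicator C x)"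
      using C by (intro integrable_mult_right integrable_real_indicator) (auto simp: less_top[symmetric])
    show "(cmod (c k))\<^sup>2 * indicator C x \<le> (cmod (f x))\<^sup>2" for x
      using sum_level_basis[OF k(1), of x c] by (auto simp: C_def indicator_def f_def)
  qed (rule L2_functionsD(2)[OF f])
  finally show ?thesis unfolding f_def[symmetric] by (simp add: L2_norm_def)
qed

lemma koopman_pencil_level_sum:
  assumes c: "c \<in> carrier_vec (2 ^ n)"
  shows "koopman_pencil z (\<lambda>x. \<Sum>i<2 ^ n. vec_index c i * level_basis n i x)
     = (\<lambda>x. \<Sum>i<2 ^ n. vec_index (pencil_matrix n z *\<^sub>v c) i * level_basis n i x)"
proof
  fix x
  have entry: "vec_index (pencil_matrix n z *\<^sub>v c) i = z $ 0 * vec_index c i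
     + z $ 1 * vec_index (koopman_matrix n dih_a *\<^sub>v c) i + z $ 2 * vec_index (koopman_matrix n dih_t *\<^sub>v c) i
     + z $ 3 * vec_index (koopman_matrix n (dih_a * dih_t) *\<^sub>v c) i" if i: "i < 2 ^ n" for i
  proof -
    have mv: "vec_index (A *\<^sub>v c) i = (\<Sum>j<2 ^ n. A $$ (i, j) * vec_index c j)"
      if "A \<in> carrier_mat (2 ^ n) (2 ^ n)" for A
      using that c i by (auto simp: scalar_prod_def atLeast0LessThan)
    have "vec_index c i = (\<Sum>j<2 ^ n. (if i = j then 1 else 0) * vec_index c j)"
      using i by (simp add: if_distrib[of "\<lambda>u. u * _"] cong: if_cong)
    then show ?thesis
      unfolding mv[OF pencil_matrix_carrier] mv[OF koopman_matrix_carrier]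
      by (simp add: pencil_matrix_entry[OF i] sum_distrib_left sum.distrib distrib_right mult.assoc)
  qed
  show "koopman_pencil z (\<lambda>x. \<Sum>i<2 ^ n. vec_index c i * level_basis n i x) x
     = (\<Sum>i<2 ^ n. vec_index (pencil_matrix n z *\<^sub>v c) i * level_basis n i x)"
    unfolding koopman_pencil_def koopman_matrix_apply[OF c]
    by (simp add: entry sum_distrib_left sum.distrib distrib_right mult.assoc)
qed

lemma koopman_pencil_kernel:
  assumes "Determinant.det (pencil_matrix n z) = 0"
  obtains f where "f \<in> L2_functions bernoulli_measure" "L2_norm bernoulli_measure f > 0"
    "koopman_pencil z f = (\<lambda>x. 0)"
proof -
  obtain c where c: "c \<in> carrier_vec (2 ^ n)" "c \<noteq> 0\<^sub>v (2 ^ n)" "pencil_matrix n z *\<^sub>v c = 0\<^sub>v (2 ^ n)"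
    using assms unfolding det_0_iff_vec_prod_zero[OF pencil_matrix_carrier] by blast
  obtain k where k: "k < 2 ^ n" "vec_index c k \<noteq> 0"
    using c(1,2) by (metis carrier_vecD eq_vecI index_zero_vec)
  show ?thesis
  proof (rule that)
    show "(\<lambda>x. \<Sum>i<2 ^ n. vec_index c i * level_basis n i x) \<in> L2_functions bernoulli_measure"
      by (intro L2_sum level_basis_L2) auto
    show "L2_norm bernoulli_measure (\<lambda>x. \<Sum>i<2 ^ n. vec_index c i * level_basis n i x) > 0"
      using k by (rule L2_norm_level_sum_pos)
    show "koopman_pencil z (\<lambda>x. \<Sum>i<2 ^ n. vec_index c i * level_basis n i x) = (\<lambda>x. 0)"
      unfolding koopman_pencil_level_sum[OF c(1)] c(3) by simp
  qed
qed

text \<open>Perturb \<open>z\<close> to \<open>v = z + (h, 0, 0, 0)\<close> with \<open>P(F\<^sup>k(v)) = 0\<close>. Then \<open>F\<^bsup>k+2\<^esup>(v)\<close> is a multiple of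
\<open>(1, 0, 0, -1)\<close>, whose coordinates sum to \<open>0\<close>, so \<open>A(v)\<close> has a kernel vector \<open>f\<close> at level
\<open>k + 2\<close>. On it \<open>A(z)\<close> acts as multiplication by \<open>- h\<close>, for arbitrarily small \<open>h\<close>.\<close>

lemma not_invertible_koopman_pencil:
  assumes x: "x \<in> {-1..1}" and quad: "quadric_form x z = 0"
  shows "\<not> invertible_L2_operator bernoulli_measure (koopman_pencil z)"
proof
  let ?B = bernoulli_measure
  assume inv: "invertible_L2_operator ?B (koopman_pencil z)"
  obtain K where K: "K \<ge> 0" "\<And>f. f \<in> L2_functions ?B \<Longrightarrow> koopman_pencil z f \<in> L2_functions ?B
      \<Longrightarrow> L2_norm ?B f \<le> K * L2_norm ?B (koopman_pencil z f)"
    using invertible_L2_operator_lower_bound[OF inv] by blast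
  have "1 / (K + 1) > 0" using K(1) by simp
  from identity_coeff_iterate_zero_dense[OF x quad this]
  obtain k h where h: "cmod h < 1 / (K + 1)" "identity_coeff ((dihedral_map ^^ k) (z + axis 0 h)) = 0"
    unfolding eventually_sequentially by blast
  have "(dihedral_map ^^ (k + 2)) (z + axis 0 h) = (dihedral_map ^^ (0 + 2)) ((dihedral_map ^^ k) (z + axis 0 h))"
    using fun_cong[OF funpow_add[of 2 k dihedral_map], of "z + axis 0 h"] by (simp add: add.commute)
  then have "Determinant.det (pencil_matrix (k + 2) (z + axis 0 h)) = 0"
    using iterate_identity_coeff_zero[OF h(2), of 0] by (simp only: det_pencil Let_def) simp
  then obtain f where f: "f \<in> L2_functions ?B" "L2_norm ?B f > 0" "koopman_pencil (z + axis 0 h) f = (\<lambda>x. 0)"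
    by (rule koopman_pencil_kernel)
  have "koopman_pencil (z + axis 0 h) f x = koopman_pencil z f x + h * f x" for x
    by (simp add: koopman_pencil_def axis_def algebra_simps)
  then have eq: "koopman_pencil z f = (\<lambda>x. (- h) * f x)"
    using f(3) by (auto simp: fun_eq_iff add_eq_0_iff2)
  have "L2_norm ?B f \<le> K * (cmod h * L2_norm ?B f)"
    using K(2)[OF f(1)] unfolding eq L2_scale(2)[OF f(1)] using L2_scale(1)[OF f(1), of "- h"] by simp
  then have "1 \<le> K * cmod h" using f(2) by (simp add: mult.assoc[symmetric])
  also have "\<dots> \<le> K * (1 / (K + 1))" using h(1) K(1) by (intro mult_left_mono) auto
  also have "\<dots> < 1" using K(1) by simp
  finally show False by simp
qed

section \<open>Points off the quadrics belong to the resolvent set\<close>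

lemma neumann_series_unfold:
  assumes "summable (\<lambda>n. c ^ n * f ((\<phi> ^^ n) (\<phi> x)))"
  shows "neumann_series c \<phi> f x = f x + c * neumann_series c \<phi> f (\<phi> x)"
proof -
  have "(\<lambda>n. c * (c ^ n * f ((\<phi> ^^ n) (\<phi> x)))) sums (c * neumann_series c \<phi> f (\<phi> x))"
    unfolding neumann_series_def by (intro sums_mult summable_sums assms)
  then have "(\<lambda>n. c ^ Suc n * f ((\<phi> ^^ Suc n) x)) sums (c * neumann_series c \<phi> f (\<phi> x))"
    by (simp add: funpow_swap1 mult.assoc)
  then have "(\<lambda>n. c ^ n * f ((\<phi> ^^ n) x)) sums (c * neumann_series c \<phi> f (\<phi> x) + c ^ 0 * f ((\<phi> ^^ 0) x))"
    by (rule sums_Suc)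
  then show ?thesis by (simp add: neumann_series_def sums_iff)
qed

text \<open>The operator \<open>\<Sum>n. c\<^bsup>|n|\<^esup> U\<^sup>n\<close> over all integers \<open>n\<close>, where \<open>U\<close> is composition with
\<open>\<phi>\<close> and \<open>\<psi>\<close> is the inverse of \<open>\<phi>\<close>; the term with \<open>n = 0\<close> occurs in both one-sided series and is
subtracted once.\<close>

definition two_sided_neumann :: "complex \<Rightarrow> ('a \<Rightarrow> 'a) \<Rightarrow> ('a \<Rightarrow> 'a) \<Rightarrow> ('a \<Rightarrow> complex) \<Rightarrow> 'a \<Rightarrow> complex" where
  "two_sided_neumann c \<phi> \<psi> f x = neumann_series c \<phi> f x + neumann_series c \<psi> f x - f x"

context
  fixes M :: "'a measure" and \<phi> \<psi> :: "'a \<Rightarrow> 'a" and c :: complex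
  assumes \<phi>: "\<phi> \<in> measurable M M" "distr M M \<phi> = M"
    and \<psi>: "\<psi> \<in> measurable M M" "distr M M \<psi> = M"
    and inv: "\<And>x. \<phi> (\<psi> x) = x" "\<And>x. \<psi> (\<phi> x) = x"
    and c: "c \<noteq> 0" "cmod c < 1"
begin

lemma bounded_two_sided_neumann: "bounded_L2_operator M (two_sided_neumann c \<phi> \<psi>)"
proof -
  have "bounded_L2_operator M (\<lambda>f x. (neumann_series c \<phi> f x + neumann_series c \<psi> f x) + (-1) * f x)"
    by (intro bounded_L2_operator_add bounded_L2_operator_scale bounded_L2_operator_id
        bounded_L2_operator_neumann_series \<phi> \<psi> c(2))
  then show ?thesis by (simp add: two_sided_neumann_def[abs_def])
qed

text \<open>The identity \<open>(u + 1 / u - c - 1 / c) (\<Sum>n. c\<^bsup>|n|\<^esup> u\<^sup>n) = c - 1 / c\<close> with \<open>U\<close> in place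
of \<open>u\<close>, at every point \<open>x\<close> where the one-sided series converge along the orbit.\<close>

lemma two_sided_neumann_right_inverse:
  assumes f: "f \<in> L2_functions M"
  shows "AE x in M. two_sided_neumann c \<phi> \<psi> f (\<phi> x) + two_sided_neumann c \<phi> \<psi> f (\<psi> x)
      - (c + 1 / c) * two_sided_neumann c \<phi> \<psi> f x = (c - 1 / c) * f x"
proof -
  have s: "AE x in M. summable (\<lambda>n. c ^ n * f ((\<phi> ^^ n) x))" "AE x in M. summable (\<lambda>n. c ^ n * f ((\<psi> ^^ n) x))"
    using neumann_series_L2(1)[OF \<phi> c(2) f] neumann_series_L2(1)[OF \<psi> c(2) f] .
  note s' = compose_measure_preserving(3)[OF \<phi> s(1)] compose_measure_preserving(3)[OF \<psi> s(2)]
  show ?thesis using s s'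
  proof eventually_elim
    case (elim x)
    define u w where "u = neumann_series c \<phi> f x" and "w = neumann_series c \<psi> f x"
    have "u = f x + c * neumann_series c \<phi> f (\<phi> x)"
      unfolding u_def by (rule neumann_series_unfold) (rule elim(3))
    then have 1: "neumann_series c \<phi> f (\<phi> x) = (u - f x) / c" using c(1) by simp
    have "w = f x + c * neumann_series c \<psi> f (\<psi> x)"
      unfolding w_def by (rule neumann_series_unfold) (rule elim(4))
    then have 2: "neumann_series c \<psi> f (\<psi> x) = (w - f x) / c" using c(1) by simp
    have 3: "neumann_series c \<phi> f (\<psi> x) = f (\<psi> x) + c * u"
      using neumann_series_unfold[of c f \<phi> "\<psi> x"] elim(1) by (simp add: inv u_def)
    have 4: "neumann_series c \<psi> f (\<phi> x) = f (\<phi> x) + c * w"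
      using neumann_series_unfold[of c f \<psi> "\<phi> x"] elim(2) by (simp add: inv w_def)
    show ?case
      unfolding two_sided_neumann_def 1 2 3 4 u_def[symmetric] w_def[symmetric]
      using c(1) by (simp add: field_simps)
  qed
qed

text \<open>The series is symmetric in \<open>\<phi>\<close> and \<open>\<psi>\<close> and commutes with both compositions, so the left inverse
property reduces to the right one.\<close>

lemma two_sided_neumann_left_inverse:
  assumes f: "f \<in> L2_functions M"
  shows "AE x in M. two_sided_neumann c \<phi> \<psi> (\<lambda>y. f (\<phi> y) + f (\<psi> y) - (c + 1 / c) * f y) x = (c - 1 / c) * f x"
proof -
  let ?R = "two_sided_neumann c \<phi> \<psi>"
  note RD = bounded_L2_operatorD[OF bounded_two_sided_neumann]
  \<comment> \<open>The maps commute, being inverse to each other.\<close>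
  have swap: "(\<psi> ^^ n) (\<phi> x) = \<phi> ((\<psi> ^^ n) x)" "(\<phi> ^^ n) (\<psi> x) = \<psi> ((\<phi> ^^ n) x)" for n x
    by (induction n) (simp_all add: inv)
  have shift: "?R (\<lambda>y. f (\<phi> y)) x = ?R f (\<phi> x)" "?R (\<lambda>y. f (\<psi> y)) x = ?R f (\<psi> x)" for x
    by (simp_all add: two_sided_neumann_def neumann_series_def swap funpow_swap1)
  define d where "d = - (c + 1 / c)"
  note L2 = compose_measure_preserving(1)[OF \<phi> f] compose_measure_preserving(1)[OF \<psi> f] L2_scale(1)[OF f, of d]
  have eq: "(\<lambda>y. f (\<phi> y) + f (\<psi> y) - (c + 1 / c) * f y) = (\<lambda>y. (f (\<phi> y) + f (\<psi> y)) + d * f y)"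
    by (simp add: d_def algebra_simps)
  have "AE x in M. ?R (\<lambda>y. (f (\<phi> y) + f (\<psi> y)) + d * f y) x = ?R (\<lambda>y. f (\<phi> y) + f (\<psi> y)) x + ?R (\<lambda>y. d * f y) x"
    by (intro RD(3) L2_add(1) L2)
  moreover have "AE x in M. ?R (\<lambda>y. f (\<phi> y) + f (\<psi> y)) x = ?R (\<lambda>y. f (\<phi> y)) x + ?R (\<lambda>y. f (\<psi> y)) x"
    by (intro RD(3) L2)
  moreover have "AE x in M. ?R (\<lambda>y. d * f y) x = d * ?R f x" by (rule RD(4)[OF f])
  ultimately show ?thesis
    using two_sided_neumann_right_inverse[OF f] unfolding eq
  proof eventually_elim
    case (elim x)
    show ?case
      unfolding elim(1-3) shift using elim(4) by (simp add: d_def algebra_simps)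
  qed
qed

end

text \<open>The roots of \<open>q u\<^sup>2 + p u + q\<close> are \<open>r\<close> and \<open>1 / r\<close>. If \<open>r\<close> were on the unit circle, then
\<open>r + 1 / r = 2 Re r\<close> and \<open>Re r\<close> would be an excluded parameter. So one of the two lies inside.\<close>

lemma palindromic_root_off_circle:
  fixes p q :: complex
  assumes free: "\<And>x. x \<in> {-1..1} \<Longrightarrow> p + 2 * complex_of_real x * q \<noteq> 0" and q: "q \<noteq> 0"
  obtains c where "c \<noteq> 0" "cmod c < 1" "p = - q * (c + 1 / c)"
proof -
  obtain r where "r\<^sup>2 + (p / q) * r + 1 = 0" by (rule monic_quadratic_near_root)
  then have r0: "r \<noteq> 0" and "r * (r + 1 / r) = r * (- (p / q))"
    by (auto simp: power2_eq_square algebra_simps eq_neg_iff_add_eq_0)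
  then have "r + 1 / r = - (p / q)" using mult_left_cancel[OF r0] by blast
  then have p: "p = - q * (r + 1 / r)" using q by (simp add: field_simps)
  have "cmod r \<noteq> 1"
  proof
    assume "cmod r = 1"
    then have "r * cnj r = 1" unfolding complex_norm_square[symmetric] by simp
    then have "1 / r = cnj r" using r0 by (simp add: field_simps)
    then have "p + 2 * complex_of_real (Re r) * q = 0"
      unfolding p by (simp add: complex_add_cnj)
    moreover have "Re r \<in> {-1..1}" using abs_Re_le_cmod[of r] \<open>cmod r = 1\<close> by (simp add: abs_le_iff)
    ultimately show False using free by blast
  qed
  then consider "cmod r < 1" | "cmod (1 / r) < 1" using r0 by (fastforce simp: norm_divide)
  then show ?thesis
  proof cases
    case 1
    show ?thesis by (rule that[OF r0 1 p])
  next
    case 2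
    show ?thesis by (rule that[of "1 / r"]) (use r0 2 p in \<open>auto simp: add.commute\<close>)
  qed
qed

text \<open>Inverts \<open>p + q (U + U\<^sup>-\<^sup>1)\<close> for composition \<open>U\<close> with a measure-preserving bijection, assuming only
that \<open>p + 2 q x\<close> has no zero in \<open>[-1, 1]\<close>: the required part of the spectral theorem for the
self-adjoint operator \<open>(U + U\<^sup>-\<^sup>1) / 2\<close>, with an explicit inverse.\<close>

lemma laurent_operator_inverse:
  fixes p q :: complex
  assumes \<phi>: "\<phi> \<in> measurable M M" "distr M M \<phi> = M"
    and \<psi>: "\<psi> \<in> measurable M M" "distr M M \<psi> = M"
    and inv: "\<And>x. \<phi> (\<psi> x) = x" "\<And>x. \<psi> (\<phi> x) = x"
    and free: "\<And>x. x \<in> {-1..1} \<Longrightarrow> p + 2 * complex_of_real x * q \<noteq> 0"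
  obtains R where "bounded_L2_operator M R"
    "\<And>f. f \<in> L2_functions M \<Longrightarrow> AE x in M. p * R f x + q * (R f (\<phi> x) + R f (\<psi> x)) = f x"
    "\<And>f. f \<in> L2_functions M \<Longrightarrow> AE x in M. R (\<lambda>y. p * f y + q * (f (\<phi> y) + f (\<psi> y))) x = f x"
proof (cases "q = 0")
  case True
  have "p \<noteq> 0" using free[of 0] by simp
  have "bounded_L2_operator M (\<lambda>f x. (1 / p) * f x)"
    by (intro bounded_L2_operator_scale bounded_L2_operator_id)
  then show ?thesis by (rule that) (use True \<open>p \<noteq> 0\<close> in simp_all)
next
  case False
  obtain c where c: "c \<noteq> 0" "cmod c < 1" "p = - q * (c + 1 / c)"
    using palindromic_root_off_circle[OF free False] by blast
  have "c\<^sup>2 \<noteq> 1"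
  proof
    assume "c\<^sup>2 = 1"
    then have "c = 1 \<or> c = - 1" by (simp add: power2_eq_1_iff)
    then show False using c(2) by auto
  qed
  then have "c - 1 / c \<noteq> 0" using c(1) by (simp add: field_simps power2_eq_square)
  define k where "k = 1 / (q * (c - 1 / c))"
  have k: "q * k * (c - 1 / c) = 1" using False \<open>c - 1 / c \<noteq> 0\<close> by (simp add: k_def)
  let ?N = "two_sided_neumann c \<phi> \<psi>"
  note N = bounded_two_sided_neumann[OF \<phi> \<psi> inv c(1,2)]
    two_sided_neumann_right_inverse[OF \<phi> \<psi> inv c(1,2)] two_sided_neumann_left_inverse[OF \<phi> \<psi> inv c(1,2)]
  show ?thesis
  proof (rule that[of "\<lambda>f x. k * ?N f x"])
    show "bounded_L2_operator M (\<lambda>f x. k * ?N f x)"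
      by (intro bounded_L2_operator_scale N(1))
    fix f assume f: "f \<in> L2_functions M"
    show "AE x in M. p * (k * ?N f x) + q * (k * ?N f (\<phi> x) + k * ?N f (\<psi> x)) = f x"
      using N(2)[OF f]
    proof eventually_elim
      case (elim x)
      have "p * (k * ?N f x) + q * (k * ?N f (\<phi> x) + k * ?N f (\<psi> x))
          = q * k * (?N f (\<phi> x) + ?N f (\<psi> x) - (c + 1 / c) * ?N f x)"
        unfolding c(3) by (simp add: algebra_simps)
      also have "\<dots> = q * k * (c - 1 / c) * f x" unfolding elim by (simp only: mult.assoc)
      finally show ?case unfolding k by simp
    qed
    define g where "g = (\<lambda>y. f (\<phi> y) + f (\<psi> y) - (c + 1 / c) * f y)"
    have "g = (\<lambda>y. (f (\<phi> y) + f (\<psi> y)) + (- (c + 1 / c)) * f y)"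
      by (simp add: g_def algebra_simps)
    then have g: "g \<in> L2_functions M"
      by (simp only:) (intro L2_add(1) L2_scale(1) compose_measure_preserving(1)[OF \<phi>] compose_measure_preserving(1)[OF \<psi>] f)
    have eq: "(\<lambda>y. p * f y + q * (f (\<phi> y) + f (\<psi> y))) = (\<lambda>y. q * g y)"
      unfolding c(3) g_def by (simp add: algebra_simps)
    have "AE x in M. ?N (\<lambda>y. q * g y) x = q * ?N g x"
      by (rule bounded_L2_operatorD(4)[OF N(1) g])
    then show "AE x in M. k * ?N (\<lambda>y. p * f y + q * (f (\<phi> y) + f (\<psi> y))) x = f x"
      using N(3)[OF f] unfolding eq g_def[symmetric]
    proof eventually_elim
      case (elim x)
      have "k * ?N (\<lambda>y. q * g y) x = q * k * (c - 1 / c) * f x"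
        unfolding elim by (simp only: ac_simps)
      then show ?case unfolding k by simp
    qed
  qed
qed

lemma koopman_gens:
  "koopman dih_a f x = f (flip_a x)" "koopman dih_t f x = f (flip_t x)"
  "koopman (dih_a * dih_t) f x = f (flip_t (flip_a x))"
  by (simp_all add: koopman_def dihedral_inverse_mult dihedral_inverse_gens dih_act_mult dih_act_gens)

text \<open>In every two-dimensional representation where \<open>a\<close> and \<open>t\<close> are reflections, this is the adjugate
matrix \<open>tr A - A\<close> of the pencil \<open>A\<close>: reflections have trace \<open>0\<close>, and the adjugate of
the rotation \<open>at\<close> is its inverse \<open>ta\<close>.\<close>

definition adjugate_pencil ::
    "complex ^ 4 \<Rightarrow> (bool stream \<Rightarrow> complex) \<Rightarrow> (bool stream \<Rightarrow> complex)" where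
  "adjugate_pencil z f =
     (\<lambda>x. z $ 0 * f x + z $ 3 * f (flip_a (flip_t x)) + (- z $ 1) * f (flip_a x) + (- z $ 2) * f (flip_t x))"

lemma pencil_adjugate:
  "koopman_pencil z (adjugate_pencil z f) = (\<lambda>x. identity_coeff z * f x
     + rotation_coeff z * (f (flip_a (flip_t x)) + f (flip_t (flip_a x))))"
  "adjugate_pencil z (koopman_pencil z f) = (\<lambda>x. identity_coeff z * f x
     + rotation_coeff z * (f (flip_a (flip_t x)) + f (flip_t (flip_a x))))"
  by (simp_all add: fun_eq_iff koopman_pencil_def adjugate_pencil_def koopman_gens flip_a_flip_a flip_t_flip_t
      identity_coeff_def rotation_coeff_def power2_eq_square algebra_simps)

lemma flip_measure_preserving:
  "flip_a \<in> measurable bernoulli_measure bernoulli_measure" "distr bernoulli_measure bernoulli_measure flip_a = bernoulli_measure"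
  "flip_t \<in> measurable bernoulli_measure bernoulli_measure" "distr bernoulli_measure bernoulli_measure flip_t = bernoulli_measure"
  "(\<lambda>x. flip_a (flip_t x)) \<in> measurable bernoulli_measure bernoulli_measure"
  "distr bernoulli_measure bernoulli_measure (\<lambda>x. flip_a (flip_t x)) = bernoulli_measure"
  "(\<lambda>x. flip_t (flip_a x)) \<in> measurable bernoulli_measure bernoulli_measure"
  "distr bernoulli_measure bernoulli_measure (\<lambda>x. flip_t (flip_a x)) = bernoulli_measure"
proof -
  have eq: "flip_a = dih_act dih_a" "flip_t = dih_act dih_t"
    "(\<lambda>x. dih_act dih_a (dih_act dih_t x)) = dih_act (dih_a * dih_t)"
    "(\<lambda>x. dih_act dih_t (dih_act dih_a x)) = dih_act (dih_t * dih_a)"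
    by (simp_all add: dih_act_gens fun_eq_iff dih_act_mult)
  show "flip_a \<in> measurable bernoulli_measure bernoulli_measure" "distr bernoulli_measure bernoulli_measure flip_a = bernoulli_measure"
  "flip_t \<in> measurable bernoulli_measure bernoulli_measure" "distr bernoulli_measure bernoulli_measure flip_t = bernoulli_measure"
  "(\<lambda>x. flip_a (flip_t x)) \<in> measurable bernoulli_measure bernoulli_measure"
  "distr bernoulli_measure bernoulli_measure (\<lambda>x. flip_a (flip_t x)) = bernoulli_measure"
  "(\<lambda>x. flip_t (flip_a x)) \<in> measurable bernoulli_measure bernoulli_measure"
  "distr bernoulli_measure bernoulli_measure (\<lambda>x. flip_t (flip_a x)) = bernoulli_measure"
    unfolding eq(1,2) unfolding eq(3,4) by (rule dih_act_measurable distr_dih_act)+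
qed

lemma bounded_pencils:
  "bounded_L2_operator bernoulli_measure (koopman_pencil z)"
  "bounded_L2_operator bernoulli_measure (adjugate_pencil z)"
  unfolding koopman_pencil_def[abs_def] adjugate_pencil_def[abs_def] koopman_gens
  by (intro bounded_L2_operator_add bounded_L2_operator_scale bounded_L2_operator_id
      bounded_L2_operator_compose_map flip_measure_preserving)+

lemma invertible_koopman_pencil:
  assumes free: "\<And>x. x \<in> {-1..1} \<Longrightarrow> quadric_form x z \<noteq> 0"
  shows "invertible_L2_operator bernoulli_measure (koopman_pencil z)"
proof -
  let ?B = bernoulli_measure
  have flip_inv: "flip_a (flip_t (flip_t (flip_a x))) = x" "flip_t (flip_a (flip_a (flip_t x))) = x" for x
    by (simp_all add: flip_a_flip_a flip_t_flip_t)
  have "identity_coeff z + 2 * complex_of_real x * rotation_coeff z \<noteq> 0" if "x \<in> {-1..1}" for x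
    using free[OF that] by (simp add: quadric_form_eq)
  from laurent_operator_inverse[OF flip_measure_preserving(5-8) flip_inv this]
  obtain R where R: "bounded_L2_operator ?B R"
    "\<And>f. f \<in> L2_functions ?B \<Longrightarrow> AE x in ?B. identity_coeff z * R f x
       + rotation_coeff z * (R f (flip_a (flip_t x)) + R f (flip_t (flip_a x))) = f x"
    "\<And>f. f \<in> L2_functions ?B \<Longrightarrow> AE x in ?B. R (\<lambda>y. identity_coeff z * f y
       + rotation_coeff z * (f (flip_a (flip_t y)) + f (flip_t (flip_a y)))) x = f x"
    by blast
  show ?thesis
  proof (rule invertible_L2_operatorI[OF bounded_pencils(1)])
    show "bounded_L2_operator ?B (\<lambda>f. R (adjugate_pencil z f))"
      "bounded_L2_operator ?B (\<lambda>f. adjugate_pencil z (R f))"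
      by (rule bounded_L2_operator_compose[OF R(1) bounded_pencils(2)],
          rule bounded_L2_operator_compose[OF bounded_pencils(2) R(1)])
  qed (use R(2,3) in \<open>simp_all add: pencil_adjugate\<close>)
qed

lemma quadrics_eq_joint_spectrum:
  "(\<Union>x\<in>{-1..1}. proj_zeros (quadric_form x)) = joint_spectrum"
proof -
  have "\<not> invertible_L2_operator bernoulli_measure (koopman_pencil z) \<longleftrightarrow> (\<exists>x\<in>{-1..1}. quadric_form x z = 0)" for z
    using invertible_koopman_pencil not_invertible_koopman_pencil by blast
  then have "{z. \<not> invertible_L2_operator bernoulli_measure (koopman_pencil z)} - {0}
      = {v. v \<noteq> 0 \<and> (\<exists>x\<in>{-1..1}. quadric_form x v = 0)}" by auto
  then show ?thesis
    unfolding joint_spectrum_def by (auto simp: proj_zeros_def)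
qed

theorem theoremA:
  shows "(\<forall>n z. Determinant.det (pencil_matrix (Suc n) z)
              = Determinant.det (pencil_matrix n (dihedral_map z)))
       \<and> julia_set dihedral_map = (\<Union>x\<in>{-1..1}. proj_zeros (quadric_form x))
       \<and> (\<Union>x\<in>{-1..1}. proj_zeros (quadric_form x)) = joint_spectrum"
  by (intro conjI allI det_pencil_Suc julia_set_dihedral_map quadrics_eq_joint_spectrum)

end
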